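(* Let $R$ be a skew-invertible Hecke symmetry over $\mathbb{C}[[h]]$ of rank $(M|0)$. If $\mathcal{N}_R$ is a scalar matrix, then for any $c\in\mathbb{C}$ all coefficients of the series $$\mathrm{qdet}\,\overline T^+(x)=\mathrm{tr}^R_{1,\dots,M}\,\mathcal{P}^{(M)}\,\overline T_1^+(x)\,\overline T_2^+(xe^{-2h})\cdots\overline T_M^+(xe^{-2(M-1)h})\in\mathbf{D}(\overline R)_c[[x]]$$ belong to the center of the algebra $\mathbf{D}(\overline R)_c$.
   Context: Hecke symmetries. $N\geqslant 2$ is an integer, $h$ a formal parameter, $P=\sum_{i,j}e_{ij}\otimes e_{ji}$ and $I$ (identity) on $\mathbb{C}^N\otimes\mathbb{C}^N$ ($I$ also denotes the identity matrix in $\mathrm{End}\,\mathbb{C}^N$). For $A\in(\mathrm{End}\,\mathbb{C}^N)^{\otimes 2}$ (with any coefficients), $A_{rs}$ denotes $A$ acting on tensor factors $r$ and $s$ (first leg in factor $r$, second leg in factor $s$); e.g. $A_{21}=PA_{12}P$. A Hecke symmetry is $R\in(\mathrm{End}\,\mathbb{C}^N)^{\otimes 2}[[h]]$ with $R_{12}R_{23}R_{12}=R_{23}R_{12}R_{23}$ and $(R-e^hI)(R+e^{-h}I)=0$; it is skew-invertible if there is $\Psi\in(\mathrm{End}\,\mathbb{C}^N)^{\otimes 2}[[h]]$ with $\mathrm{tr}_2R_{12}\Psi_{23}=P_{13}=\mathrm{tr}_2\Psi_{12}R_{23}$. Skew-symmetrizers, rank, $\mathcal{N}_R$, $R$-trace.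 Put $[k]_h=\frac{e^{kh}-e^{-kh}}{e^h-e^{-h}}$ and $\widehat R(x)=R+\frac{(e^h-e^{-h})x}{1-x}I$; so $\widehat R(e^{2kh})=R-\frac{e^{kh}}{[k]_h}I$. The skew-symmetrizers $\mathcal{P}^{(k)}\in(\mathrm{End}\,\mathbb{C}^N)^{\otimes k}[[h]]$ are defined by $\mathcal{P}^{(1)}=I$, $\mathcal{P}^{(k+1)}=(-1)^k[k+1]_h^{-1}\widehat R_{12}(e^{2h})\widehat R_{23}(e^{4h})\cdots\widehat R_{k\,k+1}(e^{2kh})\mathcal{P}^{(k)}_{1\ldots k}$. $R$ has rank $(M|0)$ if the Hilbert–Poincaré series $1+\sum_{k\geqslant1}t^k\,\mathrm{rank}\,\mathcal{P}^{(k)}$ is a polynomial in $t$ of degree $M$. In this case the image of $\mathcal{P}^{(M)}$ is spanned by a single nonzero vector $v_R$, and $\mathcal{N}_R$ is the linear map determined by $R_{12}R_{23}\cdots R_{M\,M+1}(v_R\otimes w)=\mathcal{N}_R(w)\otimes v_R$ for all $w\in\mathbb{C}^N$. With $C=\mathrm{tr}_2\Psi$, the $R$-trace of an $N\times N$ matrix $A$ is $\mathrm{tr}^RA=\mathrm{tr}(AC)$, and $\mathrm{tr}^R_{1,\dots,k}=\mathrm{tr}^R_1\cdots\mathrm{tr}^R_k$ with $\mathrm{tr}_i^R$ the $R$-trace over the $i$-th factor. Multiplicative $R$-matrix. Fix $0\ne a\in\mathbb{C}$; $M$ is the integer in the rank $(M|0)$ of $R$. Let $\overline g(x)\in 1+x\mathbb{C}[[x,h]]$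 be the unique series with $\prod_{k=0}^{M-1}\overline g(xe^{-2kh})=\frac{1-xe^{-2(M-1)h}}{1-x}$, let $\overline f(x)=\frac{1-x}{1-xe^{-2h}}\,\overline g(x)$, and $\overline R(x)=\overline f(x)\big(PR+\frac{(e^h-e^{-h})x}{1-x}P\big)\in(\mathrm{End}\,\mathbb{C}^N)^{\otimes2}[[x,h]]$; all expansions are in nonnegative powers of $x$, so $\overline R(x/y)$ is a series in nonnegative powers of $x/y$, etc. Algebra. $\mathbf{D}(\overline R)_c$ is the topologically free unital $\mathbb{C}[[h]]$-algebra generated by $\overline t_{ij}^{(r)}$ ($1\leqslant i,j\leqslant N$, $r\in\mathbb{Z}$) subject to $\overline R_{12}(x/y)\overline T_1^\pm(x)\overline T_2^\pm(y)=\overline T_2^\pm(y)\overline T_1^\pm(x)\overline R_{12}(x/y)$ (both signs) and $\overline T_1^-(x)\overline T_2^+(y)\overline R_{21}(ye^{-hc/a}/x)=\overline R_{21}(ye^{hc/a}/x)\overline T_2^+(y)\overline T_1^-(x)$, where $\overline T^+(x)=\sum_{i,j}e_{ij}\otimes\sum_{r\geqslant1}\overline t_{ij}^{(-r)}x^{r-1}$, $\overline T^-(x)=\sum_{i,j}e_{ij}\otimes\sum_{r\geqslant0}\overline t_{ij}^{(r)}x^{-r}$, and a subscript $k$ indicates that the matrix part sits in the $k$-th copy of $\mathrm{End}\,\mathbb{C}^N$. (Topologically free: the quotient of the $h$-adically completed free algebra by the smallest $h$-adically closed two-sided ideal $J$ containing the relations and such that $hb\in J$ implies $b\in J$.) 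*)

theory Defs
  imports
    "HOL-Computational_Algebra.Formal_Laurent_Series"
    "HOL-Computational_Algebra.Polynomial_FPS"
    "HOL-Library.Poly_Mapping"
    "HOL-Library.Function_Algebras"
    "HOL-Analysis.Finite_Cartesian_Product"
    "HOL-Algebra.QuotRing"
begin

section \<open>Operators on tensor powers\<close>

text \<open>
  \<open>\<complex>[[h]]\<close> is \<^typ>\<open>complex fps\<close>, and \<open>e\<^sup>c\<^sup>h\<close> is \<^term>\<open>fps_exp c\<close>.  The finite type \<^typ>\<open>'n\<close>
  indexes the standard basis of \<open>\<complex>\<^sup>N\<close>, so \<open>N = CARD('n)\<close>.  Elements of \<open>End \<complex>\<^sup>N\<close> and of
  \<open>(End \<complex>\<^sup>N)\<^sup>\<otimes>\<^sup>2\<close> with coefficients in \<^typ>\<open>'a\<close> are matrices indexed by \<^typ>\<open>'n\<close> and by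
  \<^typ>\<open>'n \<times> 'n\<close>.  As the number \<open>k\<close> of tensor factors varies, an element of
  \<open>(End \<complex>\<^sup>N)\<^sup>\<otimes>\<^sup>k\<close> is a matrix indexed by multi-indices, i.e. lists of length \<open>k\<close>, which vanishes
  on lists of any other length.  Row index first: \<open>A e\<^sub>J = \<Sum>\<^sub>I A I J e\<^sub>I\<close>.
  Tensor factors are numbered from 0, so \<open>A\<^sub>1\<^sub>2\<close> is \<open>leg2 k 0 1 A\<close> and \<open>A\<^sub>2\<^sub>1\<close> is \<open>leg2 k 1 0 A\<close>.
\<close>

type_synonym ('n, 'a) mat1 = "'a ^ 'n ^ 'n"
type_synonym ('n, 'a) mat2 = "'a ^ ('n \<times> 'n) ^ ('n \<times> 'n)"
type_synonym ('n, 'a) tensop = "'n list \<Rightarrow> 'n list \<Rightarrow> 'a"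

definition multi_idx :: "nat \<Rightarrow> 'n list set" where
  "multi_idx k = {I. length I = k}"

definition op_id :: "nat \<Rightarrow> ('n, 'a::semiring_1) tensop" where
  "op_id k = (\<lambda>I J. if I \<in> multi_idx k \<and> I = J then 1 else 0)"

definition op_mult :: "nat \<Rightarrow> ('n::finite, 'a::semiring_1) tensop \<Rightarrow> ('n, 'a) tensop \<Rightarrow> ('n, 'a) tensop"
  where "op_mult k A B = (\<lambda>I J. \<Sum>L\<in>multi_idx k. A I L * B L J)"

definition op_prod :: "nat \<Rightarrow> ('n::finite, 'a::semiring_1) tensop list \<Rightarrow> ('n, 'a) tensop" where
  "op_prod k As = foldr (op_mult k) As (op_id k)"

definition op_apply ::
  "nat \<Rightarrow> ('n::finite, 'a::semiring_1) tensop \<Rightarrow> ('n list \<Rightarrow> 'a) \<Rightarrow> 'n list \<Rightarrow> 'a" where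
  "op_apply k A v = (\<lambda>I. \<Sum>J\<in>multi_idx k. A I J * v J)"

definition leg1 :: "nat \<Rightarrow> nat \<Rightarrow> ('n::finite, 'a::zero) mat1 \<Rightarrow> ('n, 'a) tensop" where
  "leg1 k r A = (\<lambda>I J. if I \<in> multi_idx k \<and> J \<in> multi_idx k \<and> (\<forall>p<k. p \<noteq> r \<longrightarrow> I ! p = J ! p)
     then A $ (I ! r) $ (J ! r) else 0)"

definition leg2 :: "nat \<Rightarrow> nat \<Rightarrow> nat \<Rightarrow> ('n::finite, 'a::zero) mat2 \<Rightarrow> ('n, 'a) tensop" where
  "leg2 k r s A = (\<lambda>I J. if I \<in> multi_idx k \<and> J \<in> multi_idx k \<and>
       (\<forall>p<k. p \<noteq> r \<and> p \<noteq> s \<longrightarrow> I ! p = J ! p)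
     then A $ (I ! r, I ! s) $ (J ! r, J ! s) else 0)"

text \<open>\<open>A \<mapsto> A\<^sub>1\<^sub>.\<^sub>.\<^sub>k\<close>, from \<open>k\<close> to \<open>k + 1\<close> tensor factors.\<close>

definition op_extend :: "('n, 'a::zero) tensop \<Rightarrow> ('n, 'a) tensop" where
  "op_extend A = (\<lambda>I J. if I \<noteq> [] \<and> J \<noteq> [] \<and> last I = last J
     then A (butlast I) (butlast J) else 0)"

text \<open>The trace over factor \<open>r\<close>; the remaining factors are renumbered consecutively.\<close>

definition partial_trace :: "nat \<Rightarrow> ('n::finite, 'a::comm_monoid_add) tensop \<Rightarrow> ('n, 'a) tensop" where
  "partial_trace r A =
     (\<lambda>I J. \<Sum>b\<in>UNIV. A (take r I @ b # drop r I) (take r J @ b # drop r J))"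

text \<open>
  The rank of an operator over \<open>\<complex>[[h]]\<close>: the dimension of its column space over the fraction
  field \<open>\<complex>((h))\<close>.
\<close>

definition fls_scale :: "complex fls \<Rightarrow> ('n list \<Rightarrow> complex fls) \<Rightarrow> 'n list \<Rightarrow> complex fls" where
  "fls_scale c v = (\<lambda>I. c * v I)"

lemma vector_space_fls_scale: "vector_space fls_scale"
  by standard (simp_all add: fls_scale_def fun_eq_iff algebra_simps)

definition op_rank :: "nat \<Rightarrow> ('n, complex fps) tensop \<Rightarrow> nat" where
  "op_rank k A = vector_space.dim fls_scale ((\<lambda>J I. fps_to_fls (A I J)) ` multi_idx k)"

section \<open>Hecke symmetries\<close>

definition flip :: "('n::finite, 'a::zero_neq_one) mat2" where
  "flip = (\<chi> p q. if fst p = snd q \<and> snd p = fst q then 1 else 0)"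

definition hecke_symmetry :: "('n::finite, complex fps) mat2 \<Rightarrow> bool" where
  "hecke_symmetry R \<longleftrightarrow>
     op_prod 3 [leg2 3 0 1 R, leg2 3 1 2 R, leg2 3 0 1 R] =
     op_prod 3 [leg2 3 1 2 R, leg2 3 0 1 R, leg2 3 1 2 R] \<and>
     (R - mat (fps_exp 1)) ** (R + mat (fps_exp (- 1))) = 0"

definition is_skew_inverse ::
  "('n::finite, complex fps) mat2 \<Rightarrow> ('n, complex fps) mat2 \<Rightarrow> bool" where
  "is_skew_inverse R \<Psi> \<longleftrightarrow>
     partial_trace 1 (op_mult 3 (leg2 3 0 1 R) (leg2 3 1 2 \<Psi>)) = leg2 2 0 1 flip \<and>
     partial_trace 1 (op_mult 3 (leg2 3 0 1 \<Psi>) (leg2 3 1 2 R)) = leg2 2 0 1 flip"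

definition skew_invertible :: "('n::finite, complex fps) mat2 \<Rightarrow> bool" where
  "skew_invertible R \<longleftrightarrow> (\<exists>\<Psi>. is_skew_inverse R \<Psi>)"

definition skew_inverse :: "('n::finite, complex fps) mat2 \<Rightarrow> ('n, complex fps) mat2" where
  "skew_inverse R = (SOME \<Psi>. is_skew_inverse R \<Psi>)"

definition C_matrix :: "('n::finite, complex fps) mat2 \<Rightarrow> ('n, complex fps) mat1" where
  "C_matrix R = (\<chi> i j. \<Sum>b\<in>UNIV. skew_inverse R $ (i, b) $ (j, b))"

text \<open>
  \<open>tr\<^sup>R\<^sub>1 \<cdots> tr\<^sup>R\<^sub>k\<close>, with \<open>tr\<^sup>R\<^sub>i A = tr\<^sub>i (A C\<^sub>i)\<close>, for coefficients in any ring; the innermost trace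
  is over the last factor.
\<close>

primrec R_trace :: "('n::finite, 'a::semiring_1) mat1 \<Rightarrow> nat \<Rightarrow> ('n, 'a) tensop \<Rightarrow> 'a" where
  "R_trace C 0 A = A [] []"
| "R_trace C (Suc k) A =
     R_trace C k (partial_trace k (op_mult (Suc k) A (leg1 (Suc k) k C)))"

text \<open>
  In \<open>q_int\<close> and \<open>R_hat\<close> the division is that of \<^typ>\<open>complex fps\<close>, which is exact whenever the
  quotient exists in \<open>\<complex>[[h]]\<close>, as it does for \<open>x = e\<^sup>2\<^sup>k\<^sup>h\<close>.
\<close>

definition q_int :: "nat \<Rightarrow> complex fps" where
  "q_int k = (fps_exp (of_nat k) - fps_exp (- of_nat k)) / (fps_exp 1 - fps_exp (- 1))"

definition R_hat :: "('n::finite, complex fps) mat2 \<Rightarrow> complex fps \<Rightarrow> ('n, complex fps) mat2" where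
  "R_hat R x = R + mat ((fps_exp 1 - fps_exp (- 1)) * x / (1 - x))"

primrec skew_symmetrizer ::
  "('n::finite, complex fps) mat2 \<Rightarrow> nat \<Rightarrow> ('n, complex fps) tensop" where
  "skew_symmetrizer R 0 = op_id 0"
| "skew_symmetrizer R (Suc k) =
     (if k = 0 then op_id 1
      else (\<lambda>I J. (- 1) ^ k * inverse (q_int (k + 1)) *
        op_mult (k + 1)
          (op_prod (k + 1)
            (map (\<lambda>i. leg2 (k + 1) (i - 1) i (R_hat R (fps_exp (2 * of_nat i)))) [1..<k + 1]))
          (op_extend (skew_symmetrizer R k)) I J))"

definition hilbert_series :: "('n::finite, complex fps) mat2 \<Rightarrow> int fps" where
  "hilbert_series R = Abs_fps (\<lambda>k. if k = 0 then 1 else int (op_rank k (skew_symmetrizer R k)))"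

definition has_rank_M0 :: "('n::finite, complex fps) mat2 \<Rightarrow> nat \<Rightarrow> bool" where
  "has_rank_M0 R M \<longleftrightarrow> (\<exists>p. hilbert_series R = fps_of_poly p \<and> degree p = M)"

definition vec1 :: "'a::zero ^ 'n::finite \<Rightarrow> 'n list \<Rightarrow> 'a" where
  "vec1 w = (\<lambda>I. if I \<in> multi_idx 1 then w $ (I ! 0) else 0)"

text \<open>The tensor product of \<open>u\<close>, living on \<open>p\<close> factors, with \<open>v\<close>.\<close>

definition tensor_vec :: "nat \<Rightarrow> ('n list \<Rightarrow> 'a::times) \<Rightarrow> ('n list \<Rightarrow> 'a) \<Rightarrow> 'n list \<Rightarrow> 'a" where
  "tensor_vec p u v = (\<lambda>I. u (take p I) * v (drop p I))"

text \<open>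
  \<open>v\<close> is a nonzero vector spanning the image of \<open>\<P>\<^sup>(\<^sup>M\<^sup>)\<close>.  It is determined up to a unit of
  \<open>\<complex>[[h]]\<close>, on which the matrix singled out by \<open>is_N_R\<close> does not depend.
\<close>

definition is_v_R ::
  "('n::finite, complex fps) mat2 \<Rightarrow> nat \<Rightarrow> ('n list \<Rightarrow> complex fps) \<Rightarrow> bool" where
  "is_v_R R M v \<longleftrightarrow> v \<noteq> (\<lambda>_. 0) \<and>
     range (op_apply M (skew_symmetrizer R M)) = {(\<lambda>I. c * v I) | c. True}"

definition is_N_R ::
  "('n::finite, complex fps) mat2 \<Rightarrow> nat \<Rightarrow> ('n, complex fps) mat1 \<Rightarrow> bool" where
  "is_N_R R M N_R \<longleftrightarrow> (\<exists>v. is_v_R R M v \<and>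
     (\<forall>w :: complex ^ 'n. let w' = (\<chi> i. fps_const (w $ i)) in
       op_apply (M + 1) (op_prod (M + 1) (map (\<lambda>i. leg2 (M + 1) i (i + 1) R) [0..<M]))
         (tensor_vec M v (vec1 w')) =
       tensor_vec 1 (vec1 (N_R *v w')) v))"

definition scalar_matrix :: "('n::finite, 'a::zero) mat1 \<Rightarrow> bool" where
  "scalar_matrix A \<longleftrightarrow> (\<exists>s. A = mat s)"

section \<open>The multiplicative R-matrix\<close>

text \<open>
  \<open>\<complex>[[x,h]]\<close> is \<^typ>\<open>complex fps fps\<close> with \<open>x\<close> as the outer variable.  The substitution
  \<open>x \<mapsto> u x\<close> is \<open>subst_scale u\<close>.
\<close>

definition subst_scale :: "'a::semiring_1 \<Rightarrow> 'a fps \<Rightarrow> 'a fps" where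
  "subst_scale u f = f oo (fps_const u * fps_X)"

text \<open>Division by \<open>1 - u x\<close> in \<open>\<complex>[[x,h]]\<close> is expansion in nonnegative powers of \<open>x\<close>.\<close>

lemma divide_one_minus_mult:
  fixes f :: "complex fps fps"
  shows "f / (1 - fps_const u * fps_X) * (1 - fps_const u * fps_X) = f"
proof -
  let ?g = "1 - fps_const u * fps_X :: complex fps fps"
  have nz: "fps_nth ?g 0 = 1" by simp
  have sd: "subdegree ?g = 0" using nz by (metis subdegree_eq_0 zero_neq_one)
  have g0: "?g \<noteq> 0" using nz by (metis fps_zero_nth zero_neq_one)
  have "inverse (1 :: complex fps) = 1" by (rule fps_inverse_one)
  then have "inverse ?g * ?g = 1"
    using fps_left_inverse'[of 1 ?g] by (simp add: fps_inverse_def[of ?g] fps_left_inverse)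
  then show ?thesis using sd g0 by (simp add: fps_divide_def mult.assoc)
qed

definition g_bar :: "nat \<Rightarrow> complex fps fps" where
  "g_bar M = (THE g. fps_nth g 0 = 1 \<and>
     (\<Prod>k<M. subst_scale (fps_exp (- 2 * of_nat k)) g) =
     (1 - fps_const (fps_exp (- 2 * (of_nat M - 1))) * fps_X) / (1 - fps_X))"

definition f_bar :: "nat \<Rightarrow> complex fps fps" where
  "f_bar M = (1 - fps_X) / (1 - fps_const (fps_exp (- 2)) * fps_X) * g_bar M"

definition R_bar :: "('n::finite, complex fps) mat2 \<Rightarrow> nat \<Rightarrow> ('n, complex fps fps) mat2" where
  "R_bar R M = (\<chi> p q. f_bar M *
     (fps_const ((flip ** R) $ p $ q) +
      fps_const (fps_exp 1 - fps_exp (- 1)) * fps_X / (1 - fps_X) * flip $ p $ q))"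

section \<open>The algebra\<close>

text \<open>
  Words in the generators form a free monoid (written additively, as required for the
  convolution product of \<^typ>\<open>'k \<Rightarrow>\<^sub>0 'a\<close>).  The \<open>h\<close>-adic completion of the free
  \<open>\<complex>[[h]]\<close>-algebra consists of the power series in \<open>h\<close> over the free \<open>\<complex>\<close>-algebra, and the
  topology of type \<open>fps\<close> is the \<open>h\<close>-adic one.  The triple \<open>(i, j, r)\<close> stands for the
  generator \<open>t\<^sub>i\<^sub>j\<^sup>(\<^sup>r\<^sup>)\<close>.
\<close>

datatype 'g free_word = Free_Word (letters: "'g list")

instantiation free_word :: (type) monoid_add
begin

definition zero_free_word :: "'a free_word" where
  "zero_free_word = Free_Word []"

definition plus_free_word :: "'a free_word \<Rightarrow> 'a free_word \<Rightarrow> 'a free_word" where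
  "plus_free_word u v = Free_Word (letters u @ letters v)"

instance
  by standard (simp_all add: zero_free_word_def plus_free_word_def)

end

type_synonym 'n falg = "(('n \<times> 'n \<times> int) free_word \<Rightarrow>\<^sub>0 complex) fps"

definition falg_ring :: "'n falg ring" where
  "falg_ring = \<lparr>carrier = UNIV, monoid.mult = (*), one = 1, zero = 0, add = (+)\<rparr>"

lemma ring_falg_ring: "ring (falg_ring :: 'n falg ring)"
proof (rule ringI)
  show "abelian_group (falg_ring :: 'n falg ring)"
    by (rule abelian_groupI)
      (auto simp: falg_ring_def add.assoc add.commute intro: exI[of _ "- _"] left_minus)
  show "Group.monoid (falg_ring :: 'n falg ring)"
    by (rule monoidI) (auto simp: falg_ring_def mult.assoc)
qed (auto simp: falg_ring_def algebra_simps)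

definition scalar :: "complex fps \<Rightarrow> 'n falg" where
  "scalar f = Abs_fps (\<lambda>n. Poly_Mapping.single 0 (fps_nth f n))"

definition gen :: "'n \<Rightarrow> 'n \<Rightarrow> int \<Rightarrow> 'n falg" where
  "gen i j r = fps_const (Poly_Mapping.single (Free_Word [(i, j, r)]) 1)"

text \<open>The power series \<open>T\<^sup>+(x)\<close>, and the coefficients of \<open>x\<^sup>p\<close>, \<open>p \<in> \<int>\<close>, in \<open>T\<^sup>+(x)\<close> and \<open>T\<^sup>-(x)\<close>.\<close>

definition T_plus :: "('n::finite, 'n falg fps) mat1" where
  "T_plus = (\<chi> i j. Abs_fps (\<lambda>s. gen i j (- int (s + 1))))"

definition T_plus_coeff :: "int \<Rightarrow> ('n::finite, 'n falg) mat1" where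
  "T_plus_coeff p = (\<chi> i j. if p \<ge> 0 then fps_nth (T_plus $ i $ j) (nat p) else 0)"

definition T_minus_coeff :: "int \<Rightarrow> ('n::finite, 'n falg) mat1" where
  "T_minus_coeff p = (\<chi> i j. if p \<le> 0 then gen i j (- p) else 0)"

text \<open>The coefficient of \<open>z\<^sup>k\<close> in a matrix of power series \<open>A(u z)\<close>, as a matrix over the algebra.\<close>

definition mat2_coeff ::
  "('n::finite, complex fps fps) mat2 \<Rightarrow> complex fps \<Rightarrow> nat \<Rightarrow> ('n, 'n falg) mat2" where
  "mat2_coeff A u k = (\<chi> p q. scalar (fps_nth (subst_scale u (A $ p $ q)) k))"

text \<open>
  Matrix entries of the coefficients of \<open>x\<^sup>m y\<^sup>n\<close> (left-hand side minus right-hand side) in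
  \<open>A\<^sub>1\<^sub>2(x/y) T\<^sub>1(x) T\<^sub>2(y) = T\<^sub>2(y) T\<^sub>1(x) A\<^sub>1\<^sub>2(x/y)\<close>, and in
  \<open>T\<^sup>-\<^sub>1(x) T\<^sup>+\<^sub>2(y) A\<^sub>2\<^sub>1(u\<^sup>-\<^sup>1 y/x) = A\<^sub>2\<^sub>1(u y/x) T\<^sup>+\<^sub>2(y) T\<^sup>-\<^sub>1(x)\<close> where \<open>u = e\<^sup>d\<^sup>h\<close>.
  Here \<open>k\<close> is the exponent of \<open>x/y\<close>, respectively \<open>y/x\<close>, contributed by \<open>A\<close>; since \<open>T\<^sup>+\<close>
  (\<open>T\<^sup>-\<close>) has only nonnegative (nonpositive) powers, the sums over \<open>k\<close> have finite support.
\<close>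

definition RTT_relation ::
  "('n::finite, complex fps fps) mat2 \<Rightarrow> (int \<Rightarrow> ('n, 'n falg) mat1) \<Rightarrow> int \<Rightarrow> int \<Rightarrow>
    ('n, 'n falg) tensop" where
  "RTT_relation A T m n = (\<lambda>I J.
     Sum_any (\<lambda>k::nat. op_prod 2
       [leg2 2 0 1 (mat2_coeff A 1 k), leg1 2 0 (T (m - int k)), leg1 2 1 (T (n + int k))] I J) -
     Sum_any (\<lambda>k::nat. op_prod 2
       [leg1 2 1 (T (n + int k)), leg1 2 0 (T (m - int k)), leg2 2 0 1 (mat2_coeff A 1 k)] I J))"

definition mixed_relation ::
  "('n::finite, complex fps fps) mat2 \<Rightarrow> complex \<Rightarrow> int \<Rightarrow> int \<Rightarrow> ('n, 'n falg) tensop" where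
  "mixed_relation A d m n = (\<lambda>I J.
     Sum_any (\<lambda>k::nat. op_prod 2
       [leg1 2 0 (T_minus_coeff (m + int k)), leg1 2 1 (T_plus_coeff (n - int k)),
        leg2 2 1 0 (mat2_coeff A (fps_exp (- d)) k)] I J) -
     Sum_any (\<lambda>k::nat. op_prod 2
       [leg2 2 1 0 (mat2_coeff A (fps_exp d) k),
        leg1 2 1 (T_plus_coeff (n - int k)), leg1 2 0 (T_minus_coeff (m + int k))] I J))"

definition D_relations ::
  "('n::finite, complex fps) mat2 \<Rightarrow> nat \<Rightarrow> complex \<Rightarrow> complex \<Rightarrow> 'n falg set" where
  "D_relations R M a c =
     {RTT_relation (R_bar R M) T_plus_coeff m n I J | m n I J. True} \<union>
     {RTT_relation (R_bar R M) T_minus_coeff m n I J | m n I J. True} \<union>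
     {mixed_relation (R_bar R M) (c / a) m n I J | m n I J. True}"

definition D_ideal ::
  "('n::finite, complex fps) mat2 \<Rightarrow> nat \<Rightarrow> complex \<Rightarrow> complex \<Rightarrow> 'n falg set" where
  "D_ideal R M a c = \<Inter>{J. ideal J falg_ring \<and> closed J \<and> D_relations R M a c \<subseteq> J \<and>
     (\<forall>b. fps_X * b \<in> J \<longrightarrow> b \<in> J)}"

definition D_algebra ::
  "('n::finite, complex fps) mat2 \<Rightarrow> nat \<Rightarrow> complex \<Rightarrow> complex \<Rightarrow> 'n falg set ring" where
  "D_algebra R M a c = falg_ring Quot D_ideal R M a c"

definition D_class ::
  "('n::finite, complex fps) mat2 \<Rightarrow> nat \<Rightarrow> complex \<Rightarrow> complex \<Rightarrow> 'n falg \<Rightarrow> 'n falg set" where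
  "D_class R M a c b = D_ideal R M a c +>\<^bsub>falg_ring\<^esub> b"

definition ring_center :: "('a, 'b) ring_scheme \<Rightarrow> 'a set" where
  "ring_center A = {z \<in> carrier A. \<forall>y \<in> carrier A. z \<otimes>\<^bsub>A\<^esub> y = y \<otimes>\<^bsub>A\<^esub> z}"

text \<open>
  The quantum determinant, as a series in \<open>x\<close> over the completed free algebra; its coefficients
  in \<open>D(R)\<^sub>c\<close> are the classes of the coefficients of this series.
\<close>

definition qdet_T_plus :: "('n::finite, complex fps) mat2 \<Rightarrow> nat \<Rightarrow> 'n falg fps" where
  "qdet_T_plus R M =
     R_trace (\<chi> i j. fps_const (scalar (C_matrix R $ i $ j))) M
       (op_mult M (\<lambda>I J. fps_const (scalar (skew_symmetrizer R M I J)))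
         (op_prod M (map (\<lambda>k. leg1 M k
            (\<chi> i j. subst_scale (scalar (fps_exp (- 2 * of_nat k))) (T_plus $ i $ j))) [0..<M])))"

end

theory Submission
  imports Defs
begin

no_notation fps_nth (infixl "$" 75)

text \<open>
  Write \<open>q = e\<^sup>h\<close> and let \<open>Q(x) = P R(x)\<close> be the braided form of the multiplicative R-matrix.  All relations then
  read \<open>Q\<^sub>i(u z) T\<^sub>i(x) S\<^sub>i\<^sub>+\<^sub>1(y) = S\<^sub>i(y) T\<^sub>i\<^sub>+\<^sub>1(x) Q\<^sub>i(z / u)\<close> with \<open>T = T\<^sup>+\<close>, \<open>z = x / y\<close>, where either
  \<open>S = T\<^sup>+\<close> and \<open>u = 1\<close>, or \<open>S = T\<^sup>-\<close> and \<open>u\<close> is the exponential of the central charge.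

  Specialising the first relation, the factors of the skew-symmetrizer \<open>\<P>\<close> of degree \<open>M\<close> reverse the order of the
  arguments of \<open>T(x) T(x q\<^sup>-\<^sup>2) \<cdots>\<close>; since \<open>\<P>\<close> has rank one, the reversed product \<open>T'\<close> satisfies \<open>T' \<P> = D \<P>\<close> for a
  single series \<open>D\<close>, and the quantum determinant is \<open>D\<close> times the R-trace of \<open>\<P>\<close>.

  Moving \<open>S\<close> through \<open>T'\<close> costs the product of the \<open>Q\<^sub>i\<close> at the arguments \<open>z q\<^sup>-\<^sup>2\<^sup>(\<^sup>M\<^sup>-\<^sup>i\<^sup>)\<close>.  Because the skew-symmetrizer of degree
  \<open>M + 1\<close> vanishes, this product acts on the image of \<open>\<P>\<close> as a scalar series times \<open>R\<^sub>1 \<cdots> R\<^sub>M\<close>, and the normalisation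
  of \<open>Q\<close> makes the scalar equal to 1, whatever \<open>u\<close> is.  When \<open>\<N>\<^sub>R\<close> is scalar, \<open>R\<^sub>1 \<cdots> R\<^sub>M\<close> is a nonzero multiple of the
  cyclic rotation on that image, so \<open>D\<close> commutes with \<open>S\<close>.
\<close>

section \<open>Kernels on multi-indices\<close>

text \<open>Two obstacles shape the argument. Scalars that have to be removed, such as 1 - q^(2k) or
  an entry of the skew-symmetrizer, are nonzero in C[[h]] but need not be units. The ideal of
  relations contains b whenever it contains h b, which licenses cancelling any nonzero scalar; its
  h-adic closedness serves separately, to pass from the generators to the whole completed algebra.
  Moreover Q is a power series in x / y and cannot be evaluated at x / y = q^(2k). It is, however, a
  unit series times a polynomial linear in x / y, and only that polynomial is specialised. The unit
  series comes back in the product of the Q_i, where the functional equation of \<open>g_bar\<close>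
  is exactly what makes all scalar factors cancel. The R-trace of the skew-symmetrizer enters only
  as a central scalar multiplying the eigenvalue, so commutation is needed for the eigenvalue
  alone.\<close>

lemma finite_multi_idx [simp]: "finite (multi_idx k :: 'n::finite list set)"
  using finite_lists_length_eq[of "UNIV :: 'n set" k] by (simp add: multi_idx_def)

lemma mem_multi_idx [simp]: "I \<in> multi_idx k \<longleftrightarrow> length I = k"
  by (simp add: multi_idx_def)

text \<open>
  Operators on all tensor powers at once, so that they form a ring type: operators on \<open>K\<close> factors are the corner of this
  ring cut out by the idempotent \<open>idL K\<close> below, and \<open>Lop K\<close> embeds them.
\<close>

typedef (overloaded) ('n, 'a) lop =
  "{A :: 'n list \<Rightarrow> 'n list \<Rightarrow> 'a::zero. \<forall>I J. length I \<noteq> length J \<longrightarrow> A I J = 0}"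
  morphisms ent Abs_lop
  by (rule exI[of _ "\<lambda>_ _. 0"]) simp

setup_lifting type_definition_lop

lemma ent_eq_0: "length I \<noteq> length J \<Longrightarrow> ent A I J = 0"
  using ent[of A] by simp

lemma lop_eqI: "(\<And>I J. length I = length J \<Longrightarrow> ent A I J = ent B I J) \<Longrightarrow> A = B"
  by (metis ent_eq_0 ent_inject ext)

instantiation lop :: (finite, ring_1) ring_1
begin

lift_definition zero_lop :: "('a, 'b) lop" is "\<lambda>_ _. 0" by simp
lift_definition one_lop :: "('a, 'b) lop" is "\<lambda>I J. if I = J then 1 else 0" by auto
lift_definition plus_lop :: "('a, 'b) lop \<Rightarrow> ('a, 'b) lop \<Rightarrow> ('a, 'b) lop"
  is "\<lambda>A B I J. A I J + B I J" by simp
lift_definition minus_lop :: "('a, 'b) lop \<Rightarrow> ('a, 'b) lop \<Rightarrow> ('a, 'b) lop"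
  is "\<lambda>A B I J. A I J - B I J" by simp
lift_definition uminus_lop :: "('a, 'b) lop \<Rightarrow> ('a, 'b) lop"
  is "\<lambda>A I J. - A I J" by simp
lift_definition times_lop :: "('a, 'b) lop \<Rightarrow> ('a, 'b) lop \<Rightarrow> ('a, 'b) lop"
  is "\<lambda>A B I J. \<Sum>L\<in>multi_idx (length I). A I L * B L J"
  by (auto intro!: sum.neutral)

instance
proof
  fix A B C :: "('a, 'b) lop"
  show "A * B * C = A * (B * C)"
  proof (rule lop_eqI)
    fix I J :: "'a list"
    show "ent (A * B * C) I J = ent (A * (B * C)) I J"
      by (simp add: times_lop.rep_eq sum_distrib_left sum_distrib_right mult.assoc)
        (rule sum.swap)
  qed
  show "1 * A = A" "A * 1 = A"
    by (rule lop_eqI; simp add: times_lop.rep_eq one_lop.rep_eq if_distrib if_distribR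
        sum.delta sum.delta' cong: if_cong)+
  show "(0::('a, 'b) lop) \<noteq> 1"
    by (metis one_lop.rep_eq zero_lop.rep_eq zero_neq_one)
qed (rule lop_eqI; simp add: plus_lop.rep_eq minus_lop.rep_eq uminus_lop.rep_eq zero_lop.rep_eq
    times_lop.rep_eq sum.distrib algebra_simps)+

end

lemmas ent_simps [simp] = zero_lop.rep_eq plus_lop.rep_eq minus_lop.rep_eq uminus_lop.rep_eq

lemma ent_mult: "length I = K \<Longrightarrow> ent (A * B) I J = (\<Sum>L\<in>multi_idx K. ent A I L * ent B L J)"
  by (simp add: times_lop.rep_eq)

lift_definition Lop :: "nat \<Rightarrow> ('n, 'a::zero) tensop \<Rightarrow> ('n, 'a) lop"
  is "\<lambda>K A I J. if length I = K \<and> length J = K then A I J else 0" by auto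

lemma ent_Lop: "ent (Lop K A) I J = (if length I = K \<and> length J = K then A I J else 0)"
  by (simp add: Lop.rep_eq)

lemma Lop_op_mult: "Lop K (op_mult K A B) = Lop K A * Lop K B"
  by (rule lop_eqI) (auto simp: ent_Lop op_mult_def times_lop.rep_eq)

text \<open>The identity of degree \<open>K\<close> has to be kept on the right: the empty
  \<open>prod_list\<close> is the identity on all tensor powers, the empty \<open>op_prod K\<close>
  only on \<open>K\<close> factors.\<close>

lemma Lop_op_prod: "Lop K (op_prod K As) = prod_list (map (Lop K) As) * Lop K (op_id K)"
  by (induction As) (simp_all add: op_prod_def Lop_op_mult mult.assoc)

lemma Lop_id_mult [simp]: "Lop K (op_id K) * Lop K A = Lop K A"
proof (rule lop_eqI)
  fix I J :: "'a list"
  show "ent (Lop K (op_id K) * Lop K A) I J = ent (Lop K A) I J"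
    by (cases "length I = K")
      (simp_all add: ent_Lop op_id_def times_lop.rep_eq mult_delta_left sum.delta)
qed

lemma Lop_mult_id [simp]: "Lop K A * Lop K (op_id K) = Lop K A"
proof (rule lop_eqI)
  fix I J :: "'a list"
  assume "length I = length J"
  then show "ent (Lop K A * Lop K (op_id K)) I J = ent (Lop K A) I J"
    by (cases "length I = K")
      (simp_all add: ent_Lop op_id_def times_lop.rep_eq mult_delta_right sum.delta')
qed

lift_definition smul :: "'a \<Rightarrow> ('n::finite, 'a::ring_1) lop \<Rightarrow> ('n, 'a) lop"
  is "\<lambda>c A I J. c * A I J" by simp

lemma ent_smul [simp]: "ent (smul c A) I J = c * ent A I J"
  by (simp add: smul.rep_eq)

lemma smul_mult_left: "smul c A * B = smul c (A * B)"
  by (rule lop_eqI) (simp add: times_lop.rep_eq sum_distrib_left mult.assoc)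

lemma smul_mult_right:
  assumes "\<And>I J. c * ent A I J = ent A I J * c"
  shows "A * smul c B = smul c (A * B)"
  by (rule lop_eqI) (simp add: times_lop.rep_eq sum_distrib_left assms flip: mult.assoc)

lemma smul_mult_right_comm: "A * smul (c :: 'a :: comm_ring_1) B = smul c (A * B)"
  by (rule smul_mult_right) (rule mult.commute)

lemma smul_add: "smul c (A + B) = smul c A + smul c B"
  and smul_add_left: "smul (c + d) A = smul c A + smul d A"
  and smul_diff: "smul c (A - B) = smul c A - smul c B"
  and smul_diff_left: "smul (c - d) A = smul c A - smul d A"
  and smul_smul: "smul c (smul d A) = smul (c * d) A"
  and smul_0 [simp]: "smul c 0 = 0"
  and smul_0_left [simp]: "smul 0 A = 0"
  and smul_1 [simp]: "smul 1 A = A"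
  and smul_minus: "smul (- c) A = - smul c A"
  by (rule lop_eqI; simp add: algebra_simps)+

lemma smul_cancel:
  fixes c :: "'a::idom"
  assumes "smul c A = 0" "c \<noteq> 0"
  shows "A = 0"
proof (rule lop_eqI)
  fix I J
  have "c * ent A I J = 0"
    using arg_cong[OF assms(1), of "\<lambda>A. ent A I J"] by simp
  then show "ent A I J = ent 0 I J" using assms(2) by simp
qed

text \<open>Operator identities are proved over the commutative rings C[[h]] and C[[x,h]] and then
  carried entrywise to series rings over the noncommutative algebra.\<close>

locale ring_hom1 =
  fixes \<phi> :: "'a::ring_1 \<Rightarrow> 'b::ring_1"
  assumes add: "\<phi> (x + y) = \<phi> x + \<phi> y" and mult: "\<phi> (x * y) = \<phi> x * \<phi> y" and one: "\<phi> 1 = 1"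
begin

lemma zero: "\<phi> 0 = 0"
  using add[of 0 0] by simp

lemma minus: "\<phi> (- x) = - \<phi> x"
  using add[of x "- x"] by (simp add: zero add_eq_0_iff)

lemma diff: "\<phi> (x - y) = \<phi> x - \<phi> y"
  using add[of x "- y"] by (simp add: minus)

lemma sum: "\<phi> (sum f S) = (\<Sum>x\<in>S. \<phi> (f x))"
  by (induction S rule: infinite_finite_induct) (simp_all add: zero add)

lemma power: "\<phi> (x ^ n) = \<phi> x ^ n"
  by (induction n) (simp_all add: one mult)

end

text \<open>The guard on lengths keeps the result inside the type for an arbitrary
  \<open>\<phi>\<close>, which need not preserve 0; for a homomorphism it has no effect.\<close>

lift_definition lop_map :: "('a::ring_1 \<Rightarrow> 'b::ring_1) \<Rightarrow> ('n::finite, 'a) lop \<Rightarrow> ('n, 'b) lop"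
  is "\<lambda>\<phi> A I J. if length I = length J then \<phi> (A I J) else 0" by simp

lemma (in ring_hom1) ent_lop_map: "ent (lop_map \<phi> A) I J = \<phi> (ent A I J)"
  by (simp add: lop_map.rep_eq zero ent_eq_0)

lemma (in ring_hom1) lop_map: "ring_hom1 (lop_map \<phi> :: ('n::finite, 'a) lop \<Rightarrow> ('n, 'b) lop)"
  by unfold_locales (rule lop_eqI; simp add: ent_lop_map add times_lop.rep_eq sum mult one_lop.rep_eq one
      zero)+

lemma (in ring_hom1) lop_map_smul: "lop_map \<phi> (smul c A) = smul (\<phi> c) (lop_map \<phi> A)"
  by (rule lop_eqI) (simp add: ent_lop_map mult)

lemma (in ring_hom1) prod_list: "\<phi> (prod_list xs) = prod_list (map \<phi> xs)"
  by (induction xs) (simp_all add: one mult)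

section \<open>Operators on one or two tensor factors\<close>

lemma list_eq_upd1:
  assumes "length I = length J" "r < length I" "\<forall>p<length I. p \<noteq> r \<longrightarrow> I ! p = J ! p"
  shows "J = I[r := J ! r]"
  using assms by (intro nth_equalityI) (auto simp: nth_list_update)

lemma list_eq_upd2:
  assumes "length I = length J" "r < length I" "s < length I" "\<forall>p<length I. p \<noteq> r \<and> p \<noteq> s \<longrightarrow> I ! p = J ! p"
  shows "J = I[r := J ! r, s := J ! s]"
  using assms by (intro nth_equalityI) (auto simp: nth_list_update)

text \<open>Of all multi-indices only those agreeing with \<open>I\<close> off position
  \<open>r\<close> contribute. With \<open>leg2_mult\<close> this reduces identities between legs to
  list updates.\<close>

lemma leg1_mult:
  assumes "length I = K" "r < K"
  shows "ent (Lop K (leg1 K r A) * X) I J = (\<Sum>a\<in>UNIV. A $ (I ! r) $ a * ent X (I[r := a]) J)"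
proof -
  have "ent (Lop K (leg1 K r A) * X) I J =
    (\<Sum>L\<in>multi_idx K. leg1 K r A I L * ent X L J)"
    using assms by (simp add: ent_mult ent_Lop)
  also have "\<dots> = (\<Sum>L\<in>(\<lambda>a. I[r := a]) ` UNIV. leg1 K r A I L * ent X L J)"
  proof (rule sum.mono_neutral_right)
    show "\<forall>L\<in>multi_idx K - range (\<lambda>a. I[r := a]). leg1 K r A I L * ent X L J = 0"
    proof
      fix L assume L: "L \<in> multi_idx K - range (\<lambda>a. I[r := a])"
      then have "L \<noteq> I[r := L ! r]" by blast
      then show "leg1 K r A I L * ent X L J = 0"
        using assms list_eq_upd1[of I L r] L by (auto simp: leg1_def)
    qed
  qed (use assms in auto)
  also have "\<dots> = (\<Sum>a\<in>UNIV. leg1 K r A I (I[r := a]) * ent X (I[r := a]) J)"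
    by (subst sum.reindex[OF injI]) (use assms in \<open>metis nth_list_update_eq\<close>, simp)
  also have "\<dots> = (\<Sum>a\<in>UNIV. A $ (I ! r) $ a * ent X (I[r := a]) J)"
    using assms by (intro sum.cong) (auto simp: leg1_def)
  finally show ?thesis .
qed

lemma leg2_mult:
  assumes "length I = K" "r < K" "s < K" "r \<noteq> s"
  shows "ent (Lop K (leg2 K r s A) * X) I J =
    (\<Sum>p\<in>UNIV. A $ (I ! r, I ! s) $ p * ent X (I[r := fst p, s := snd p]) J)"
proof -
  let ?f = "\<lambda>(a, b). I[r := a, s := b]"
  have inj: "inj ?f"
  proof (rule injI, clarify)
    fix a b a' b' assume "I[r := a, s := b] = I[r := a', s := b']"
    then show "a = a' \<and> b = b'"
      using assms by (metis length_list_update nth_list_update_eq nth_list_update_neq)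
  qed
  have "ent (Lop K (leg2 K r s A) * X) I J =
    (\<Sum>L\<in>multi_idx K. leg2 K r s A I L * ent X L J)"
    using assms by (simp add: ent_mult ent_Lop)
  also have "\<dots> = (\<Sum>L\<in>range ?f. leg2 K r s A I L * ent X L J)"
  proof (rule sum.mono_neutral_right)
    show "\<forall>L\<in>multi_idx K - range ?f. leg2 K r s A I L * ent X L J = 0"
    proof
      fix L assume L: "L \<in> multi_idx K - range ?f"
      then have "L \<noteq> ?f (L ! r, L ! s)" by blast
      then show "leg2 K r s A I L * ent X L J = 0"
        using assms list_eq_upd2[of I L r s] L by (auto simp: leg2_def)
    qed
  qed (use assms in auto)
  also have "\<dots> = (\<Sum>p\<in>UNIV. leg2 K r s A I (I[r := fst p, s := snd p]) * ent X (I[r := fst p, s := snd p]) J)"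
    by (subst sum.reindex[OF inj]) (auto intro!: sum.cong)
  also have "\<dots> = (\<Sum>p\<in>UNIV. A $ (I ! r, I ! s) $ p * ent X (I[r := fst p, s := snd p]) J)"
    using assms by (intro sum.cong) (auto simp: leg2_def)
  finally show ?thesis .
qed

abbreviation idL :: "nat \<Rightarrow> ('n::finite, 'a::ring_1) lop" where
  "idL K \<equiv> Lop K (op_id K)"

lemma ent_Lop_mult_0: "length I \<noteq> K \<Longrightarrow> ent (Lop K A * X) I J = 0"
  by (simp add: times_lop.rep_eq ent_Lop)

lemma Lop_mult_eqI:
  assumes "\<And>I J. length I = K \<Longrightarrow> ent (Lop K A * X) I J = ent (Lop K B * Y) I J"
  shows "Lop K A * X = Lop K B * Y"
  by (rule lop_eqI) (metis assms ent_Lop_mult_0)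

lemma leg1_leg2_commute:
  assumes "r < K" "s < K" "t < K" "r \<noteq> s" "t \<noteq> r" "t \<noteq> s"
    and comm: "\<And>p q a b. A $ p $ q * T $ a $ b = T $ a $ b * A $ p $ q"
  shows "Lop K (leg2 K r s A) * Lop K (leg1 K t T) = Lop K (leg1 K t T) * Lop K (leg2 K r s A)"
proof -
  \<comment> \<open>The trailing \<open>idL K\<close> gives the last leg an operator to act on, so
    that the two update formulas apply to every factor; it is absorbed at the end.\<close>
  have "Lop K (leg2 K r s A) * (Lop K (leg1 K t T) * idL K) =
    Lop K (leg1 K t T) * (Lop K (leg2 K r s A) * idL K)" (is "?l = ?r")
  proof (rule Lop_mult_eqI)
    fix I J :: "'a list" assume len: "length I = K"
    have upd: "I[t := c, r := a, s := b] = I[r := a, s := b, t := c]" for a b c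
      using assms by (metis list_update_swap)
    have "ent ?l I J = (\<Sum>p\<in>UNIV. A $ (I ! r, I ! s) $ p *
        (\<Sum>c\<in>UNIV. T $ (I ! t) $ c * ent (idL K) (I[r := fst p, s := snd p, t := c]) J))"
      using len assms by (simp add: leg2_mult leg1_mult del: Lop_mult_id)
    also have "\<dots> = (\<Sum>c\<in>UNIV. \<Sum>p\<in>UNIV. A $ (I ! r, I ! s) $ p *
        (T $ (I ! t) $ c * ent (idL K) (I[r := fst p, s := snd p, t := c]) J))"
      by (subst sum.swap) (simp add: sum_distrib_left)
    also have "\<dots> = (\<Sum>c\<in>UNIV. \<Sum>p\<in>UNIV. T $ (I ! t) $ c * (A $ (I ! r, I ! s) $ p *
        ent (idL K) (I[t := c, r := fst p, s := snd p]) J))"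
      by (simp add: upd comm flip: mult.assoc)
    also have "\<dots> = ent ?r I J"
      using len assms by (simp add: leg2_mult leg1_mult sum_distrib_left del: Lop_mult_id)
    finally show "ent ?l I J = ent ?r I J" .
  qed
  then show ?thesis by simp
qed

text \<open>The entry of \<open>T\<close> stands to the left of that of \<open>S\<close>: over a
  noncommutative ring this is T_1 S_2, in general different from S_2 T_1.\<close>

definition kron :: "('n::finite, 'a::times) mat1 \<Rightarrow> ('n, 'a) mat1 \<Rightarrow> ('n, 'a) mat2" where
  "kron T S = (\<chi> p q. T $ fst p $ fst q * S $ snd p $ snd q)"

lemma leg1_leg1:
  assumes "r < K" "s < K" "r \<noteq> s"
  shows "Lop K (leg1 K r T) * Lop K (leg1 K s S) = Lop K (leg2 K r s (kron T S))"
proof -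
  have "Lop K (leg1 K r T) * (Lop K (leg1 K s S) * idL K) = Lop K (leg2 K r s (kron T S)) * idL K"
    (is "?l = ?r")
  proof (rule Lop_mult_eqI)
    fix I J :: "'a list" assume len: "length I = K"
    have "ent ?l I J = (\<Sum>a\<in>UNIV. \<Sum>b\<in>UNIV. T $ (I ! r) $ a * (S $ (I ! s) $ b *
        ent (idL K) (I[r := a, s := b]) J))"
      using len assms by (simp add: leg1_mult sum_distrib_left del: Lop_mult_id)
    also have "\<dots> = ent ?r I J"
      using len assms
      by (simp add: leg2_mult kron_def sum.cartesian_product case_prod_beta mult.assoc del: Lop_mult_id)
    finally show "ent ?l I J = ent ?r I J" .
  qed
  then show ?thesis by simp
qed

lemma leg2_leg2:
  assumes "r < K" "s < K" "r \<noteq> s"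
  shows "Lop K (leg2 K r s A) * Lop K (leg2 K r s B) = Lop K (leg2 K r s (A ** B))"
proof -
  have "Lop K (leg2 K r s A) * (Lop K (leg2 K r s B) * idL K) = Lop K (leg2 K r s (A ** B)) * idL K"
    (is "?l = ?r")
  proof (rule Lop_mult_eqI)
    fix I J :: "'a list" assume len: "length I = K"
    have upd: "I[r := a, s := b, r := c, s := d] = I[r := c, s := d]" for a b c d
      using assms(3) by (metis list_update_overwrite list_update_swap)
    have "ent ?l I J = (\<Sum>q\<in>UNIV. \<Sum>p\<in>UNIV. A $ (I ! r, I ! s) $ q * (B $ q $ p *
        ent (idL K) (I[r := fst p, s := snd p]) J))"
      using len assms by (simp add: leg2_mult sum_distrib_left upd del: Lop_mult_id)
    also have "\<dots> = ent ?r I J"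
      using len assms
      by (subst sum.swap) (simp add: leg2_mult matrix_matrix_mult_def sum_distrib_right mult.assoc del:
          Lop_mult_id)
    finally show "ent ?l I J = ent ?r I J" .
  qed
  then show ?thesis by simp
qed

lemma leg2_leg2_commute:
  fixes A B :: "('n::finite, 'a::ring_1) mat2"
  assumes "r < K" "s < K" "t < K" "u < K" "r \<noteq> s" "t \<noteq> u" "t \<notin> {r, s}" "u \<notin> {r, s}"
    and comm: "\<And>p q a b. A $ p $ q * B $ a $ b = B $ a $ b * A $ p $ q"
  shows "Lop K (leg2 K r s A) * Lop K (leg2 K t u B) = Lop K (leg2 K t u B) * Lop K (leg2 K r s A)"
proof -
  have "Lop K (leg2 K r s A) * (Lop K (leg2 K t u B) * idL K) =
    Lop K (leg2 K t u B) * (Lop K (leg2 K r s A) * idL K)" (is "?l = ?r")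
  proof (rule Lop_mult_eqI)
    fix I J :: "'n list" assume len: "length I = K"
    have upd: "I[t := c, u := d, r := a, s := b] = I[r := a, s := b, t := c, u := d]" for a b c d
      using assms len by (intro nth_equalityI) (auto simp: nth_list_update)
    have "ent ?l I J = (\<Sum>p\<in>UNIV. A $ (I ! r, I ! s) $ p * (\<Sum>q\<in>UNIV. B $ (I ! t, I ! u) $ q *
        ent (idL K) (I[r := fst p, s := snd p, t := fst q, u := snd q]) J))"
      using len assms by (simp add: leg2_mult del: Lop_mult_id)
    also have "\<dots> = (\<Sum>q\<in>UNIV. \<Sum>p\<in>UNIV. A $ (I ! r, I ! s) $ p * (B $ (I ! t, I ! u) $ q *
        ent (idL K) (I[r := fst p, s := snd p, t := fst q, u := snd q]) J))"
      by (subst sum.swap) (simp add: sum_distrib_left)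
    also have "\<dots> = (\<Sum>q\<in>UNIV. \<Sum>p\<in>UNIV. B $ (I ! t, I ! u) $ q * (A $ (I ! r, I ! s) $ p *
        ent (idL K) (I[t := fst q, u := snd q, r := fst p, s := snd p]) J))"
      by (simp add: upd comm flip: mult.assoc)
    also have "\<dots> = ent ?r I J"
      using len assms by (simp add: leg2_mult sum_distrib_left del: Lop_mult_id)
    finally show "ent ?l I J = ent ?r I J" .
  qed
  then show ?thesis by simp
qed

lemma Lop_leg2_add: "Lop K (leg2 K r s (A + B)) = Lop K (leg2 K r s A) + Lop K (leg2 K r s B)"
  by (rule lop_eqI) (auto simp: ent_Lop leg2_def)

lemma Lop_leg2_diff: "Lop K (leg2 K r s (A - B)) = Lop K (leg2 K r s A) - Lop K (leg2 K r s B)"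
  by (rule lop_eqI) (auto simp: ent_Lop leg2_def)

lemma Lop_leg2_smult: "Lop K (leg2 K r s (\<chi> p q. c * A $ p $ q)) = smul c (Lop K (leg2 K r s A))"
  by (rule lop_eqI) (auto simp: ent_Lop leg2_def)

lemma Lop_leg2_mat:
  assumes "r < K" "s < K"
  shows "Lop K (leg2 K r s (mat c)) = smul c (idL K)"
proof (rule lop_eqI)
  fix I J :: "'a list"
  have "(\<forall>p<K. p \<noteq> r \<and> p \<noteq> s \<longrightarrow> I ! p = J ! p) \<and> I ! r = J ! r \<and> I ! s = J ! s \<longleftrightarrow> I = J"
    if "length I = K" "length J = K"
    using that assms by (metis nth_equalityI)
  then show "ent (Lop K (leg2 K r s (mat c))) I J = ent (smul c (idL K)) I J"
    by (auto simp: ent_Lop leg2_def mat_def op_id_def)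
qed

lemma (in ring_hom1) lop_map_Lop: "lop_map \<phi> (Lop K A) = Lop K (\<lambda>I J. \<phi> (A I J))"
  by (rule lop_eqI) (auto simp: ent_lop_map ent_Lop zero)

lemma (in ring_hom1) lop_map_leg2:
  "lop_map \<phi> (Lop K (leg2 K r s A)) = Lop K (leg2 K r s (\<chi> p q. \<phi> (A $ p $ q)))"
  by (rule lop_eqI) (auto simp: ent_lop_map ent_Lop leg2_def zero)

lemma (in ring_hom1) lop_map_leg1:
  "lop_map \<phi> (Lop K (leg1 K r A)) = Lop K (leg1 K r (\<chi> p q. \<phi> (A $ p $ q)))"
  by (rule lop_eqI) (auto simp: ent_lop_map ent_Lop leg1_def zero)

text \<open>The braid relation is given on three factors only. Freezing all positions outside a
  window of three turns a product of neighbouring legs among \<open>K\<close> factors into the same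
  product on three; the offsets 0 and 1 select the two neighbouring pairs.\<close>

lemma leg2_braid_shift:
  fixes A B C :: "('n::finite, 'a::ring_1) mat2"
  assumes K: "Suc (Suc i) < K"
  assumes rst: "r \<le> 1" "s \<le> 1" "t \<le> 1"
  assumes I: "length I = K"
  shows "ent (Lop K (leg2 K (i + r) (Suc (i + r)) A) * (Lop K (leg2 K (i + s) (Suc (i + s)) B) *
      (Lop K (leg2 K (i + t) (Suc (i + t)) C) * idL K))) I J =
    (\<Sum>L\<in>multi_idx 3. op_prod 3 [leg2 3 r (Suc r) A, leg2 3 s (Suc s) B, leg2 3 t (Suc t) C] [I ! i, I ! (i
        + 1), I ! (i + 2)] L *
       ent (idL K) (I[i := L ! 0, i + 1 := L ! 1, i + 2 := L ! 2]) J)"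
proof -
  define w where "w = (\<lambda>L. I[i := L ! 0, i + 1 := L ! 1, i + 2 := L ! 2])"
  have win: "ent (Lop K (leg2 K (i + r) (Suc (i + r)) D) * X) (w L) J =
     (\<Sum>N\<in>multi_idx 3. leg2 3 r (Suc r) D L N * ent X (w N) J)"
    if rr: "r \<le> 1" and L: "length L = 3" for D :: "('n, 'a) mat2" and X L r
  proof -
    have "(\<Sum>N\<in>multi_idx 3. leg2 3 r (Suc r) D L N * ent X (w N) J) =
      ent (Lop 3 (leg2 3 r (Suc r) D) * Lop 3 (\<lambda>N _. ent X (w N) J)) L L"
      using L by (simp add: ent_mult ent_Lop)
    also have "\<dots> = (\<Sum>p\<in>UNIV. D $ (L ! r, L ! Suc r) $ p * ent X (w (L[r := fst p, Suc r := snd p])) J)"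
      using rr L by (simp add: leg2_mult ent_Lop)
    also have "\<dots> = ent (Lop K (leg2 K (i + r) (Suc (i + r)) D) * X) (w L) J"
    proof -
      have len: "length (w L) = K" using I by (simp add: w_def)
      have r01: "r = 0 \<or> r = 1" using rr by auto
      have upd: "(w L)[i + r := a, Suc (i + r) := b] = w (L[r := a, Suc r := b])" for a b
        using r01 L I K by (auto intro!: nth_equalityI simp: nth_list_update w_def)
      have nth: "w L ! (i + r) = L ! r" "w L ! Suc (i + r) = L ! Suc r"
        using r01 L I K by (auto simp: nth_list_update numeral_2_eq_2 w_def)
      show ?thesis
        using rr K by (simp add: leg2_mult[OF len] nth upd)
    qed
    finally show ?thesis by simp
  qed
  define I3 where "I3 = [I ! i, I ! (i + 1), I ! (i + 2)]"
  have wI: "w I3 = I" and I3: "length I3 = 3"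
    using K I by (auto intro!: nth_equalityI simp: nth_list_update numeral_2_eq_2 w_def I3_def)
  have op: "op_prod 3 [leg2 3 r (Suc r) A, leg2 3 s (Suc s) B, leg2 3 t (Suc t) C] I0 L =
    (\<Sum>M\<in>multi_idx 3. leg2 3 r (Suc r) A I0 M * (\<Sum>N\<in>multi_idx 3. leg2 3 s (Suc s) B M N * leg2 3 t (Suc t)
        C N L))"
    if "length L = 3" for L I0
    using that by (simp add: op_prod_def op_mult_def op_id_def mult_delta_right sum.delta')
  have "ent (Lop K (leg2 K (i + r) (Suc (i + r)) A) * (Lop K (leg2 K (i + s) (Suc (i + s)) B) *
      (Lop K (leg2 K (i + t) (Suc (i + t)) C) * idL K))) (w I3) J =
    (\<Sum>M\<in>multi_idx 3. leg2 3 r (Suc r) A I3 M * (\<Sum>N\<in>multi_idx 3. leg2 3 s (Suc s) B M N *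
      (\<Sum>L\<in>multi_idx 3. leg2 3 t (Suc t) C N L * ent (idL K) (w L) J)))"
    by (simp add: win[OF rst(1)] win[OF rst(2)] win[OF rst(3)] I3 del: Lop_mult_id)
  also have "\<dots> = (\<Sum>M\<in>multi_idx 3. \<Sum>L\<in>multi_idx 3. \<Sum>N\<in>multi_idx 3. leg2 3 r (Suc r) A I3 M *
      (leg2 3 s (Suc s) B M N * (leg2 3 t (Suc t) C N L * ent (idL K) (w L) J)))"
    unfolding sum_distrib_left by (rule sum.cong[OF refl], rule sum.swap)
  also have "\<dots> = (\<Sum>L\<in>multi_idx 3. op_prod 3 [leg2 3 r (Suc r) A, leg2 3 s (Suc s) B, leg2 3 t (Suc t) C]
      I3 L *
       ent (idL K) (w L) J)"
    by (subst sum.swap) (simp add: op sum_distrib_left sum_distrib_right mult.assoc)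
  finally show ?thesis unfolding wI unfolding I3_def w_def .
qed

abbreviation RL :: "('n::finite, 'a::ring_1) mat2 \<Rightarrow> nat \<Rightarrow> nat \<Rightarrow> ('n, 'a) lop" where
  "RL R K i \<equiv> Lop K (leg2 K i (Suc i) R)"

lemma hecke_braid:
  fixes R :: "('n::finite, complex fps) mat2"
  assumes "hecke_symmetry R" "Suc (Suc i) < K"
  shows "RL R K i * Lop K (leg2 K (Suc i) (Suc (Suc i)) R) * RL R K i =
    Lop K (leg2 K (Suc i) (Suc (Suc i)) R) * RL R K i * Lop K (leg2 K (Suc i) (Suc (Suc
        i)) R)"
proof -
  have h: "op_prod 3 [leg2 3 0 (Suc 0) R, leg2 3 1 (Suc 1) R, leg2 3 0 (Suc 0) R] =
    op_prod 3 [leg2 3 1 (Suc 1) R, leg2 3 0 (Suc 0) R, leg2 3 1 (Suc 1) R]"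
    using assms(1) by (simp add: hecke_symmetry_def numeral_2_eq_2)
  have "Lop K (leg2 K (i + 0) (Suc (i + 0)) R) * (Lop K (leg2 K (i + 1) (Suc (i + 1)) R) * (Lop K (leg2 K
      (i + 0) (Suc (i + 0)) R) * idL K)) =
    Lop K (leg2 K (i + 1) (Suc (i + 1)) R) * (Lop K (leg2 K (i + 0) (Suc (i + 0)) R) * (Lop K (leg2 K (i +
        1) (Suc (i + 1)) R) * idL K))"
  proof (rule Lop_mult_eqI)
    fix I J :: "'n list" assume len: "length I = K"
    note shift = leg2_braid_shift[OF assms(2) _ _ _ len, of _ _ _ R R R J]
    show "ent (Lop K (leg2 K (i + 0) (Suc (i + 0)) R) * (Lop K (leg2 K (i + 1) (Suc (i + 1)) R) *
        (Lop K (leg2 K (i + 0) (Suc (i + 0)) R) * idL K))) I J =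
      ent (Lop K (leg2 K (i + 1) (Suc (i + 1)) R) * (Lop K (leg2 K (i + 0) (Suc (i + 0)) R) *
        (Lop K (leg2 K (i + 1) (Suc (i + 1)) R) * idL K))) I J"
      unfolding shift[of 0 1 0, OF le0 order_refl le0] shift[of 1 0 1, OF order_refl le0 order_refl] h ..
  qed
  then show ?thesis by (simp add: mult.assoc)
qed

lemma hecke_quadratic:
  fixes R :: "('n::finite, complex fps) mat2"
  assumes "hecke_symmetry R" "Suc i < K"
  shows "RL R K i * RL R K i =
    smul (fps_exp 1 - fps_exp (-1)) (RL R K i) + idL K"
proof -
  let ?r = "RL R K i"
  have z: "Lop K (leg2 K i (Suc i) (0 :: ('n, complex fps) mat2)) = 0"
    by (rule lop_eqI) (simp add: ent_Lop leg2_def)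
  have "(?r - smul (fps_exp 1) (idL K)) * (?r + smul (fps_exp (-1)) (idL K)) = 0"
    using assms leg2_leg2[of i K "Suc i" "R - mat (fps_exp 1)" "R + mat (fps_exp (-1))"]
    by (simp add: hecke_symmetry_def Lop_leg2_diff Lop_leg2_add Lop_leg2_mat z)
  moreover have "fps_exp (1 :: complex) * fps_exp (-1) = 1" "fps_exp (-1 :: complex) * fps_exp 1 = 1"
    by (simp_all flip: fps_exp_add_mult)
  ultimately show ?thesis
    by (simp add: algebra_simps smul_mult_left smul_mult_right_comm smul_smul smul_diff_left smul_diff)
qed

section \<open>Adjoining a tensor factor\<close>

text \<open>Tensoring with the identity on a new last factor. This is multiplicative but not unital:
  \<open>op_extend\<close> vanishes on the empty index, so 1 is not preserved.\<close>

lift_definition lext :: "('n::finite, 'a::ring_1) lop \<Rightarrow> ('n, 'a) lop"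
  is "op_extend"
proof -
  fix A :: "'n list \<Rightarrow> 'n list \<Rightarrow> 'a" and I J :: "'n list"
  assume "\<And>I J. length I \<noteq> length J \<Longrightarrow> A I J = 0" "length I \<noteq> length J"
  then show "op_extend A I J = 0"
    by (cases I rule: rev_cases; cases J rule: rev_cases) (auto simp: op_extend_def)
qed

lemma ent_lext: "ent (lext A) (I @ [i]) (J @ [j]) = (if i = j then ent A I J else 0)"
  by (simp add: lext.rep_eq op_extend_def)

lemma ent_lext_Nil: "ent (lext A) [] J = 0" "ent (lext A) I [] = 0"
  by (simp_all add: lext.rep_eq op_extend_def)

lemma sum_multi_idx_Suc:
  fixes f :: "'n::finite list \<Rightarrow> 'a::comm_monoid_add"
  shows "(\<Sum>L\<in>multi_idx (Suc k). f L) = (\<Sum>L\<in>multi_idx k. \<Sum>l\<in>UNIV. f (L @ [l]))"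
proof -
  have "(\<Sum>L\<in>multi_idx k. \<Sum>l\<in>UNIV. f (L @ [l])) = (\<Sum>(L, l)\<in>multi_idx k \<times> UNIV. f (L @ [l]))"
    by (rule sum.cartesian_product)
  also have "\<dots> = (\<Sum>L\<in>multi_idx (Suc k). f L)"
    by (rule sum.reindex_bij_witness[where i = "\<lambda>L. (butlast L, last L)" and j = "\<lambda>(L, l). L @ [l]"])
      (auto simp: length_Suc_conv_rev)
  finally show ?thesis by simp
qed

lemma lop_eq_snocI:
  assumes "\<And>I J i j. length I = length J \<Longrightarrow> ent A (I @ [i]) (J @ [j]) = ent B (I @ [i]) (J @ [j])"
    and "ent A [] [] = ent B [] []"
  shows "A = B"
proof (rule lop_eqI)
  fix I J :: "'a list" assume "length I = length J"
  then show "ent A I J = ent B I J"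
    using assms by (cases I rule: rev_cases; cases J rule: rev_cases) auto
qed

lemma lext_mult: "lext (A * B) = lext A * lext B"
  by (rule lop_eq_snocI)
    (simp_all add: ent_lext ent_lext_Nil times_lop.rep_eq sum_multi_idx_Suc mult_delta_left
        mult_delta_right sum.delta)

lemma lext_smul: "lext (smul c A) = smul c (lext A)"
  by (rule lop_eq_snocI) (simp_all add: ent_lext ent_lext_Nil)

lemma lext_0: "lext 0 = 0"
  by (rule lop_eq_snocI) (simp_all add: ent_lext ent_lext_Nil)

lemma lext_add: "lext (A + B) = lext A + lext B"
  by (rule lop_eq_snocI) (simp_all add: ent_lext ent_lext_Nil)

lemma lext_diff: "lext (A - B) = lext A - lext B"
  by (rule lop_eq_snocI) (simp_all add: ent_lext ent_lext_Nil)

lemma (in ring_hom1) lop_map_lext: "lop_map \<phi> (lext A) = lext (lop_map \<phi> A)"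
  by (rule lop_eq_snocI) (simp_all add: ent_lext ent_lext_Nil ent_lop_map zero)

lemma lext_Lop: "lext (Lop k A) = Lop (Suc k) (op_extend A)"
  by (rule lop_eq_snocI) (simp_all add: ent_lext ent_lext_Nil ent_Lop op_extend_def)

lemma lext_id: "lext (idL k) = idL (Suc k)"
  by (rule lop_eq_snocI) (simp_all add: ent_lext ent_lext_Nil ent_Lop op_id_def)

lemma lext_leg2:
  assumes "r < k" "s < k"
  shows "lext (Lop k (leg2 k r s A)) = Lop (Suc k) (leg2 (Suc k) r s A)"
  using assms
  by (intro lop_eq_snocI) (auto simp: ent_lext ent_lext_Nil ent_Lop leg2_def nth_append less_Suc_eq)

lemma lext_leg1:
  assumes "r < k"
  shows "lext (Lop k (leg1 k r A)) = Lop (Suc k) (leg1 (Suc k) r A)"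
  using assms
  by (intro lop_eq_snocI) (auto simp: ent_lext ent_lext_Nil ent_Lop leg1_def nth_append less_Suc_eq)

lemma ent_leg1_last:
  assumes "length I = k" "length J = k"
  shows "ent (Lop (Suc k) (leg1 (Suc k) k T)) (I @ [i]) (J @ [j]) = (if I = J then T $ i $ j else 0)"
proof -
  have "(\<forall>p<Suc k. p \<noteq> k \<longrightarrow> (I @ [i]) ! p = (J @ [j]) ! p) \<longleftrightarrow> I = J"
    using assms by (auto simp: list_eq_iff_nth_eq nth_append less_Suc_eq)
  then show ?thesis using assms by (simp add: ent_Lop leg1_def nth_append)
qed

lemma ent_leg1_last_mult_lext:
  assumes "length I = k" "length J = k"
  shows "ent (Lop (Suc k) (leg1 (Suc k) k T) * lext A) (I @ [i]) (J @ [j]) = T $ i $ j * ent A I J"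
  using assms
  by (simp add: times_lop.rep_eq sum_multi_idx_Suc ent_lext mult_delta_right sum.delta sum.delta')
    (simp add: ent_leg1_last mult_delta_left sum.delta sum.delta')

lemma ent_lext_mult_leg1_last:
  assumes "length I = k" "length J = k"
  shows "ent (lext A * Lop (Suc k) (leg1 (Suc k) k T)) (I @ [i]) (J @ [j]) = ent A I J * T $ i $ j"
  using assms
  by (simp add: times_lop.rep_eq sum_multi_idx_Suc ent_leg1_last ent_lext mult_delta_left mult_delta_right
      sum.delta sum.delta')

lemma lext_leg1_last_commute:
  assumes comm: "\<And>I J i j. ent (Lop k A) I J * T $ i $ j = T $ i $ j * ent (Lop k A) I J"
  shows "lext (Lop k A) * Lop (Suc k) (leg1 (Suc k) k T) = Lop (Suc k) (leg1 (Suc k) k T) * lext (Lop k A)"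
proof (rule lop_eq_snocI)
  fix I J :: "'a list" and i j assume len: "length I = length J"
  show "ent (lext (Lop k A) * Lop (Suc k) (leg1 (Suc k) k T)) (I @ [i]) (J @ [j]) =
    ent (Lop (Suc k) (leg1 (Suc k) k T) * lext (Lop k A)) (I @ [i]) (J @ [j])"
  proof (cases "length I = k")
    case True
    then show ?thesis
      using len by (simp add: ent_leg1_last_mult_lext ent_lext_mult_leg1_last comm)
  next
    case False
    then show ?thesis
      by (simp add: lext_Lop ent_Lop_mult_0)
  qed
qed (simp add: lext_Lop ent_Lop_mult_0)

section \<open>Rotation of the tensor factors\<close>

text \<open>With row indices first, this maps v \<otimes> w, where w sits in the last factor, to w
  \<otimes> v, which is the shape of the equation defining N_R.\<close>

definition rotL :: "nat \<Rightarrow> ('n::finite, 'a::ring_1) lop" where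
  "rotL K = Lop K (\<lambda>I J. if J = rotate1 I then 1 else 0)"

lemma ent_rotL_mult:
  assumes "length I = K"
  shows "ent (rotL K * X) I J = ent X (rotate1 I) J"
  using assms by (simp add: ent_mult rotL_def ent_Lop mult_delta_left sum.delta')

lemma rotate1_inj: "rotate1 I = rotate1 J \<longleftrightarrow> I = J"
  by (cases I; cases J) auto

lemma ent_mult_rotL:
  assumes "length I = K" "length J = K"
  shows "ent (X * rotL K) I (rotate1 J) = ent X I J"
  using assms by (simp add: ent_mult rotL_def ent_Lop mult_delta_right sum.delta' rotate1_inj cong: if_cong)

lemma leg1_rotate1:
  assumes "length I = K" "length J = K" "k < K"
  shows "leg1 K k T (rotate1 I) (rotate1 J) = leg1 K (if Suc k < K then Suc k else 0) T I J"
proof -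
  obtain i I' where I: "I = i # I'" using assms by (cases I) auto
  obtain j J' where J: "J = j # J'" using assms by (cases J) auto
  have K: "K = Suc (length I')" "length J' = length I'" using assms I J by auto
  have len: "length (I' @ [i]) = K" "length (J' @ [j]) = K" "length (i # I') = K" "length (j # J') = K"
    using K by auto
  show ?thesis
  proof (cases "Suc k < K")
    case True
    have e1: "(\<forall>p<K. p \<noteq> Suc k \<longrightarrow> (i # I') ! p = (j # J') ! p) \<longleftrightarrow>
       (\<forall>p<length I'. p \<noteq> k \<longrightarrow> I' ! p = J' ! p) \<and> i = j"
      using K by (auto simp add: All_less_Suc2)
    have e2: "(\<forall>p<K. p \<noteq> k \<longrightarrow> (I' @ [i]) ! p = (J' @ [j]) ! p) \<longleftrightarrow>
       (\<forall>p<length I'. p \<noteq> k \<longrightarrow> I' ! p = J' ! p) \<and> i = j"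
      using True K by (simp add: All_less_Suc nth_append conj_commute)
    have "(I' @ [i]) ! k = (i # I') ! Suc k" "(J' @ [j]) ! k = (j # J') ! Suc k"
      using True K by (simp_all add: nth_append)
    then have "leg1 K k T (I' @ [i]) (J' @ [j]) = leg1 K (Suc k) T (i # I') (j # J')"
      by (simp only: leg1_def e1 e2 mem_multi_idx len)
    then show ?thesis using True I J by simp
  next
    case False
    then have k: "k = length I'" using assms K by auto
    have e1: "(\<forall>p<K. p \<noteq> 0 \<longrightarrow> (i # I') ! p = (j # J') ! p) \<longleftrightarrow> (\<forall>p<k. I' ! p = J' ! p)"
      using k K by (simp add: All_less_Suc2)
    have e2: "(\<forall>p<K. p \<noteq> k \<longrightarrow> (I' @ [i]) ! p = (J' @ [j]) ! p) \<longleftrightarrow> (\<forall>p<k. I' ! p = J' ! p)"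
      using k K by (simp add: All_less_Suc nth_append)
    have "(I' @ [i]) ! k = (i # I') ! 0" "(J' @ [j]) ! k = (j # J') ! 0"
      using k K by (simp_all add: nth_append)
    then have "leg1 K k T (I' @ [i]) (J' @ [j]) = leg1 K 0 T (i # I') (j # J')"
      by (simp only: leg1_def e1 e2 mem_multi_idx len)
    then show ?thesis using False I J by simp
  qed
qed

lemma rotL_leg1:
  fixes T :: "('n::finite, 'a::ring_1) mat1"
  assumes "k < K"
  shows "rotL K * Lop K (leg1 K k T) = Lop K (leg1 K (if Suc k < K then Suc k else 0) T) * rotL K"
proof (rule lop_eqI)
  fix I J :: "'n list" assume len: "length I = length J"
  show "ent (rotL K * Lop K (leg1 K k T)) I J =
    ent (Lop K (leg1 K (if Suc k < K then Suc k else 0) T) * rotL K) I J"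
  proof (cases "length I = K")
    case True
    have "J \<noteq> []" using True assms len by auto
    then have "rotate1 (last J # butlast J) = J" by simp
    then obtain J' where J': "J = rotate1 J'" by metis
    then have "length J' = K" using len True by simp
    then show ?thesis
      using True assms J' by (simp add: ent_rotL_mult ent_mult_rotL ent_Lop leg1_rotate1)
  next
    case False
    then show ?thesis by (simp add: rotL_def ent_Lop_mult_0)
  qed
qed

section \<open>Congruence modulo a two-sided ideal\<close>

text \<open>The same notion serves for the algebra, for series over it (\<open>coeff_ideal\<close>)
  and for operators over either (\<open>lop_ideal\<close>), so that exchange relations can be
  chained as congruences of operators.\<close>

locale two_sided_ideal =
  fixes J :: "'b::ring_1 set"
  assumes zero_mem: "0 \<in> J"
    and add_mem: "x \<in> J \<Longrightarrow> y \<in> J \<Longrightarrow> x + y \<in> J"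
    and mult_left_mem: "x \<in> J \<Longrightarrow> y * x \<in> J"
    and mult_right_mem: "x \<in> J \<Longrightarrow> x * y \<in> J"
begin

definition cgr :: "'b \<Rightarrow> 'b \<Rightarrow> bool" (infix "\<approx>" 50) where
  "x \<approx> y \<longleftrightarrow> x - y \<in> J"

lemma minus_mem: "x \<in> J \<Longrightarrow> - x \<in> J"
  using mult_left_mem[of x "-1"] by simp

lemma diff_mem: "x \<in> J \<Longrightarrow> y \<in> J \<Longrightarrow> x - y \<in> J"
  using add_mem[of x "- y"] minus_mem[of y] by simp

lemma sum_mem: "(\<And>x. x \<in> S \<Longrightarrow> f x \<in> J) \<Longrightarrow> sum f S \<in> J"
  by (induction S rule: infinite_finite_induct) (auto intro: zero_mem add_mem)

lemma cgr_refl: "x \<approx> x"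
  by (simp add: cgr_def zero_mem)

lemma cgr_sym: "x \<approx> y \<Longrightarrow> y \<approx> x"
  using minus_mem[of "x - y"] by (simp add: cgr_def)

lemma cgr_trans [trans]: "x \<approx> y \<Longrightarrow> y \<approx> z \<Longrightarrow> x \<approx> z"
  using add_mem[of "x - y" "y - z"] by (simp add: cgr_def)

lemma cgr_mult: "x \<approx> y \<Longrightarrow> x' \<approx> y' \<Longrightarrow> x * x' \<approx> y * y'"
  using add_mem[OF mult_right_mem[of "x - y" x'] mult_left_mem[of "x' - y'" y]]
  by (simp add: cgr_def algebra_simps)

lemma cgr_mult_left: "x \<approx> y \<Longrightarrow> z * x \<approx> z * y"
  by (rule cgr_mult[OF cgr_refl])

lemma cgr_mult_right: "x \<approx> y \<Longrightarrow> x * z \<approx> y * z"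
  by (rule cgr_mult[OF _ cgr_refl])

end

lemma commute_prod_list:
  fixes y :: "'b::monoid_mult"
  assumes "\<And>x. x \<in> set xs \<Longrightarrow> y * x = x * y"
  shows "y * prod_list xs = prod_list xs * y"
  using assms by (induction xs) (simp_all, metis mult.assoc)

text \<open>\<open>X\<close> enters behind the last \<open>A\<close> and moves one factor to the
  left at each exchange, pushing every \<open>A i\<close> to position \<open>i + 1\<close> as
  \<open>B (Suc i)\<close>. Induction peels off the last exchange: \<open>Q j\<close> passes the
  earlier \<open>A\<close>, and afterwards \<open>B (Suc j)\<close> passes the earlier
  \<open>Q'\<close>. This serves both for the reversal of arguments by the skew-symmetrizer and for
  moving a generator past the determinant.\<close>

lemma (in two_sided_ideal) transport:
  assumes rel: "\<And>i. i < j \<Longrightarrow> Q i * A i * X (Suc i) \<approx> X i * B (Suc i) * Q' i"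
    and QA: "\<And>i l. i < j \<Longrightarrow> l < i \<Longrightarrow> Q i * A l = A l * Q i"
    and QB: "\<And>i l. Suc i < l \<Longrightarrow> l \<le> j \<Longrightarrow> Q' i * B l = B l * Q' i"
  shows "prod_list (map Q [0..<j]) * prod_list (map A [0..<j]) * X j \<approx>
    X 0 * prod_list (map (\<lambda>i. B (Suc i)) [0..<j]) * prod_list (map Q' [0..<j])"
  using assms
proof (induction j)
  case 0
  then show ?case by (simp add: cgr_refl)
next
  case (Suc j)
  let ?q = "prod_list (map Q [0..<j])" and ?a = "prod_list (map A [0..<j])"
    and ?b = "prod_list (map (\<lambda>i. B (Suc i)) [0..<j])" and ?q' = "prod_list (map Q' [0..<j])"
  have c1: "Q j * ?a = ?a * Q j"
    by (rule commute_prod_list) (auto intro!: Suc.prems(2))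
  have c2: "B (Suc j) * ?q' = ?q' * B (Suc j)"
    by (rule commute_prod_list) (auto simp: Suc.prems(3))
  have IH: "?q * ?a * X j \<approx> X 0 * ?b * ?q'"
    using Suc.prems by (intro Suc.IH) auto
  have "?q * Q j * (?a * A j) * X (Suc j) = ?q * (Q j * ?a) * (A j * X (Suc j))"
    by (simp add: mult.assoc)
  also have "\<dots> = ?q * ?a * (Q j * A j * X (Suc j))"
    unfolding c1 by (simp add: mult.assoc)
  also have "\<dots> \<approx> ?q * ?a * (X j * B (Suc j) * Q' j)"
    by (rule cgr_mult_left) (rule Suc.prems(1), simp)
  also have "\<dots> = ?q * ?a * X j * (B (Suc j) * Q' j)"
    by (simp add: mult.assoc)
  also have "\<dots> \<approx> X 0 * ?b * ?q' * (B (Suc j) * Q' j)"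
    by (rule cgr_mult_right[OF IH])
  also have "\<dots> = X 0 * ?b * (?q' * B (Suc j)) * Q' j"
    by (simp add: mult.assoc)
  also have "\<dots> = X 0 * (?b * B (Suc j)) * (?q' * Q' j)"
    unfolding c2[symmetric] by (simp add: mult.assoc)
  finally show ?case by simp
qed

lemma lop_ideal:
  assumes "two_sided_ideal I"
  shows "two_sided_ideal {A :: ('n::finite, 'a::ring_1) lop. \<forall>X Y. ent A X Y \<in> I}"
proof -
  interpret two_sided_ideal I by fact
  show ?thesis
    by unfold_locales
      (auto simp: zero_mem add_mem times_lop.rep_eq intro!: sum_mem intro: mult_left_mem mult_right_mem)
qed

section \<open>The Hecke relations\<close>

text \<open>The Yang-Baxter equation with spectral parameters. When \<open>q * p = 1\<close> and
  scalars are written as (q - p) x / (1 - x), the value \<open>p\<close> belongs to x = p^2, and the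
  condition on \<open>c\<close> and \<open>d\<close> says that the middle parameter is p^2 times
  that of \<open>d\<close>.\<close>

lemma hecke_YBE:
  fixes r s e :: "('n::finite, 'a::comm_ring_1) lop"
  assumes braid: "s * r * s = r * s * r"
    and quad: "r * r = smul (q - p) r + e" "s * s = smul (q - p) s + e"
    and e: "e * r = r" "r * e = r" "e * s = s" "s * e = s" "e * e = e"
    and c: "c * (q + d) = p * d"
  shows "(s + smul p e) * (r + smul c e) * (s + smul d e) = (r + smul d e) * (s + smul c e) * (r + smul p e)"
proof -
  have "(s + smul p e) * (r + smul c e) * (s + smul d e) - (r + smul d e) * (s + smul c e) * (r + smul p e) =
    (s * r * s - r * s * r) + smul c (s * s - r * r) + smul (c * d + p * c - p * d) (s - r)"
    by (simp add: algebra_simps smul_mult_left smul_mult_right_comm smul_smul smul_add smul_diff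
        smul_add_left smul_diff_left e)
  also have "\<dots> = smul (c * (q + d) - p * d) (s - r)"
    unfolding braid quad by (simp add: algebra_simps smul_smul smul_add smul_diff smul_add_left
        smul_diff_left)
  finally show ?thesis unfolding c by simp
qed

text \<open>The degree step for R_j acting by - p on skew-symmetrizers, with \<open>X\<close> the
  extended one of lower degree. For \<open>j = 0\<close> the leftmost factor has scalar
  \<open>- q\<close> and is annihilated by the quadratic relation. Otherwise \<open>r j + p\<close>
  passes to factors \<open>j - 1\<close> and \<open>j\<close>, where the Yang-Baxter equation moves
  it to their right as \<open>r (j - 1) + p\<close>; this passes the remaining factors and
  annihilates \<open>X\<close>.\<close>

lemma skew_kill_step:
  fixes r :: "nat \<Rightarrow> ('n::finite, 'a::comm_ring_1) lop"
  assumes qp: "q * p = 1"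
    and braid: "\<And>i. Suc i < k \<Longrightarrow> r i * r (Suc i) * r i = r (Suc i) * r i * r (Suc i)"
    and quad: "\<And>i. i < k \<Longrightarrow> r i * r i = smul (q - p) (r i) + e"
    and e: "\<And>i. i < k \<Longrightarrow> e * r i = r i" "\<And>i. i < k \<Longrightarrow> r i * e = r i" "e * e = e" "e * X = X"
    and far: "\<And>i j. i < k \<Longrightarrow> j < k \<Longrightarrow> Suc i < j \<Longrightarrow> r i * r j = r j * r i"
    and X: "\<And>j. Suc j < k \<Longrightarrow> (r j + smul p e) * X = 0"
    and c1: "c 1 = - q" and c: "\<And>i. 0 < i \<Longrightarrow> c i * (q + c (Suc i)) = p * c (Suc i)"
    and j: "j < k"
  shows "(r j + smul p e) * (prod_list (map (\<lambda>i. r i + smul (c (Suc i)) e) [0..<k]) * X) = 0"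
proof -
  define F where "F = (\<lambda>i. r i + smul (c (Suc i)) e)"
  show ?thesis
  proof (cases j)
    case 0
    have "(r 0 + smul p e) * F 0 = 0"
      using quad[of 0] e(1,2)[of 0] e(3) j 0 c1 qp
      by (simp add: F_def algebra_simps smul_mult_left smul_mult_right_comm smul_smul smul_minus
          smul_diff_left smul_add)
    moreover have "[0..<k] = 0 # [1..<k]" using j by (simp add: upt_conv_Cons)
    ultimately show ?thesis
      unfolding F_def[symmetric] 0 by (simp flip: mult.assoc)
  next
    case (Suc i)
    have upt: "[0..<k] = [0..<i] @ [i, Suc i] @ [Suc (Suc i)..<k]"
      using Suc j upt_add_eq_append[of 0 i "k - i"] by (simp add: upt_conv_Cons)
    let ?a = "prod_list (map F [0..<i])" and ?b = "prod_list (map F [Suc (Suc i)..<k])"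
    have "r (Suc i) * r l = r l * r (Suc i)" if "l < i" for l
      using far[of l "Suc i"] that Suc j by simp
    then have c1: "(r (Suc i) + smul p e) * ?a = ?a * (r (Suc i) + smul p e)"
      by (intro commute_prod_list)
        (use Suc j e in \<open>auto simp: F_def algebra_simps smul_mult_left smul_mult_right_comm smul_smul
            mult.commute\<close>)
    have c2: "(r i + smul p e) * ?b = ?b * (r i + smul p e)"
      by (rule commute_prod_list)
        (use Suc j e far in \<open>auto simp: F_def algebra_simps smul_mult_left smul_mult_right_comm smul_smul
            mult.commute\<close>)
    have ybe: "(r (Suc i) + smul p e) * F i * F (Suc i) =
       (r i + smul (c (Suc (Suc i))) e) * (r (Suc i) + smul (c (Suc i)) e) * (r i + smul p e)"
      unfolding F_def using Suc j c[of "Suc i"]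
      by (intro hecke_YBE[where q = q]) (auto simp: braid quad e)
    have "(r j + smul p e) * (prod_list (map F [0..<k]) * X) =
       ((r (Suc i) + smul p e) * ?a) * F i * F (Suc i) * ?b * X"
      unfolding upt Suc by (simp add: mult.assoc)
    also have "\<dots> = ?a * ((r (Suc i) + smul p e) * F i * F (Suc i)) * ?b * X"
      unfolding c1 by (simp add: mult.assoc)
    also have "\<dots> = ?a * (r i + smul (c (Suc (Suc i))) e) * (r (Suc i) + smul (c (Suc i)) e) * ((r i + smul
        p e) * ?b) * X"
      unfolding ybe by (simp add: mult.assoc)
    also have "\<dots> = ?a * (r i + smul (c (Suc (Suc i))) e) * (r (Suc i) + smul (c (Suc i)) e) * ?b * ((r i +
        smul p e) * X)"
      unfolding c2 by (simp add: mult.assoc)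
    also have "\<dots> = 0"
      using X[of i] Suc j by simp
    finally show ?thesis unfolding F_def .
  qed
qed

section \<open>Fusion\<close>

text \<open>Factors are numbered from the right, so that each induction step multiplies an already
  known operator on the left.\<close>

primrec chain :: "(nat \<Rightarrow> 'b::monoid_mult) \<Rightarrow> 'b \<Rightarrow> nat \<Rightarrow> 'b" where
  "chain F X 0 = X"
| "chain F X (Suc d) = F d * chain F X d"

lemma chain_eq_prod_list: "chain F X d = prod_list (map (\<lambda>i. F (d - Suc i)) [0..<d]) * X"
proof (induction d)
  case (Suc d)
  have "[0..<Suc d] = 0 # map Suc [0..<d]"
    by (simp add: map_Suc_upt upt_conv_Cons del: upt_Suc)
  then show ?case
    using Suc by (simp add: comp_def mult.assoc del: upt_Suc)
qed simp

lemma chain_smul: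
  fixes F :: "nat \<Rightarrow> ('n::finite, 'a::comm_ring_1) lop"
  shows "chain (\<lambda>d. smul (k d) (F d)) X n = smul (\<Prod>d<n. k d) (chain F X n)"
  by (induction n) (simp_all add: smul_mult_left smul_mult_right_comm smul_smul mult.commute)

text \<open>Explicitly the sum of (- p)^(d - 1 - i) p^(2i) \<open>E i\<close> over i < d: in term i,
  factor i is replaced by a scalar and each later factor acts by - p.\<close>

primrec tail_sum :: "'a::ring_1 \<Rightarrow> (nat \<Rightarrow> ('n::finite, 'a) lop) \<Rightarrow> nat \<Rightarrow> ('n, 'a) lop" where
  "tail_sum p E 0 = 0"
| "tail_sum p E (Suc d) = smul (p ^ (2 * d)) (E d) + smul (- p) (tail_sum p E d)"

text \<open>
  Here \<open>\<rho> d\<close> stands for \<open>R\<^sub>M\<^sub>-\<^sub>d\<close>.  Expanding the product, each term in which a factor \<open>\<rho> d\<close> is replaced by a scalar loses all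
  the later factors, because these commute past the rest and act on \<open>X\<close> by \<open>- p\<close>; the arguments \<open>z p\<^sup>2\<^sup>d\<close> make the coefficients
  of the resulting terms proportional.
\<close>

lemma chain_fusion:
  fixes \<rho> :: "nat \<Rightarrow> ('n::finite, 'a::comm_ring_1) lop" and X :: "('n, 'a) lop"
  defines "E \<equiv> chain \<rho> X"
  assumes qp: "q * p = 1"
    and e: "\<And>d. e * chain \<rho> X d = chain \<rho> X d"
    and far: "\<And>d d'. d' < d \<Longrightarrow> d \<le> n \<Longrightarrow> \<rho> d * chain \<rho> X d' = smul (- p) (chain \<rho> X d')"
    and d: "d \<le> n"
  shows "chain (\<lambda>d. smul (1 - z * p ^ (2 * d)) (\<rho> d) + smul ((q - p) * z * p ^ (2 * d)) e) X (Suc d) =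
    smul (\<Prod>i<d. 1 - z * p ^ (2 * i)) (smul (1 - z * p ^ (2 * d)) (E (Suc d)) + smul ((q - p) * z)
        (tail_sum p E (Suc d)))"
  using d
proof (induction d)
  case 0
  then show ?case using e[of 0] by (simp add: E_def smul_mult_left distrib_right)
next
  case (Suc d)
  have eS: "e * tail_sum p E m = tail_sum p E m" for m
    by (induction m) (simp_all add: E_def distrib_left smul_mult_right_comm e)
  have fS: "\<rho> d * tail_sum p E m = smul (- p) (tail_sum p E m)" if "m \<le> d" "d \<le> n" for m d
    using that
    by (induction m) (simp_all add: E_def distrib_left smul_mult_right_comm far smul_smul smul_add
        mult.commute)
  \<comment> \<open>A factor multiplies the tail sum by - p times the numerator 1 - z p^(2d) of the
    factor before it. This lets the scalars collect into a common product.\<close>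
  have coef: "(1 - z * p ^ (2 * Suc d)) * (- p) + (q - p) * z * p ^ (2 * Suc d) = - p * (1 - z * p ^ (2 * d))"
  proof -
    have "q * p ^ (2 * Suc d) = p * p ^ (2 * d)"
      using qp by (simp add: mult.assoc[symmetric])
    then have "q * z * p ^ (2 * Suc d) = z * p * p ^ (2 * d)"
      by (simp only: mult.assoc mult.left_commute[of q z])
    then show ?thesis
      by (simp only: left_diff_distrib right_diff_distrib) (simp add: algebra_simps)
  qed
  let ?A = "\<Prod>i<d. 1 - z * p ^ (2 * i)"
  let ?f = "smul (1 - z * p ^ (2 * Suc d)) (\<rho> (Suc d)) + smul ((q - p) * z * p ^ (2 * Suc d)) e"
  let ?S = "tail_sum p E (Suc d)"
  have 1: "?f * E (Suc d) = smul (1 - z * p ^ (2 * Suc d)) (E (Suc (Suc d))) + smul ((q - p) * z * p ^ (2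
      * Suc d)) (E (Suc d))"
    using e[of "Suc d"] by (simp add: E_def distrib_right smul_mult_left)
  have "?f * ?S = smul ((1 - z * p ^ (2 * Suc d)) * (- p) + (q - p) * z * p ^ (2 * Suc d)) ?S"
    using fS[of "Suc d" "Suc d"] eS[of "Suc d"] Suc.prems
    by (simp only: distrib_right smul_mult_left smul_smul smul_add_left)
  then have 2: "?f * ?S = smul (- p * (1 - z * p ^ (2 * d))) ?S"
    unfolding coef .
  have "chain (\<lambda>d. smul (1 - z * p ^ (2 * d)) (\<rho> d) + smul ((q - p) * z * p ^ (2 * d)) e) X (Suc (Suc d)) =
    ?f * smul ?A (smul (1 - z * p ^ (2 * d)) (E (Suc d)) + smul ((q - p) * z) ?S)"
    using Suc by (simp only: chain.simps(2)[of _ _ "Suc d"] Suc_leD)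
  also have "\<dots> = smul ?A (smul (1 - z * p ^ (2 * d)) (?f * E (Suc d)) + smul ((q - p) * z) (?f * ?S))"
    by (simp only: smul_mult_right_comm distrib_left)
  also have "\<dots> = smul (?A * (1 - z * p ^ (2 * d))) (smul (1 - z * p ^ (2 * Suc d)) (E (Suc (Suc d))) +
      smul ((q - p) * z) (smul (p ^ (2 * Suc d)) (E (Suc d)) + smul (- p) ?S))"
    unfolding 1 2 by (simp only: smul_smul smul_add mult_ac add.assoc)
  finally show ?case
    by (simp only: tail_sum.simps(2)[of _ _ "Suc d"] prod.lessThan_Suc)
qed

text \<open>The vanishing at \<open>z\<^sub>0 = p\<^sup>-\<^sup>2\<^sup>M\<close> eliminates the tail sum for every \<open>z\<close>.\<close>

lemma chain_fusion_scalar: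
  fixes \<rho> :: "nat \<Rightarrow> ('n::finite, 'a::idom) lop" and X e :: "('n, 'a) lop" and p q :: 'a and n :: nat
  defines "G \<equiv> \<lambda>z. chain (\<lambda>d. smul (1 - z * p ^ (2 * d)) (\<rho> d) + smul ((q - p) * z * p ^ (2 * d)) e) X
      (Suc n)"
  assumes qp: "q * p = 1"
    and e: "\<And>d. e * chain \<rho> X d = chain \<rho> X d"
    and far: "\<And>d d'. d' < d \<Longrightarrow> d \<le> n \<Longrightarrow> \<rho> d * chain \<rho> X d' = smul (- p) (chain \<rho> X d')"
    and z0: "z0 * p ^ (2 * Suc n) = 1" and nz: "\<And>i. i < n \<Longrightarrow> z0 * p ^ (2 * i) \<noteq> 1"
    and G0: "G z0 = 0"
  shows "G z = smul ((\<Prod>i<n. 1 - z * p ^ (2 * i)) * (1 - z * p ^ (2 * Suc n))) (chain \<rho> X (Suc n))"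
proof -
  let ?E = "chain \<rho> X (Suc n)" and ?S = "tail_sum p (chain \<rho> X) (Suc n)"
  have G: "G z = smul (\<Prod>i<n. 1 - z * p ^ (2 * i)) (smul (1 - z * p ^ (2 * n)) ?E + smul ((q - p) * z) ?S)"
      for z
    unfolding G_def by (rule chain_fusion[OF qp e far]) auto
  have "(\<Prod>i<n. 1 - z0 * p ^ (2 * i)) \<noteq> 0"
    using nz by (auto simp: prod_zero_iff)
  then have "smul (1 - z0 * p ^ (2 * n)) ?E + smul ((q - p) * z0) ?S = 0"
    using G[of z0] G0 smul_cancel by metis
  \<comment> \<open>Since z0 p^(2n+2) = 1, this multiple turns the coefficient (q - p) z0 of the
    tail sum into (q - p) z, the one that occurs at an arbitrary z.\<close>
  then have "smul (z * p ^ (2 * Suc n)) (smul (1 - z0 * p ^ (2 * n)) ?E + smul ((q - p) * z0) ?S) = 0"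
    by simp
  moreover have "z * p ^ (2 * Suc n) * ((q - p) * z0) = (q - p) * z"
    using z0 by (metis mult.assoc mult.commute mult_1)
  ultimately have S: "smul ((q - p) * z) ?S = - smul (z * p ^ (2 * Suc n) * (1 - z0 * p ^ (2 * n))) ?E"
    by (simp only: smul_add smul_smul) (simp add: eq_neg_iff_add_eq_0 add.commute)
  have "p ^ (2 * Suc n) * (z0 * p ^ (2 * n)) = p ^ (2 * n)"
    using z0 by (metis mult.assoc mult.commute mult_1)
  then have "1 - z * p ^ (2 * n) - z * p ^ (2 * Suc n) * (1 - z0 * p ^ (2 * n)) = 1 - z * p ^ (2 * Suc n)"
    by (simp only: right_diff_distrib mult.assoc) simp
  then have "smul (1 - z * p ^ (2 * n)) ?E + smul ((q - p) * z) ?S = smul (1 - z * p ^ (2 * Suc n)) ?E"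
    unfolding S add_uminus_conv_diff smul_diff_left[symmetric] by (simp only:)
  then show ?thesis unfolding G by (simp only: smul_smul)
qed

lemma fps_const_mult_X_power: "(fps_const u * fps_X) ^ n = fps_const (u ^ n) * (fps_X :: 'a::ring_1 fps) ^ n"
proof (induction n)
  case (Suc n)
  have "(fps_const u * fps_X) ^ Suc n = fps_const u * fps_X * (fps_const (u ^ n) * fps_X ^ n)"
    using Suc by simp
  also have "\<dots> = fps_const u * (fps_X * fps_const (u ^ n)) * fps_X ^ n"
    by (simp add: mult.assoc)
  also have "\<dots> = fps_const u * fps_const (u ^ n) * (fps_X * fps_X ^ n)"
    unfolding fps_mult_fps_X_commute[of "fps_const (u ^ n)"] by (simp only: mult.assoc)
  finally show ?case by (simp only: fps_const_mult power_Suc)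
qed simp

lemma nth_subst_scale: "fps_nth (subst_scale u f) n = fps_nth f n * (u::'a::ring_1) ^ n"
  by (simp add: subst_scale_def fps_compose_nth fps_const_mult_X_power mult_delta_right sum.delta')

section \<open>The normalising series\<close>

text \<open>With constant term 1 and the coefficients below \<open>n\<close> fixed, coefficient
  \<open>n\<close> of the product of the f(u_k x) is affine in that of \<open>f\<close>, with slope
  the sum of the u_k^n. Existence and uniqueness of \<open>g_bar\<close> follow by solving for one
  coefficient at a time.\<close>

lemma prod_subst_perturb:
  fixes f g :: "'a::comm_ring_1 fps" and M :: nat
  assumes n: "n > 0" and fg: "\<And>m. m < n \<Longrightarrow> fps_nth f m = fps_nth g m" and f0: "fps_nth f 0 = 1"
  shows "fps_nth (\<Prod>k<M. subst_scale (u k) f) 0 = 1"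
    and "m < n \<Longrightarrow> fps_nth (\<Prod>k<M. subst_scale (u k) f) m = fps_nth (\<Prod>k<M. subst_scale (u k) g) m"
    and "fps_nth (\<Prod>k<M. subst_scale (u k) f) n - fps_nth (\<Prod>k<M. subst_scale (u k) g) n =
      (\<Sum>k<M. u k ^ n) * (fps_nth f n - fps_nth g n)"
proof (induction M arbitrary: m)
  case 0
  { case 1 show ?case by simp }
  { case 2 show ?case by simp }
  { case 3 show ?case by simp }
next
  case (Suc M)
  let ?a = "fps_nth (\<Prod>k<M. subst_scale (u k) f)" and ?a' = "fps_nth (\<Prod>k<M. subst_scale (u k) g)"
  let ?b = "fps_nth (subst_scale (u M) f)" and ?b' = "fps_nth (subst_scale (u M) g)"
  { case 1 show ?case using Suc(1) f0 by (simp add: nth_subst_scale) }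
  { case 2 then show ?case using Suc(2) fg by (simp add: fps_mult_nth nth_subst_scale) }
  { case 3
    have g0: "fps_nth g 0 = 1" using fg n f0 by metis
    have a0: "?a 0 = 1" "?a' 0 = 1" using Suc(1) Suc(2)[OF n] by auto
    have "(\<Sum>i=0..n. ?a i * ?b (n - i)) - (\<Sum>i=0..n. ?a' i * ?b' (n - i)) =
      (\<Sum>i=0..n. ?a i * ?b (n - i) - ?a' i * ?b' (n - i))"
      by (rule sum_subtractf[symmetric])
    also have "\<dots> = (\<Sum>i\<in>{0, n}. ?a i * ?b (n - i) - ?a' i * ?b' (n - i))"
    proof (rule sum.mono_neutral_right; (intro ballI)?)
      fix i assume "i \<in> {0..n} - {0, n}"
      then have "i < n" "n - i < n" by auto
      then show "?a i * ?b (n - i) - ?a' i * ?b' (n - i) = 0"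
        using Suc(2) fg by (simp add: nth_subst_scale)
    qed auto
    also have "\<dots> = ?b n - ?b' n + (?a n - ?a' n)"
      using n a0 f0 g0 by (simp add: nth_subst_scale)
    also have "\<dots> = (\<Sum>k<Suc M. u k ^ n) * (fps_nth f n - fps_nth g n)"
      unfolding Suc(3) by (simp add: nth_subst_scale algebra_simps)
    finally show ?case by (simp add: fps_mult_nth) }
qed

lemma prod_subst_unique:
  fixes f g :: "'a::idom fps" and M :: nat
  assumes "fps_nth f 0 = 1" "fps_nth g 0 = 1" and u: "\<And>n. n > 0 \<Longrightarrow> (\<Sum>k<M. u k ^ n) \<noteq> 0"
    and eq: "(\<Prod>k<M. subst_scale (u k) f) = (\<Prod>k<M. subst_scale (u k) g)"
  shows "f = g"
proof (rule fps_ext)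
  fix n show "fps_nth f n = fps_nth g n"
  proof (induction n rule: less_induct)
    case (less n)
    show ?case
    proof (cases "n = 0")
      case False
      then have "(\<Sum>k<M. u k ^ n) * (fps_nth f n - fps_nth g n) = 0"
        using prod_subst_perturb(3)[where M = M and u = u and f = f and g = g and n = n] less assms by simp
      then show ?thesis using u[of n] False by simp
    qed (use assms in simp)
  qed
qed

lemma prod_subst_exists:
  fixes b :: "'a::comm_ring_1 fps" and M :: nat
  assumes b: "fps_nth b 0 = 1" and u: "\<And>n. n > 0 \<Longrightarrow> (\<Sum>k<M. u k ^ n) * w n = 1"
  shows "\<exists>f. fps_nth f 0 = 1 \<and> (\<Prod>k<M. subst_scale (u k) f) = b"
proof -
  let ?P = "\<lambda>f. \<Prod>k<M. subst_scale (u k) f"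
  \<comment> \<open>\<open>G n\<close> solves the equation up to degree n. The correction is the
    defect in degree n + 1 divided by the slope, whose inverse is \<open>w (Suc n)\<close>.\<close>
  define G where "G = rec_nat 1 (\<lambda>n f. f + fps_const (w (Suc n) * (fps_nth b (Suc n) - fps_nth (?P f) (Suc
      n))) * fps_X ^ Suc n)"
  have G0: "G 0 = 1" and GS: "G (Suc n) = G n + fps_const (w (Suc n) * (fps_nth b (Suc n) - fps_nth (?P (G
      n)) (Suc n))) * fps_X ^ Suc n" for n
    by (simp_all add: G_def)
  have stab: "fps_nth (G n) m = fps_nth (G m) m" if "m \<le> n" for m n
    using that
  proof (induction n)
    case (Suc n)
    then show ?case by (cases "m = Suc n") (auto simp: GS fps_X_power_mult_right_nth simp del: power_Suc)
  qed simp
  define f where "f = Abs_fps (\<lambda>n. fps_nth (G n) n)"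
  have f: "fps_nth f m = fps_nth (G n) m" if "m \<le> n" for m n
    using stab[OF that] by (simp add: f_def)
  have f0: "fps_nth f 0 = 1" by (simp add: f_def G0)
  have "fps_nth (?P f) n = fps_nth b n" for n
  proof (cases n)
    case 0
    then show ?thesis using prod_subst_perturb(1)[of 1 f f] f0 b by simp
  next
    case (Suc m)
    have d: "fps_nth f n - fps_nth (G m) n = w n * (fps_nth b n - fps_nth (?P (G m)) n)"
    proof -
      have "fps_nth f n = fps_nth (G n) n" by (simp add: f_def)
      moreover have "fps_nth (G n) n = fps_nth (G m) n + w n * (fps_nth b n - fps_nth (?P (G m)) n)"
        unfolding Suc GS[of m] by (simp add: fps_X_power_mult_right_nth del: power_Suc)
      ultimately show ?thesis by simp
    qed
    have "fps_nth (?P f) n - fps_nth (?P (G m)) n = (\<Sum>k<M. u k ^ n) * (fps_nth f n - fps_nth (G m) n)"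
      by (rule prod_subst_perturb(3)) (use Suc f f0 in auto)
    also have "\<dots> = (\<Sum>k<M. u k ^ n) * w n * (fps_nth b n - fps_nth (?P (G m)) n)"
      unfolding d by (simp add: mult.assoc)
    finally show ?thesis using u[of n] Suc by simp
  qed
  then have "?P f = b" by (intro fps_ext) simp
  with f0 show ?thesis by blast
qed

text \<open>The definite description is legitimate because the slope, the sum of e^(-2knh) over k <
  M, has constant term M and is therefore a unit of C[[h]].\<close>

lemma g_bar:
  assumes "M > 0"
  shows "fps_nth (g_bar M) 0 = 1"
    and "(\<Prod>k<M. subst_scale (fps_exp (- 2 * of_nat k)) (g_bar M)) * (1 - fps_X) =
      1 - fps_const (fps_exp (- 2 * (of_nat M - 1))) * fps_X"
proof -
  let ?u = "\<lambda>k. fps_exp (- 2 * of_nat k :: complex)"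
  let ?a = "1 - fps_const (fps_exp (- 2 * (of_nat M - 1))) * fps_X :: complex fps fps"
  let ?b = "?a / (1 - fps_X)"
  have b: "?b * (1 - fps_X) = ?a"
    using divide_one_minus_mult[of ?a 1] by simp
  have "fps_nth (?b * (1 - fps_X)) 0 = 1" unfolding b by simp
  then have b0: "fps_nth ?b 0 = 1" by (simp add: fps_mult_nth)
  have nz: "fps_nth (\<Sum>k<M. ?u k ^ n) 0 \<noteq> 0" for n
    using assms by (simp add: fps_sum_nth fps_nth_power_0)
  have nz': "(\<Sum>k<M. ?u k ^ n) \<noteq> 0" for n
    by (rule notI) (use nz[of n] in \<open>simp only: fps_zero_nth simp_thms\<close>)
  have inv: "(\<Sum>k<M. ?u k ^ n) * inverse (\<Sum>k<M. ?u k ^ n) = 1" for n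
    using nz[of n] by (metis inverse_mult_eq_1')
  have "\<exists>!g. fps_nth g 0 = 1 \<and> (\<Prod>k<M. subst_scale (?u k) g) = ?b"
  proof (rule ex_ex1I)
    show "\<exists>g. fps_nth g 0 = 1 \<and> (\<Prod>k<M. subst_scale (?u k) g) = ?b"
      by (rule prod_subst_exists[OF b0]) (rule inv)
  next
    fix f g
    assume f: "fps_nth f 0 = 1 \<and> (\<Prod>k<M. subst_scale (?u k) f) = ?b"
      and g: "fps_nth g 0 = 1 \<and> (\<Prod>k<M. subst_scale (?u k) g) = ?b"
    have fg: "(\<Prod>k<M. subst_scale (?u k) f) = (\<Prod>k<M. subst_scale (?u k) g)"
      by (rule trans[OF conjunct2[OF f] sym[OF conjunct2[OF g]]])
    show "f = g"
      by (rule prod_subst_unique[where M = M and u = ?u, OF conjunct1[OF f] conjunct1[OF g] nz' fg])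
  qed
  then have g: "fps_nth (g_bar M) 0 = 1 \<and> (\<Prod>k<M. subst_scale (?u k) (g_bar M)) = ?b"
    unfolding g_bar_def by (rule theI')
  then show "fps_nth (g_bar M) 0 = 1" ..
  show "(\<Prod>k<M. subst_scale (fps_exp (- 2 * of_nat k)) (g_bar M)) * (1 - fps_X) = ?a"
    unfolding conjunct2[OF g] by (rule b)
qed

section \<open>Skew-symmetrizers\<close>

lemma fps_exp_m1_power: "fps_exp (- 1 :: complex) ^ (2 * d) = fps_exp (- 2 * of_nat d)"
  by (simp add: fps_exp_power_mult mult.commute)

lemma fps_exp_1_m1: "fps_exp (1 :: complex) * fps_exp (- 1) = 1"
  by (simp flip: fps_exp_add_mult)

lemma fps_dvd_order1:
  fixes f g :: "complex fps"
  assumes "fps_nth f 1 \<noteq> 0" "fps_nth g 0 = 0"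
  shows "f dvd g"
proof -
  have "f \<noteq> 0" using assms by auto
  have "subdegree f \<le> 1" using assms(1) by (rule subdegree_leI)
  moreover have "g = 0 \<or> 1 \<le> subdegree g"
    using assms(2) by (metis One_nat_def Suc_leI gr0I nth_subdegree_nonzero)
  ultimately show ?thesis using \<open>f \<noteq> 0\<close> by (cases "g = 0") (auto simp: fps_dvd_iff)
qed

text \<open>For \<open>i > 0\<close> this is - e^(ih) / [i]_h, the scalar part of R-hat at
  e^(2ih).\<close>

definition skew_coeff :: "nat \<Rightarrow> complex fps" where
  "skew_coeff i = (fps_exp 1 - fps_exp (- 1)) * fps_exp (2 * of_nat i) / (1 - fps_exp (2 * of_nat i))"

lemma R_hat_eq: "R_hat R (fps_exp (2 * of_nat i)) = R + mat (skew_coeff i)"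
  by (simp add: R_hat_def skew_coeff_def)

lemma one_minus_fps_exp_nonzero: "i > 0 \<Longrightarrow> 1 - fps_exp (2 * of_nat i :: complex) \<noteq> 0"
  by (auto dest!: arg_cong[of _ _ "\<lambda>f. fps_nth f 1"])

lemma skew_coeff_mult:
  assumes "i > 0"
  shows "skew_coeff i * (1 - fps_exp (2 * of_nat i)) = (fps_exp 1 - fps_exp (- 1)) * fps_exp (2 * of_nat i)"
  unfolding skew_coeff_def
  by (rule dvd_div_mult_self, rule fps_dvd_order1) (use assms in auto)

lemma skew_coeff_1: "skew_coeff 1 = - fps_exp 1"
proof -
  have "skew_coeff 1 * (1 - fps_exp 2) = - fps_exp 1 * (1 - fps_exp 2)"
    using skew_coeff_mult[of 1] by (simp add: algebra_simps flip: fps_exp_add_mult)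
  then show ?thesis
    using one_minus_fps_exp_nonzero[of 1] by (metis mult_right_cancel mult_1_right of_nat_1 zero_less_one)
qed

text \<open>The parameter condition of \<open>skew_kill_step\<close>: consecutive arguments differ
  by the factor e^(2h). In q-integers it reads [i+1] = q^-1 [i] + q^i; the proof clears both
  denominators.\<close>

lemma skew_coeff_rec:
  assumes "i > 0"
  shows "skew_coeff i * (fps_exp 1 + skew_coeff (Suc i)) = fps_exp (- 1) * skew_coeff (Suc i)"
proof -
  let ?q = "fps_exp 1 :: complex fps" and ?p = "fps_exp (- 1) :: complex fps"
    and ?x = "fps_exp (2 * of_nat i) :: complex fps" and ?c = "skew_coeff i" and ?d = "skew_coeff (Suc i)"
  have S: "fps_exp (2 * of_nat (Suc i)) = ?q * ?q * ?x"
    by (simp flip: fps_exp_add_mult)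
  have c: "?c * (1 - ?x) = (?q - ?p) * ?x"
    using skew_coeff_mult[OF assms] .
  have d: "?d * (1 - ?q * ?q * ?x) = (?q - ?p) * (?q * ?q * ?x)"
    using skew_coeff_mult[of "Suc i"] unfolding S by simp
  have nz: "(1 - ?x) * (1 - ?q * ?q * ?x) \<noteq> 0"
    using one_minus_fps_exp_nonzero[OF assms] one_minus_fps_exp_nonzero[of "Suc i"] unfolding S by simp
  have "(?c * (?q + ?d) - ?p * ?d) * ((1 - ?x) * (1 - ?q * ?q * ?x)) =
    (?c * (1 - ?x)) * (?q * (1 - ?q * ?q * ?x) + ?d * (1 - ?q * ?q * ?x)) - ?p * (?d * (1 - ?q * ?q * ?x))
        * (1 - ?x)"
    by (simp add: algebra_simps)
  also have "\<dots> = (?q - ?p) * ?x * (?q - ?p * ?q * ?q * ?x - ?p * ?q * ?q + ?p * ?q * ?q * ?x)"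
    unfolding c d by (simp add: algebra_simps)
  also have "\<dots> = 0"
    using fps_exp_1_m1 by (simp add: mult.commute[of ?p])
  finally show ?thesis using nz by simp
qed

abbreviation skewL :: "('n::finite, complex fps) mat2 \<Rightarrow> nat \<Rightarrow> ('n, complex fps) lop" where
  "skewL R k \<equiv> Lop k (skew_symmetrizer R k)"

lemma Lop_smult: "Lop K (\<lambda>I J. c * A I J) = smul c (Lop K A)"
  by (rule lop_eqI) (simp add: ent_Lop)

lemma skewL_Suc:
  assumes "k > 0"
  shows "skewL R (Suc k) = smul ((- 1) ^ k * inverse (q_int (k + 1)))
    (prod_list (map (\<lambda>i. RL R (Suc k) i + smul (skew_coeff (Suc i)) (idL (Suc k)))
        [0..<k]) *
      lext (skewL R k))"
proof -
  have m: "map f [1..<k + 1] = map (\<lambda>i. f (Suc i)) [0..<k]" for f :: "nat \<Rightarrow> ('a, complex fps) tensop"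
    by (induction k) simp_all
  have F: "Lop (Suc k) (leg2 (Suc k) i (Suc i) (R + mat c)) =
    RL R (Suc k) i + smul c (idL (Suc k))" if "i < k" for i c
    using that by (simp add: Lop_leg2_add Lop_leg2_mat)
  have "skewL R (Suc k) = smul ((- 1) ^ k * inverse (q_int (k + 1)))
    (Lop (Suc k) (op_prod (Suc k) (map (\<lambda>i. leg2 (Suc k) i (Suc i) (R + mat (skew_coeff (Suc i))))
        [0..<k])) * lext (skewL R k))"
    using assms unfolding skew_symmetrizer.simps m
    by (simp add: Lop_smult Lop_op_mult lext_Lop R_hat_eq[of R "Suc _", simplified] del: upt_Suc)
  also have "Lop (Suc k) (op_prod (Suc k) (map (\<lambda>i. leg2 (Suc k) i (Suc i) (R + mat (skew_coeff (Suc i))))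
      [0..<k])) * lext (skewL R k) =
    prod_list (map (\<lambda>i. Lop (Suc k) (leg2 (Suc k) i (Suc i) (R + mat (skew_coeff (Suc i))))) [0..<k]) *
        lext (skewL R k)"
    by (simp add: Lop_op_prod mult.assoc lext_Lop comp_def)
  also have "map (\<lambda>i. Lop (Suc k) (leg2 (Suc k) i (Suc i) (R + mat (skew_coeff (Suc i))))) [0..<k] =
    map (\<lambda>i. RL R (Suc k) i + smul (skew_coeff (Suc i)) (idL (Suc k))) [0..<k]"
    by (rule map_cong) (simp_all add: F)
  finally show ?thesis .
qed

lemma skewL_kill:
  fixes R :: "('n::finite, complex fps) mat2"
  assumes h: "hecke_symmetry R"
  shows "Suc j < k \<Longrightarrow> (RL R k j + smul (fps_exp (- 1)) (idL k)) * skewL R k = 0"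
proof (induction k arbitrary: j)
  case (Suc k)
  then have k: "k > 0" by auto
  have X: "(RL R (Suc k) j + smul (fps_exp (- 1)) (idL (Suc k))) * lext (skewL R
      k) = 0"
    if "Suc j < k" for j
  proof -
    have "lext ((RL R k j + smul (fps_exp (- 1)) (idL k)) * skewL R k) = lext 0"
      using Suc.IH[OF that] by simp
    then show ?thesis
      using that by (simp add: lext_add lext_0 lext_mult lext_leg2 lext_smul lext_id)
  qed
  have "(RL R (Suc k) j + smul (fps_exp (- 1)) (idL (Suc k))) *
    (prod_list (map (\<lambda>i. RL R (Suc k) i + smul (skew_coeff (Suc i)) (idL (Suc k)))
        [0..<k]) *
      lext (skewL R k)) = 0"
    by (rule skew_kill_step[where q = "fps_exp 1"])
      (use Suc.prems X h in \<open>auto simp: fps_exp_1_m1 skew_coeff_1 skew_coeff_rec lext_Lop hecke_quadratic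
        intro!: hecke_braid leg2_leg2_commute mult.commute simp del: One_nat_def\<close>)
  then show ?case
    by (simp only: skewL_Suc[OF k] smul_mult_right_comm smul_0)
qed simp

lemma op_rank_eq_0:
  fixes A :: "('n::finite, complex fps) tensop"
  assumes "op_rank k A = 0" "length J = k"
  shows "A I J = 0"
proof -
  interpret V: vector_space "fls_scale :: complex fls \<Rightarrow> ('n list \<Rightarrow> complex fls) \<Rightarrow> _"
    by (rule vector_space_fls_scale)
  let ?S = "(\<lambda>J I. fps_to_fls (A I J)) ` multi_idx k"
  obtain B where B: "B \<subseteq> ?S" "?S \<subseteq> V.span B" "card B = V.dim ?S"
    using V.basis_exists[of ?S] by metis
  have "finite B" using B(1) by (rule finite_subset) simp
  then have "B = {}" using B(3) assms(1) by (simp add: op_rank_def)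
  moreover have "(\<lambda>I. fps_to_fls (A I J)) \<in> ?S" using assms(2) by simp
  ultimately have "(\<lambda>I. fps_to_fls (A I J)) = 0" using B(2) by auto
  then have "fps_to_fls (A I J) = 0" by (auto dest: fun_cong[of _ _ I])
  then show ?thesis by simp
qed

text \<open>The constant term of [k+1]_h is k + 1, so \<open>inverse\<close> is a true inverse here
  and not the default value 0 of a non-unit.\<close>

lemma q_int_nonzero: "inverse (q_int (k + 1)) \<noteq> 0"
proof -
  let ?k = "of_nat (k + 1) :: complex"
  have "q_int (k + 1) * (fps_exp 1 - fps_exp (- 1)) = fps_exp ?k - fps_exp (- ?k)"
    unfolding q_int_def by (rule dvd_div_mult_self, rule fps_dvd_order1) auto
  then have "fps_nth (q_int (k + 1) * (fps_exp 1 - fps_exp (- 1))) 1 = fps_nth (fps_exp ?k - fps_exp (-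
      ?k)) 1"
    by simp
  then have "fps_nth (q_int (k + 1)) 0 * 2 = 2 * ?k"
    by (simp add: fps_mult_nth)
  moreover have "?k \<noteq> 0" by (simp only: of_nat_eq_0_iff)
  ultimately have "fps_nth (q_int (k + 1)) 0 \<noteq> 0" by (metis mult_eq_0_iff zero_neq_numeral)
  then show ?thesis by simp
qed

text \<open>Beyond its degree the Hilbert series has coefficient 0, so the skew-symmetrizer of
  degree \<open>M + 1\<close> has rank 0 and vanishes; removing its nonzero scalar prefactor leaves
  the product. In degree 1 it is the identity, which excludes \<open>M = 0\<close>.\<close>

lemma rank_M0:
  fixes R :: "('n::finite, complex fps) mat2"
  assumes "has_rank_M0 R M"
  shows "M > 0" and "prod_list (map (\<lambda>i. RL R (Suc M) i +
    smul (skew_coeff (Suc i)) (idL (Suc M))) [0..<M]) * lext (skewL R M) = 0"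
proof -
  obtain P where P: "hilbert_series R = fps_of_poly P" "degree P = M"
    using assms unfolding has_rank_M0_def by blast
  have "fps_nth (hilbert_series R) (Suc M) = coeff P (Suc M)"
    using P by simp
  then have "op_rank (Suc M) (skew_symmetrizer R (Suc M)) = 0"
    using P by (simp add: hilbert_series_def coeff_eq_0 del: skew_symmetrizer.simps)
  then have zero: "skewL R (Suc M) = 0"
    by (intro lop_eqI) (auto simp: ent_Lop op_rank_eq_0 simp del: skew_symmetrizer.simps)
  show M: "M > 0"
  proof (rule ccontr)
    assume "\<not> M > 0"
    then have "ent (Lop 1 (op_id 1) :: ('n, complex fps) lop) [undefined] [undefined] = 0"
      using zero by simp
    then show False by (simp add: ent_Lop op_id_def)
  qed
  show "prod_list (map (\<lambda>i. RL R (Suc M) i +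
    smul (skew_coeff (Suc i)) (idL (Suc M))) [0..<M]) * lext (skewL R M) = 0"
    by (rule smul_cancel[OF zero[unfolded skewL_Suc[OF M]]]) (use q_int_nonzero[of M] in simp)
qed

section \<open>The multiplicative R-matrix\<close>

lemma subst_scale_hom: "ring_hom1 (subst_scale (u :: 'a::comm_ring_1))"
proof
  fix f g :: "'a fps"
  show "subst_scale u (f + g) = subst_scale u f + subst_scale u g"
    by (rule fps_ext) (simp add: nth_subst_scale algebra_simps)
  show "subst_scale u (f * g) = subst_scale u f * subst_scale u g"
  proof (rule fps_ext)
    fix n
    have "fps_nth f i * fps_nth g (n - i) * u ^ n = fps_nth f i * u ^ i * (fps_nth g (n - i) * u ^ (n - i))"
      if "i \<in> {0..n}" for i
    proof -
      have "u ^ n = u ^ i * u ^ (n - i)" using that by (simp flip: power_add)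
      then show ?thesis by (simp add: mult_ac)
    qed
    then show "fps_nth (subst_scale u (f * g)) n = fps_nth (subst_scale u f * subst_scale u g) n"
      by (simp add: nth_subst_scale fps_mult_nth sum_distrib_right)
  qed
  show "subst_scale u 1 = 1"
    by (rule fps_ext) (simp add: nth_subst_scale)
qed

lemma subst_scale_const: "subst_scale u (fps_const c) = fps_const (c :: 'a::ring_1)"
  by (rule fps_ext) (simp add: nth_subst_scale)

lemma subst_scale_X: "subst_scale u fps_X = fps_const (u :: 'a::ring_1) * fps_X"
  by (rule fps_ext) (auto simp: nth_subst_scale le_Suc_eq)

lemma fps_const_hom: "ring_hom1 (fps_const :: 'a::ring_1 \<Rightarrow> 'a fps)"
  by unfold_locales simp_all

text \<open>The braided form \<open>P R(x)\<close> of the multiplicative R-matrix.\<close>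

definition Q_mat :: "('n::finite, complex fps) mat2 \<Rightarrow> nat \<Rightarrow> ('n, complex fps fps) mat2" where
  "Q_mat R M = (\<chi> a b. f_bar M * (fps_const (R $ a $ b) +
      fps_const (fps_exp 1 - fps_exp (- 1)) * fps_X / (1 - fps_X) * mat 1 $ a $ b))"

lemma R_bar_eq: "R_bar R M $ (i, j) $ q = Q_mat R M $ (j, i) $ q"
proof -
  have f: "flip $ (i, j) $ q = (mat 1 $ (j, i) $ q :: 'b::zero_neq_one)" for q
    by (auto simp: flip_def mat_def prod_eq_iff)
  have "(flip ** R) $ (i, j) $ q = (\<Sum>k\<in>UNIV. if (j, i) = k then R $ k $ q else 0)"
    by (simp add: matrix_matrix_mult_def f mat_def mult_delta_left)
  then show ?thesis by (simp add: R_bar_def Q_mat_def f sum.delta')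
qed

text \<open>This is \<open>f_bar\<close> divided by 1 - x: the pole of the R-matrix at x = 1 is
  cleared, and what remains besides \<open>kappa\<close> is linear in x.\<close>

definition kappa :: "nat \<Rightarrow> complex fps fps" where
  "kappa M = 1 / (1 - fps_const (fps_exp (- 2)) * fps_X) * g_bar M"

lemma Q_mat_eq: "Q_mat R M $ a $ b = kappa M * ((1 - fps_X) * fps_const (R $ a $ b) +
   fps_const (fps_exp 1 - fps_exp (- 1)) * fps_X * mat 1 $ a $ b)"
proof -
  let ?w = "1 / (1 - fps_const (fps_exp (- 2)) * fps_X) :: complex fps fps"
  let ?B = "1 - fps_const (fps_exp (- 2)) * fps_X :: complex fps fps"
  let ?l = "fps_const (fps_exp 1 - fps_exp (- 1)) * fps_X :: complex fps fps"
  have "fps_nth ?B 0 \<noteq> 0" by simp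
  then have B: "?B \<noteq> 0" by (metis fps_zero_nth)
  have "(1 - fps_X) / ?B * ?B = (1 - fps_X) * ?w * ?B"
    by (simp only: divide_one_minus_mult mult.assoc mult_1_right)
  then have 1: "(1 - fps_X) / ?B = (1 - fps_X) * ?w"
    by (rule mult_right_cancel[OF B, THEN iffD1])
  have 2: "?l / (1 - fps_X) * (1 - fps_X) = ?l"
    using divide_one_minus_mult[of ?l 1] by simp
  have "Q_mat R M $ a $ b = ?w * g_bar M * ((1 - fps_X) * fps_const (R $ a $ b) + (?l / (1 - fps_X) * (1 -
      fps_X)) * mat 1 $ a $ b)"
    unfolding Q_mat_def f_bar_def 1 by (simp add: algebra_simps)
  then show ?thesis unfolding 2 kappa_def .
qed

lemma kappa_mult: "kappa M * (1 - fps_const (fps_exp (- 2)) * fps_X) = g_bar M"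
proof -
  have "kappa M * (1 - fps_const (fps_exp (- 2)) * fps_X) =
    (1 / (1 - fps_const (fps_exp (- 2)) * fps_X)) * (1 - fps_const (fps_exp (- 2)) * fps_X) * g_bar M"
    unfolding kappa_def by (simp only: mult_ac)
  then show ?thesis by (simp only: divide_one_minus_mult mult_1_left)
qed

text \<open>Put B_i = 1 - x p^(2i) and M = n + 1. Then kappa(x p^(2d)) B_(d+1) = g(x p^(2d)), and
  the functional equation of \<open>g_bar\<close> says that the right-hand sides multiply to B_n /
  B_0. Hence the kappas multiply to the inverse of B_0 ... B_(n-1) B_(n+1), the scalar left by
  \<open>chain_fusion_scalar\<close>.\<close>

lemma kappa_prod:
  "(\<Prod>d<Suc n. subst_scale (fps_exp (- 1) ^ (2 * d)) (kappa (Suc n))) *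
    ((\<Prod>i<n. 1 - fps_X * fps_const (fps_exp (- 1)) ^ (2 * i)) * (1 - fps_X * fps_const (fps_exp (- 1)) ^ (2
        * Suc n))) = 1"
proof -
  let ?p = "fps_exp (- 1) :: complex fps"
  define B where "B = (\<lambda>i. 1 - fps_X * fps_const ?p ^ (2 * i))"
  have nth0: "fps_nth (B i) 0 = 1" for i by (simp add: B_def)
  then have B: "B i \<noteq> 0" for i by (metis fps_zero_nth zero_neq_one)
  have p2: "fps_const (fps_exp (- 2 :: complex)) = fps_const (?p ^ 2)"
    by (simp add: power2_eq_square flip: fps_exp_add_mult)
  have S: "subst_scale (?p ^ (2 * d)) (1 - fps_const (fps_exp (- 2)) * fps_X) = B (Suc d)" for d
  proof -
    interpret ring_hom1 "subst_scale (?p ^ (2 * d))" by (rule subst_scale_hom)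
    have e: "fps_const ?p ^ (2 * Suc d) = fps_const (?p ^ 2) * fps_const (?p ^ (2 * d))"
      by (simp only: fps_const_power fps_const_mult power_add[symmetric]) simp
    show ?thesis
      unfolding p2 by (simp only: diff mult one subst_scale_const subst_scale_X) (simp only: B_def e, simp
          only: mult_ac)
  qed
  have K: "subst_scale (?p ^ (2 * d)) (kappa (Suc n)) * B (Suc d) = subst_scale (?p ^ (2 * d)) (g_bar (Suc
      n))" for d
    unfolding S[symmetric] kappa_mult[symmetric] by (simp add: ring_hom1.mult[OF subst_scale_hom])
  let ?N = "\<Prod>d<Suc n. subst_scale (?p ^ (2 * d)) (kappa (Suc n))"
  have NB: "?N * (\<Prod>d<Suc n. B (Suc d)) * B 0 = (\<Prod>d<Suc n. subst_scale (?p ^ (2 * d)) (g_bar (Suc n))) * (1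
      - fps_X)"
    unfolding prod.distrib[symmetric] K by (simp add: B_def)
  have Bn: "B n = 1 - fps_const (fps_exp (- 2 * of_nat n)) * fps_X"
    by (simp only: B_def fps_const_power fps_exp_m1_power mult.commute[of fps_X])
  have gB: "(\<Prod>d<Suc n. subst_scale (?p ^ (2 * d)) (g_bar (Suc n))) * (1 - fps_X) = B n"
    using g_bar(2)[of "Suc n"] unfolding Bn fps_exp_m1_power by simp
  have "?N * (\<Prod>d<Suc (Suc n). B d) = B n"
    using NB unfolding gB prod.lessThan_Suc_shift[of B "Suc n"] by (simp only: mult_ac)
  then have "?N * ((\<Prod>i<n. B i) * B (Suc n)) * B n = 1 * B n"
    by (simp add: mult_ac)
  then show ?thesis
    unfolding mult_right_cancel[OF B] unfolding B_def .
qed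

lemma Lop_Q_mat:
  fixes R :: "('n::finite, complex fps) mat2"
  assumes "Suc i < K"
  shows "Lop K (leg2 K i (Suc i) (\<chi> a b. subst_scale (fps_exp (- 1) ^ (2 * d)) (Q_mat R M $ a $ b))) =
    smul (subst_scale (fps_exp (- 1) ^ (2 * d)) (kappa M))
      (smul (1 - fps_X * fps_const (fps_exp (- 1)) ^ (2 * d)) (lop_map fps_const (RL R K i)) +
       smul ((fps_const (fps_exp 1) - fps_const (fps_exp (- 1))) * fps_X * fps_const (fps_exp (- 1)) ^ (2
           * d)) (idL K))"
proof -
  let ?u = "fps_exp (- 1 :: complex) ^ (2 * d)"
  let ?l = "(fps_const (fps_exp 1) - fps_const (fps_exp (- 1))) * fps_X * fps_const ?u :: complex fps fps"
  interpret S: ring_hom1 "subst_scale ?u" by (rule subst_scale_hom)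
  have m: "subst_scale ?u (mat 1 $ a $ b) = mat 1 $ a $ b" for a b :: "'n \<times> 'n"
    by (simp add: mat_def S.one S.zero)
  have Q: "subst_scale ?u (Q_mat R M $ a $ b) =
    subst_scale ?u (kappa M) * ((1 - fps_X * fps_const ?u) * fps_const (R $ a $ b) + ?l * mat 1 $ a $ b)"
        for a b
    unfolding Q_mat_eq S.mult S.add S.diff S.one subst_scale_const subst_scale_X m fps_const_sub[symmetric]
    by (simp only: mult_ac)
  have l: "mat ?l $ a $ b = ?l * mat 1 $ a $ b" for a b :: "'n \<times> 'n"
    by (simp add: mat_def)
  have "(\<chi> a b. subst_scale ?u (Q_mat R M $ a $ b)) =
    (\<chi> a b. subst_scale ?u (kappa M) * ((\<chi> a b. (1 - fps_X * fps_const ?u) * (\<chi> a b. fps_const (R $ a $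
        b)) $ a $ b) + mat ?l) $ a $ b)"
    by (simp only: vec_eq_iff vec_lambda_beta vector_add_component Q l) simp
  then show ?thesis
    using assms
    by (simp only: Lop_leg2_smult Lop_leg2_add Lop_leg2_mat Suc_lessD fps_const_power
        ring_hom1.lop_map_leg2[OF fps_const_hom])
qed

text \<open>Apart from the prefactors, the product of the Q_i is a chain of the kind treated by
  \<open>chain_fusion_scalar\<close>; the prefactors multiply to the inverse of the scalar found
  there, so no dependence on x survives.\<close>

lemma Q_mat_fusion:
  fixes R :: "('n::finite, complex fps) mat2"
  assumes h: "hecke_symmetry R" and rk: "has_rank_M0 R M"
  defines "K \<equiv> Suc M"
  shows "prod_list (map (\<lambda>i. Lop K (leg2 K i (Suc i) (\<chi> a b. subst_scale (fps_exp (- 1) ^ (2 * (M - Suc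
      i))) (Q_mat R M $ a $ b)))) [0..<M]) *
      lop_map fps_const (lext (skewL R M)) =
    lop_map fps_const (prod_list (map (\<lambda>i. RL R K i) [0..<M]) * lext (skewL R M))"
proof -
  interpret c: ring_hom1 "fps_const :: complex fps \<Rightarrow> complex fps fps" by (rule fps_const_hom)
  interpret L: ring_hom1 "lop_map fps_const :: ('n, complex fps) lop \<Rightarrow> ('n, complex fps fps) lop"
    by (rule c.lop_map)
  have M: "M > 0" using rank_M0[OF rk] by simp
  define n where "n = M - 1"
  have Mn: "M = Suc n" using M by (simp add: n_def)
  define p where "p = (fps_const (fps_exp (- 1)) :: complex fps fps)"
  define q where "q = (fps_const (fps_exp 1) :: complex fps fps)"
  \<comment> \<open>At z0 = q^(2M) factor d has argument q^(2(M-d)), so the chain becomes a multiple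
    of the product defining the skew-symmetrizer of degree M + 1, which is zero.\<close>
  let ?z0 = "fps_const (fps_exp (2 * of_nat M)) :: complex fps fps"
  define r where "r = (\<lambda>i. lop_map fps_const (RL R K i))"
  define X where "X = lop_map fps_const (lext (skewL R M))"
  define \<rho> where "\<rho> = (\<lambda>d. r (M - Suc d))"
  have eX: "idL K * X = X"
    by (simp add: X_def c.lop_map_Lop lext_Lop K_def)
  have er: "idL K * r i = r i" for i by (simp add: r_def c.lop_map_leg2)
  have e: "idL K * chain \<rho> X d = chain \<rho> X d" for d
    by (cases d) (simp_all add: eX er \<rho>_def flip: mult.assoc)
  have kill: "r j * X = smul (- p) X" if "Suc j < M" for j
  proof -
    have "lop_map fps_const (lext ((RL R M j + smul (fps_exp (- 1)) (idL M)) * skewL R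
        M)) = lop_map fps_const (lext 0)"
      using skewL_kill[OF h that] by simp
    then have "(lop_map fps_const (RL R K j) + smul p (lop_map fps_const (idL K)))
        * X = 0"
      using that by (simp add: lext_add lext_0 lext_mult lext_leg2 lext_smul lext_id L.mult L.add L.zero c.lop_map_smul
          X_def K_def p_def)
    moreover have "lop_map fps_const (idL K) = (idL K :: ('n, complex fps fps) lop)"
      by (rule lop_eqI) (simp add: c.ent_lop_map ent_Lop op_id_def)
    ultimately show ?thesis
      using eX by (simp add: r_def distrib_right smul_mult_left smul_minus add_eq_0_iff2)
  qed
  have comm: "r i * r j = r j * r i" if "Suc i < j" "j < M" for i j
    unfolding r_def L.mult[symmetric]
    by (rule arg_cong[where f = "lop_map fps_const"], rule leg2_leg2_commute) (use that K_def in auto)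
  have far: "\<rho> d * chain \<rho> X d' = smul (- p) (chain \<rho> X d')" if "d' < d" "d \<le> n" for d d'
    using that
  proof (induction d')
    case 0
    then show ?case by (simp add: \<rho>_def kill Mn)
  next
    case (Suc d')
    have "\<rho> d * \<rho> d' = \<rho> d' * \<rho> d"
      unfolding \<rho>_def by (rule comm) (use Suc Mn in auto)
    then have "\<rho> d * chain \<rho> X (Suc d') = \<rho> d' * (\<rho> d * chain \<rho> X d')"
      by (simp flip: mult.assoc)
    also have "\<dots> = smul (- p) (chain \<rho> X (Suc d'))"
      using Suc by (simp add: smul_mult_right_comm)
    finally show ?case .
  qed
  define F where "F = (\<lambda>z d. smul (1 - z * p ^ (2 * d)) (\<rho> d) + smul ((q - p) * z * p ^ (2 * d)) (idL K))"
  have z0p: "?z0 * p ^ (2 * d) = fps_const (fps_exp (2 * of_nat (M - d)))" if "d \<le> M" for d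
    using that by (simp add: p_def fps_const_power fps_exp_power_mult of_nat_diff algebra_simps flip:
        fps_exp_add_mult)
  have G0: "chain (F ?z0) X (Suc n) = 0"
  proof -
    let ?f = "\<lambda>i. RL R K i + smul (skew_coeff (Suc i)) (idL K)"
    have eK: "lop_map fps_const (idL K) = (idL K :: ('n, complex fps fps) lop)"
      by (rule lop_eqI) (simp add: c.ent_lop_map ent_Lop op_id_def)
    have Fz: "F ?z0 d = smul (fps_const (1 - fps_exp (2 * of_nat (M - d)))) (lop_map fps_const (?f (M -
        Suc d)))"
      if "d < M" for d
    proof -
      have S: "Suc (M - Suc d) = M - d" using that by simp
      define x where "x = (fps_exp (2 * of_nat (M - d)) :: complex fps)"
      have "skew_coeff (M - d) * (1 - x) = (fps_exp 1 - fps_exp (- 1)) * x"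
        using skew_coeff_mult[of "M - d"] that by (simp add: x_def)
      then have k: "fps_const (1 - x) * fps_const (skew_coeff (M - d)) = (q - p) * fps_const x"
        by (simp only: p_def q_def fps_const_mult fps_const_sub mult.commute)
      have "1 - fps_const x = fps_const (1 - x)" by simp
      then show ?thesis
        unfolding F_def mult.assoc z0p[OF less_imp_le[OF that]] x_def[symmetric] S L.add c.lop_map_smul eK
            smul_add smul_smul k
        by (simp only: \<rho>_def r_def S)
    qed
    have "chain (F ?z0) X M = prod_list (map (\<lambda>i. F ?z0 (M - Suc i)) [0..<M]) * X"
      by (rule chain_eq_prod_list)
    also have "map (\<lambda>i. F ?z0 (M - Suc i)) [0..<M] =
      map (\<lambda>i. smul (fps_const (1 - fps_exp (2 * of_nat (M - (M - Suc i))))) (lop_map fps_const (?f (M -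
          Suc (M - Suc i))))) [0..<M]"
      by (rule map_cong[OF refl]) (rule Fz, simp)
    also have "prod_list \<dots> * X = chain (\<lambda>d. smul (fps_const (1 - fps_exp (2 * of_nat (M - d)))) (lop_map
        fps_const (?f (M - Suc d)))) X M"
      by (rule chain_eq_prod_list[symmetric])
    also have "\<dots> = smul (\<Prod>d<M. fps_const (1 - fps_exp (2 * of_nat (M - d)))) (chain (\<lambda>d. lop_map fps_const
        (?f (M - Suc d))) X M)"
      by (rule chain_smul)
    also have "chain (\<lambda>d. lop_map fps_const (?f (M - Suc d))) X M =
      prod_list (map (\<lambda>i. lop_map fps_const (?f (M - Suc (M - Suc i)))) [0..<M]) * X"
      by (rule chain_eq_prod_list)
    also have "map (\<lambda>i. lop_map fps_const (?f (M - Suc (M - Suc i)))) [0..<M] = map (lop_map fps_const)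
        (map ?f [0..<M])"
      by (simp add: Suc_diff_Suc)
    also have "prod_list \<dots> * X = lop_map fps_const (prod_list (map ?f [0..<M]) * lext (skewL R M))"
      unfolding X_def by (simp only: L.mult L.prod_list)
    also have "prod_list (map ?f [0..<M]) * lext (skewL R M) = 0"
      unfolding K_def by (rule rank_M0(2)[OF rk])
    finally show ?thesis by (simp add: Mn L.zero)
  qed
  have fus: "chain (F fps_X) X (Suc n) =
    smul ((\<Prod>i<n. 1 - fps_X * p ^ (2 * i)) * (1 - fps_X * p ^ (2 * Suc n))) (chain \<rho> X (Suc n))"
    unfolding F_def
  proof (rule chain_fusion_scalar[where ?z0.0 = ?z0, OF _ e far])
    show "q * p = 1" using fps_exp_1_m1 by (simp add: p_def q_def)
    show "?z0 * p ^ (2 * Suc n) = 1" using z0p[of M] Mn by simp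
    show "?z0 * p ^ (2 * i) \<noteq> 1" if "i < n" for i
    proof -
      have "fps_exp (2 * of_nat (M - i) :: complex) \<noteq> 1"
        using one_minus_fps_exp_nonzero[of "M - i"] that Mn by simp
      then have "fps_nth (?z0 * p ^ (2 * i)) 0 \<noteq> fps_nth 1 0"
        using z0p[of i] that Mn by simp
      then show ?thesis by metis
    qed
  qed (use G0 in \<open>simp_all add: F_def\<close>)
  have "prod_list (map (\<lambda>i. Lop K (leg2 K i (Suc i) (\<chi> a b. subst_scale (fps_exp (- 1) ^ (2 * (M - Suc
      i))) (Q_mat R M $ a $ b)))) [0..<M]) * X =
     prod_list (map (\<lambda>i. smul (subst_scale (fps_exp (- 1) ^ (2 * (M - Suc i))) (kappa M)) (F fps_X (M -
         Suc i))) [0..<M]) * X"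
    by (intro arg_cong[where f = "\<lambda>xs. prod_list xs * X"] map_cong refl)
      (subst Lop_Q_mat, simp_all add: K_def F_def \<rho>_def r_def Suc_diff_Suc p_def q_def)
  also have "\<dots> = chain (\<lambda>d. smul (subst_scale (fps_exp (- 1) ^ (2 * d)) (kappa M)) (F fps_X d)) X M"
    by (rule chain_eq_prod_list[symmetric])
  also have "\<dots> = smul (\<Prod>d<M. subst_scale (fps_exp (- 1) ^ (2 * d)) (kappa M)) (chain (F fps_X) X (Suc n))"
    unfolding chain_smul Mn ..
  also have "\<dots> = chain \<rho> X M"
    unfolding fus smul_smul Mn p_def kappa_prod by simp
  also have "\<dots> = prod_list (map (\<lambda>i. \<rho> (M - Suc i)) [0..<M]) * X"
    by (rule chain_eq_prod_list)
  also have "map (\<lambda>i. \<rho> (M - Suc i)) [0..<M] = map (lop_map fps_const) (map (\<lambda>i. RL R K i) [0..<M])"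
    by (simp add: \<rho>_def r_def Suc_diff_Suc)
  also have "prod_list \<dots> * X = lop_map fps_const (prod_list (map (\<lambda>i. RL R K i) [0..<M])
      * lext (skewL R M))"
    unfolding X_def by (simp only: L.mult L.prod_list)
  finally show ?thesis unfolding X_def .
qed

section \<open>Scalars and evaluation of power series\<close>

lemma poly_mapping_additive_induct [case_names zero single add]:
  fixes f :: "'k \<Rightarrow>\<^sub>0 'v::monoid_add"
  assumes "P 0" "\<And>k v. P (Poly_Mapping.single k v)" "\<And>f g. P f \<Longrightarrow> P g \<Longrightarrow> P (f + g)"
  shows "P f"
proof (induction f rule: update_induct)
  case (update f a b)
  have "Poly_Mapping.update a b f = f + Poly_Mapping.single a b"
    using update(1)
    by (intro poly_mapping_eqI) (auto simp: lookup_update lookup_add lookup_single in_keys_iff when_def)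
  then show ?case using assms update by simp
qed (rule assms)

lemma single_0_commute:
  fixes f :: "'w::monoid_add \<Rightarrow>\<^sub>0 'v::comm_semiring_1"
  shows "Poly_Mapping.single 0 c * f = f * Poly_Mapping.single 0 c"
  by (induction f rule: poly_mapping_additive_induct) (simp_all add: mult_single distrib_left
      distrib_right mult.commute)

lemma nth_scalar: "fps_nth (scalar f) n = Poly_Mapping.single 0 (fps_nth f n)"
  by (simp add: scalar_def)

lemma single_sum: "Poly_Mapping.single k (sum f S) = (\<Sum>x\<in>S. Poly_Mapping.single k (f x ::
    'v::comm_monoid_add))"
  by (induction S rule: infinite_finite_induct) (simp_all add: single_add)

lemma scalar_hom: "ring_hom1 (scalar :: complex fps \<Rightarrow> 'n falg)"
proof
  fix f g :: "complex fps"
  show "scalar (f + g) = (scalar f + scalar g :: 'n falg)"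
    by (rule fps_ext) (simp add: nth_scalar single_add)
  show "scalar (f * g) = (scalar f * scalar g :: 'n falg)"
    by (rule fps_ext) (simp add: nth_scalar fps_mult_nth single_sum mult_single)
  show "scalar 1 = (1 :: 'n falg)"
    by (rule fps_ext) (simp add: nth_scalar)
qed

interpretation scalar: ring_hom1 "scalar :: complex fps \<Rightarrow> 'n falg"
  by (rule scalar_hom)

lemma scalar_commute: "scalar c * y = y * scalar c"
proof (rule fps_ext)
  fix n
  have "fps_nth (scalar c * y) n = (\<Sum>i=0..n. fps_nth y (n - i) * Poly_Mapping.single 0 (fps_nth c i))"
    by (simp add: fps_mult_nth nth_scalar single_0_commute)
  also have "\<dots> = (\<Sum>i=0..n. fps_nth y i * Poly_Mapping.single 0 (fps_nth c (n - i)))"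
    by (rule sum.reindex_bij_witness[of _ "\<lambda>i. n - i" "\<lambda>i. n - i"]) auto
  finally show "fps_nth (scalar c * y) n = fps_nth (y * scalar c) n"
    by (simp add: fps_mult_nth nth_scalar)
qed

lemma scalar_X: "scalar fps_X = fps_X"
  by (rule fps_ext) (simp add: nth_scalar)

text \<open>Substitution of \<tau> times the variable for the variable, after mapping the
  coefficients. It is multiplicative for central \<tau>, even if the coefficients do not commute
  with one another.\<close>

definition ev :: "('c \<Rightarrow> 'b) \<Rightarrow> 'b \<Rightarrow> 'c fps \<Rightarrow> 'b::ring_1 fps" where
  "ev \<phi> \<tau> f = Abs_fps (\<lambda>n. \<phi> (fps_nth f n) * \<tau> ^ n)"

lemma nth_ev: "fps_nth (ev \<phi> \<tau> f) n = \<phi> (fps_nth f n) * \<tau> ^ n"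
  by (simp add: ev_def)

lemma power_commute_central:
  fixes \<tau> :: "'b::ring_1"
  assumes "\<And>x. \<tau> * x = x * \<tau>"
  shows "\<tau> ^ n * x = x * \<tau> ^ n"
proof (induction n)
  case (Suc n)
  have "\<tau> ^ Suc n * x = \<tau> * (\<tau> ^ n * x)" by (simp add: mult.assoc)
  also have "\<dots> = (\<tau> * x) * \<tau> ^ n" unfolding Suc by (simp add: mult.assoc)
  also have "\<dots> = x * \<tau> ^ Suc n" unfolding assms by (simp add: mult.assoc)
  finally show ?case .
qed simp

lemma ev_hom:
  assumes "ring_hom1 \<phi>" and central: "\<And>x. \<tau> * x = x * \<tau>"
  shows "ring_hom1 (ev \<phi> \<tau>)"
proof -
  interpret ring_hom1 \<phi> by fact
  show ?thesis
  proof
    fix f g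
    show "ev \<phi> \<tau> (f + g) = ev \<phi> \<tau> f + ev \<phi> \<tau> g"
      by (rule fps_ext) (simp add: nth_ev add distrib_right)
    show "ev \<phi> \<tau> 1 = 1"
      by (rule fps_ext) (simp add: nth_ev one zero)
    show "ev \<phi> \<tau> (f * g) = ev \<phi> \<tau> f * ev \<phi> \<tau> g"
    proof (rule fps_ext)
      fix n
      have "\<phi> (fps_nth f i * fps_nth g (n - i)) * \<tau> ^ n =
          \<phi> (fps_nth f i) * \<tau> ^ i * (\<phi> (fps_nth g (n - i)) * \<tau> ^ (n - i))" if "i \<in> {0..n}" for i
      proof -
        have "\<tau> ^ n = \<tau> ^ i * \<tau> ^ (n - i)" using that by (simp flip: power_add)
        then have "\<phi> (fps_nth f i * fps_nth g (n - i)) * \<tau> ^ n =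
          \<phi> (fps_nth f i) * (\<phi> (fps_nth g (n - i)) * \<tau> ^ i) * \<tau> ^ (n - i)"
          by (simp only: mult mult.assoc)
        then show ?thesis
          unfolding power_commute_central[OF central, of i "\<phi> (fps_nth g (n - i))", symmetric] by (simp
              only: mult.assoc)
      qed
      then show "fps_nth (ev \<phi> \<tau> (f * g)) n = fps_nth (ev \<phi> \<tau> f * ev \<phi> \<tau> g) n"
        by (simp add: nth_ev fps_mult_nth sum sum_distrib_right)
    qed
  qed
qed

section \<open>Coefficient ideals and torsion\<close>

definition coeff_ideal :: "'b::ring_1 set \<Rightarrow> 'b fps set" where
  "coeff_ideal J = {f. \<forall>n. fps_nth f n \<in> J}"

lemma coeff_ideal: "two_sided_ideal J \<Longrightarrow> two_sided_ideal (coeff_ideal J)"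
proof -
  assume "two_sided_ideal J"
  then interpret two_sided_ideal J .
  show ?thesis
    by unfold_locales
      (auto simp: coeff_ideal_def zero_mem add_mem fps_mult_nth intro!: sum_mem intro: mult_left_mem
          mult_right_mem)
qed

locale torsion_free_ideal = two_sided_ideal J for J :: "'n::finite falg set" +
  assumes torsion_free: "fps_X * b \<in> J \<Longrightarrow> b \<in> J"
begin

text \<open>A nonzero element of C[[h]] is a unit times a power of h, so absence of h-torsion
  permits cancelling every nonzero scalar.\<close>

lemma scalar_cancel:
  assumes "scalar c * b \<in> J" "c \<noteq> 0"
  shows "b \<in> J"
proof -
  define k where "k = subdegree c"
  define u where "u = fps_shift k c"
  have c: "c = u * fps_X ^ k" using subdegree_decompose[of c] by (simp add: u_def k_def)
  have "fps_nth u 0 \<noteq> 0" using assms(2) by (simp add: u_def k_def)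
  then have u: "inverse u * u = 1" by (rule inverse_mult_eq_1)
  have "scalar (inverse u) * (scalar c * b) \<in> J"
    using assms(1) by (rule mult_left_mem)
  also have "scalar (inverse u) * (scalar c * b) = scalar (inverse u * u) * scalar (fps_X ^ k) * b"
    unfolding c by (simp add: scalar.mult mult.assoc)
  also have "\<dots> = fps_X ^ k * b"
    by (simp add: u scalar.one scalar.power scalar_X)
  finally have "fps_X ^ k * b \<in> J" .
  then show ?thesis
    by (induction k) (auto simp: mult.assoc dest: torsion_free)
qed

lemma scalar_cancel1:
  assumes "fps_const (scalar c) * f \<in> coeff_ideal J" "c \<noteq> 0"
  shows "f \<in> coeff_ideal J"
  using assms scalar_cancel by (auto simp: coeff_ideal_def)

lemma scalar_cancel2:
  assumes "fps_const (fps_const (scalar c)) * f \<in> coeff_ideal (coeff_ideal J)" "c \<noteq> 0"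
  shows "f \<in> coeff_ideal (coeff_ideal J)"
  using assms scalar_cancel1 unfolding coeff_ideal_def[of "coeff_ideal J"] by auto

end

section \<open>The defining relations\<close>

definition swap2 :: "('n::finite, 'a) mat2 \<Rightarrow> ('n, 'a) mat2" where
  "swap2 A = (\<chi> p q. A $ prod.swap p $ prod.swap q)"

lemma leg2_swap: "leg2 K s r A = leg2 K r s (swap2 A)"
  by (intro ext) (auto simp: leg2_def swap2_def)

lemma op_prod_2:
  fixes A :: "('n::finite, 'a::ring_1) mat2"
  assumes "length I = 2" "length J = 2" "r < 2" "s < 2" "r \<noteq> s"
  shows "op_prod 2 [leg2 2 r s A, leg1 2 r T, leg1 2 s S] I J = (A ** kron T S) $ (I ! r, I ! s) $ (J ! r,
      J ! s)"
    and "op_prod 2 [leg1 2 r T, leg1 2 s S, leg2 2 r s A] I J = (kron T S ** A) $ (I ! r, I ! s) $ (J ! r,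
        J ! s)"
proof -
  have c: "\<forall>p<2. p \<noteq> r \<and> p \<noteq> s \<longrightarrow> I ! p = J ! p" using assms by auto
  have ent: "op_prod 2 xs I J = ent (prod_list (map (Lop 2) xs) * idL 2) I J" for xs :: "('n, 'a) tensop list"
    using assms by (simp add: ent_Lop flip: Lop_op_prod)
  have l: "ent (Lop 2 (leg2 2 r s B)) I J = B $ (I ! r, I ! s) $ (J ! r, J ! s)" for B :: "('n, 'a) mat2"
    using assms c by (simp add: ent_Lop leg2_def)
  have "prod_list (map (Lop 2) [leg2 2 r s A, leg1 2 r T, leg1 2 s S]) * idL 2 = Lop 2 (leg2 2 r s (A **
      kron T S))"
    using assms by (simp add: leg1_leg1 leg2_leg2)
  then show "op_prod 2 [leg2 2 r s A, leg1 2 r T, leg1 2 s S] I J = (A ** kron T S) $ (I ! r, I ! s) $ (J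
      ! r, J ! s)"
    by (simp only: ent l)
  have "prod_list (map (Lop 2) [leg1 2 r T, leg1 2 s S, leg2 2 r s A]) * idL 2 = Lop 2 (leg2 2 r s (kron T
      S ** A))"
    using assms by (simp add: leg1_leg1 leg2_leg2 flip: mult.assoc)
  then show "op_prod 2 [leg1 2 r T, leg1 2 s S, leg2 2 r s A] I J = (kron T S ** A) $ (I ! r, I ! s) $ (J
      ! r, J ! s)"
    by (simp only: ent l)
qed

lemma kron_0: "kron (0 :: ('n::finite, 'a::ring_1) mat1) S = 0" "kron T (0 :: ('n::finite, 'a::ring_1)
    mat1) = 0"
  by (simp_all add: kron_def vec_eq_iff)

lemma Sum_any_le:
  assumes "\<And>k::nat. m < k \<Longrightarrow> f k = 0"
  shows "Sum_any f = (\<Sum>k\<le>m. f k)"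
proof (rule Sum_any.expand_superset)
  show "{k. f k \<noteq> 0} \<subseteq> {..m}" using assms not_le by blast
qed simp

lemma mat_mult_entry: "(A ** B) $ p $ q = (\<Sum>e\<in>UNIV. A $ p $ e * B $ e $ q)"
  by (simp add: matrix_matrix_mult_def)

lemma T_plus_coeff_neg: "p < 0 \<Longrightarrow> T_plus_coeff p = 0"
  by (simp add: T_plus_coeff_def vec_eq_iff)

text \<open>The coefficient of x^m y^n in Q(u z) T_1(x) V_2(y) - V_1(y) T_2(x) Q(u' z), where z = x
  / y and T = T^+. A power z^k takes k from the exponent of x, so the sums end at k = m, where T^+
  runs out of powers.\<close>

definition exchange_rel ::
  "'n falg set \<Rightarrow> ('n::finite, complex fps fps) mat2 \<Rightarrow> complex fps \<Rightarrow> complex fps \<Rightarrow> (int \<Rightarrow> ('n, 'n falg)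
      mat1) \<Rightarrow> bool" where
  "exchange_rel J Q u u' V \<longleftrightarrow> (\<forall>m n p q.
     (\<Sum>k\<le>m. (mat2_coeff Q u k ** kron (T_plus_coeff (int m - int k)) (V (n + int k))) $ p $ q) -
     (\<Sum>k\<le>m. (kron (V (n + int k)) (T_plus_coeff (int m - int k)) ** mat2_coeff Q u' k) $ p $ q) \<in> J)"

lemma exchange_plus:
  fixes R :: "('n::finite, complex fps) mat2"
  assumes "D_relations R M a c \<subseteq> J"
  shows "exchange_rel J (Q_mat R M) 1 1 T_plus_coeff"
  unfolding exchange_rel_def
proof (intro allI)
  fix m n and p q :: "'n \<times> 'n"
  let ?T = "T_plus_coeff :: int \<Rightarrow> ('n, 'n falg) mat1"
  \<comment> \<open>Reversing the row index multiplies the relation by the flip P from the left.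
    This turns \<open>R_bar\<close> into Q and exchanges the legs of T_2(y) T_1(x) on the right-hand
    side.\<close>
  let ?I = "[snd p, fst p]" and ?J = "[fst q, snd q]"
  let ?A = "\<lambda>k. mat2_coeff (R_bar R M) 1 k :: ('n, 'n falg) mat2" and ?Q = "\<lambda>k. mat2_coeff (Q_mat R M) 1 k
      :: ('n, 'n falg) mat2"
  have A: "?A k $ (i, j) $ e = ?Q k $ (j, i) $ e" for k i j e
    by (simp add: mat2_coeff_def R_bar_eq)
  have 1: "op_prod 2 [leg2 2 0 1 (?A k), leg1 2 0 T, leg1 2 1 S] ?I ?J = (?Q k ** kron T S) $ p $ q" for k T S
    by (subst op_prod_2) (simp_all add: mat_mult_entry A)
  have 2: "op_prod 2 [leg1 2 1 S, leg1 2 0 T, leg2 2 0 1 (?A k)] ?I ?J = (kron S T ** ?Q k) $ p $ q" for k T S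
    unfolding leg2_swap[of 2 0 1]
    by (subst op_prod_2) (simp_all add: mat_mult_entry swap2_def A prod.swap_def)
  have "RTT_relation (R_bar R M) ?T (int m) n ?I ?J =
     (\<Sum>k\<le>m. (?Q k ** kron (?T (int m - int k)) (?T (n + int k))) $ p $ q) -
     (\<Sum>k\<le>m. (kron (?T (n + int k)) (?T (int m - int k)) ** ?Q k) $ p $ q)"
    unfolding RTT_relation_def 1 2
    by (intro arg_cong2[of _ _ _ _ minus] Sum_any_le) (simp_all add: T_plus_coeff_neg kron_0 mat_mult_entry)
  moreover have "RTT_relation (R_bar R M) ?T (int m) n ?I ?J \<in> D_relations R M a c"
    unfolding D_relations_def by (intro UnI1 CollectI exI conjI, rule refl, rule TrueI)
  ultimately show "(\<Sum>k\<le>m. (?Q k ** kron (?T (int m - int k)) (?T (n + int k))) $ p $ q) -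
     (\<Sum>k\<le>m. (kron (?T (n + int k)) (?T (int m - int k)) ** ?Q k) $ p $ q) \<in> J"
    using assms by auto
qed

text \<open>Here z is the argument of T^+ over that of T^-, so the variables of the mixed relation
  change roles and its right-hand side becomes the left-hand side; the ideal absorbs the
  sign.\<close>

lemma exchange_minus:
  fixes R :: "('n::finite, complex fps) mat2"
  assumes "D_relations R M a c \<subseteq> J" "two_sided_ideal J"
  shows "exchange_rel J (Q_mat R M) (fps_exp (c / a)) (fps_exp (- (c / a))) T_minus_coeff"
  unfolding exchange_rel_def
proof (intro allI)
  fix m n and p q :: "'n \<times> 'n"
  let ?d = "c / a"
  let ?T = "T_plus_coeff :: int \<Rightarrow> ('n, 'n falg) mat1" and ?V = "T_minus_coeff :: int \<Rightarrow> ('n, 'n falg) mat1"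
  let ?I = "[fst p, snd p]" and ?J = "[snd q, fst q]"
  let ?A = "\<lambda>u k. mat2_coeff (R_bar R M) u k :: ('n, 'n falg) mat2" and ?Q = "\<lambda>u k. mat2_coeff (Q_mat R M)
      u k :: ('n, 'n falg) mat2"
  have A: "?A u k $ (i, j) $ e = ?Q u k $ (j, i) $ e" for u k i j e
    by (simp add: mat2_coeff_def R_bar_eq)
  have 1: "op_prod 2 [leg2 2 1 0 (?A u k), leg1 2 1 T, leg1 2 0 S] ?I ?J = (?Q u k ** kron T S) $ p $ q"
      for u k T S
    by (subst op_prod_2) (simp_all add: mat_mult_entry A)
  have 2: "op_prod 2 [leg1 2 0 S, leg1 2 1 T, leg2 2 1 0 (?A u k)] ?I ?J = (kron S T ** ?Q u k) $ p $ q"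
      for u k T S
    unfolding leg2_swap[of 2 1 0]
    by (subst op_prod_2) (simp_all add: mat_mult_entry swap2_def A prod.swap_def)
  let ?x = "(\<Sum>k\<le>m. (?Q (fps_exp ?d) k ** kron (?T (int m - int k)) (?V (n + int k))) $ p $ q)"
  let ?y = "(\<Sum>k\<le>m. (kron (?V (n + int k)) (?T (int m - int k)) ** ?Q (fps_exp (- ?d)) k) $ p $ q)"
  have "mixed_relation (R_bar R M) ?d n (int m) ?I ?J = ?y - ?x"
    unfolding mixed_relation_def 1 2
    by (intro arg_cong2[of _ _ _ _ minus] Sum_any_le) (simp_all add: T_plus_coeff_neg kron_0 mat_mult_entry)
  moreover have "mixed_relation (R_bar R M) ?d n (int m) ?I ?J \<in> D_relations R M a c"
    unfolding D_relations_def by (intro UnI2 CollectI exI conjI, rule refl, rule TrueI)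
  ultimately show "?x - ?y \<in> J"
    using two_sided_ideal.minus_mem[OF assms(2), of "?y - ?x"] assms(1) by auto
qed

section \<open>Exchange relations as identities between double series\<close>

lemma fps_central:
  fixes f :: "'b::ring_1 fps"
  assumes "\<And>n x. fps_nth f n * x = x * fps_nth f n"
  shows "f * y = y * f"
proof (rule fps_ext)
  fix n
  have "fps_nth (f * y) n = (\<Sum>i=0..n. fps_nth y (n - i) * fps_nth f i)"
    by (simp add: fps_mult_nth assms)
  also have "\<dots> = (\<Sum>i=0..n. fps_nth y i * fps_nth f (n - i))"
    by (rule sum.reindex_bij_witness[of _ "\<lambda>i. n - i" "\<lambda>i. n - i"]) auto
  finally show "fps_nth (f * y) n = fps_nth (y * f) n"
    by (simp add: fps_mult_nth)
qed

lemma const_scalar_commute: "fps_const (scalar c) * y = y * fps_const (scalar c)"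
  by (rule fps_central) (simp add: scalar_commute)

lemma const_scalar_hom: "ring_hom1 (\<lambda>c. fps_const (scalar c))"
  by unfold_locales (simp_all add: scalar.add scalar.mult scalar.one)

text \<open>
  The series in \<open>x\<close> and \<open>y\<close> are represented in \<^typ>\<open>'n falg fps fps\<close> with outer variable \<open>w\<close> and inner variable \<open>t\<close>, where
  \<open>x = t\<^sup>a w\<close> and \<open>x / y = t\<^sup>b w\<close>.  For \<open>S = T\<^sup>+\<close> one takes \<open>t = y\<close>, i.e. \<open>(a, b) = (1, 0)\<close>, and for \<open>S = T\<^sup>-\<close> one takes \<open>t = y\<^sup>-\<^sup>1\<close>,
  i.e. \<open>(a, b) = (0, 1)\<close>, so that no negative powers occur.
\<close>

definition evQ :: "nat \<Rightarrow> complex fps \<Rightarrow> complex fps fps \<Rightarrow> 'n falg fps fps" where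
  "evQ b u = ev (\<lambda>c. fps_const (scalar c)) (fps_const (scalar u) * fps_X ^ b)"

definition evT :: "nat \<Rightarrow> 'n falg fps \<Rightarrow> 'n falg fps fps" where
  "evT a = ev fps_const (fps_X ^ a)"

lemma const_X_power:
  "(fps_const (scalar c :: 'n falg) * fps_X ^ b) ^ k = fps_const (scalar (c ^ k)) * fps_X ^ (b * k)"
proof (induction k)
  case (Suc k)
  have "(fps_const (scalar c :: 'n falg) * fps_X ^ b) ^ Suc k =
    fps_const (scalar c) * (fps_X ^ b * fps_const (scalar (c ^ k))) * fps_X ^ (b * k)"
    unfolding power_Suc Suc by (simp only: mult.assoc)
  also have "\<dots> = fps_const (scalar c * scalar (c ^ k)) * (fps_X ^ b * fps_X ^ (b * k))"
    unfolding const_scalar_commute[symmetric] by (simp only: mult.assoc fps_const_mult[symmetric])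
  also have "\<dots> = fps_const (scalar (c ^ Suc k)) * fps_X ^ (b * Suc k)"
    by (simp only: scalar.mult[symmetric] power_Suc mult_Suc_right power_add)
  finally show ?case .
qed (simp add: scalar.one)

lemma central_const_X: "fps_const (scalar u) * fps_X ^ b * x = x * (fps_const (scalar u) * fps_X ^ b)"
proof -
  have "fps_const (scalar u) * fps_X ^ b * x = fps_const (scalar u) * (fps_X ^ b * x)"
    by (simp only: mult.assoc)
  also have "\<dots> = (fps_const (scalar u) * x) * fps_X ^ b"
    unfolding fps_mult_fps_X_power_commute[of b x] by (simp only: mult.assoc)
  also have "\<dots> = x * (fps_const (scalar u) * fps_X ^ b)"
    unfolding const_scalar_commute[of u x] by (simp only: mult.assoc)
  finally show ?thesis .
qed

lemma evQ_hom: "ring_hom1 (evQ b u)"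
  unfolding evQ_def by (rule ev_hom[OF const_scalar_hom central_const_X])

lemma evT_hom: "ring_hom1 (evT a)"
  unfolding evT_def by (rule ev_hom[OF fps_const_hom fps_mult_fps_X_power_commute])

lemma nth_evQ: "fps_nth (evQ b u f) k = fps_const (scalar (fps_nth f k * u ^ k)) * fps_X ^ (b * k)"
  by (simp add: evQ_def nth_ev const_X_power scalar.mult flip: mult.assoc)

lemma nth_evT: "fps_nth (evT a f) k = fps_const (fps_nth f k) * fps_X ^ (a * k)"
  by (simp add: evT_def nth_ev power_mult)

lemma evQ_const: "evQ b u (fps_const c) = fps_const (fps_const (scalar c))"
  by (rule fps_ext) (simp add: nth_evQ scalar.zero)

lemma evQ_commute: "evQ b u f * y = y * evQ b u f"
  by (rule fps_central) (simp only: nth_evQ central_const_X)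

lemma nth_monomial_mult:
  "fps_nth (fps_const A * fps_X ^ i * (fps_const B * fps_X ^ j * s)) N =
    A * (B * (if i + j \<le> N then fps_nth s (N - (i + j)) else 0))"
  "fps_nth (s * (fps_const B * fps_X ^ j) * (fps_const A * fps_X ^ i)) N =
    (if i + j \<le> N then fps_nth s (N - (i + j)) else 0) * B * A"
proof -
  have "fps_const A * fps_X ^ i * (fps_const B * fps_X ^ j * s) = fps_const A * (fps_X ^ i * fps_const B)
      * fps_X ^ j * s"
    by (simp only: mult.assoc)
  also have "\<dots> = fps_const A * (fps_const B * (fps_X ^ (i + j) * s))"
    unfolding fps_mult_fps_X_power_commute[of i "fps_const B"] by (simp only: mult.assoc power_add)
  finally show "fps_nth (fps_const A * fps_X ^ i * (fps_const B * fps_X ^ j * s)) N =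
    A * (B * (if i + j \<le> N then fps_nth s (N - (i + j)) else 0))"
    by (simp add: fps_X_power_mult_nth)
  have "s * (fps_const B * fps_X ^ j) * (fps_const A * fps_X ^ i) = s * fps_const B * (fps_X ^ j *
      fps_const A) * fps_X ^ i"
    by (simp only: mult.assoc)
  also have "\<dots> = s * fps_const B * fps_const A * fps_X ^ (j + i)"
    unfolding fps_mult_fps_X_power_commute[of j "fps_const A"] by (simp only: mult.assoc power_add)
  finally show "fps_nth (s * (fps_const B * fps_X ^ j) * (fps_const A * fps_X ^ i)) N =
    (if i + j \<le> N then fps_nth s (N - (i + j)) else 0) * B * A"
    by (simp add: fps_X_power_mult_right_nth add.commute del: fps_const_mult)
qed

text \<open>Both x and x / y are proportional to the outer variable w, so scaling them by \<theta>
  multiplies the coefficient of w^m by the central scalar \<theta>^m. Relations at shifted arguments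
  thus follow from the unshifted ones.\<close>

lemma nth_exchange_left:
  "fps_nth (fps_nth (evQ b u (subst_scale \<theta> f) * (evT a (subst_scale (scalar \<theta>) g) * fps_const s)) m) N =
    scalar (\<theta> ^ m) * (\<Sum>k\<le>m. scalar (fps_nth (subst_scale u f) k) * (fps_nth g (m - k) *
      (if b * k + a * (m - k) \<le> N then fps_nth s (N - (b * k + a * (m - k))) else 0)))"
proof -
  have "fps_nth (fps_nth (evQ b u (subst_scale \<theta> f) * (evT a (subst_scale (scalar \<theta>) g) * fps_const s)) m) N =
    (\<Sum>k\<le>m. scalar (fps_nth f k * \<theta> ^ k * u ^ k) * (fps_nth g (m - k) * scalar \<theta> ^ (m - k) *
      (if b * k + a * (m - k) \<le> N then fps_nth s (N - (b * k + a * (m - k))) else 0)))"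
    by (simp add: fps_mult_nth[of "evQ _ _ _"] fps_sum_nth nth_evQ nth_evT nth_subst_scale
        nth_monomial_mult atLeast0AtMost del: fps_const_mult)
  also have "\<dots> = (\<Sum>k\<le>m. scalar (\<theta> ^ m) * (scalar (fps_nth (subst_scale u f) k) * (fps_nth g (m - k) *
      (if b * k + a * (m - k) \<le> N then fps_nth s (N - (b * k + a * (m - k))) else 0))))"
  proof (rule sum.cong[OF refl])
    fix k assume "k \<in> {..m}"
    then have t: "\<theta> ^ m = \<theta> ^ k * \<theta> ^ (m - k)" by (simp flip: power_add)
    have "scalar (fps_nth f k * \<theta> ^ k * u ^ k) * (x * scalar \<theta> ^ (m - k) * y) =
      scalar (\<theta> ^ m) * (scalar (fps_nth (subst_scale u f) k) * (x * y))" for x y :: "'a falg"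
    proof -
      have "scalar (fps_nth f k * \<theta> ^ k * u ^ k) * (x * scalar \<theta> ^ (m - k) * y) =
        scalar (fps_nth f k * \<theta> ^ k * u ^ k) * (scalar (\<theta> ^ (m - k)) * x) * y"
        unfolding scalar_commute[of _ x] by (simp only: mult.assoc scalar.power)
      also have "\<dots> = scalar (fps_nth f k * \<theta> ^ k * u ^ k * \<theta> ^ (m - k)) * (x * y)"
        by (simp only: mult.assoc scalar.mult)
      also have "fps_nth f k * \<theta> ^ k * u ^ k * \<theta> ^ (m - k) = \<theta> ^ m * fps_nth (subst_scale u f) k"
        unfolding t nth_subst_scale by (simp only: mult_ac)
      finally show ?thesis by (simp only: scalar.mult mult.assoc)
    qed
    then show "scalar (fps_nth f k * \<theta> ^ k * u ^ k) * (fps_nth g (m - k) * scalar \<theta> ^ (m - k) *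
      (if b * k + a * (m - k) \<le> N then fps_nth s (N - (b * k + a * (m - k))) else 0)) =
      scalar (\<theta> ^ m) * (scalar (fps_nth (subst_scale u f) k) * (fps_nth g (m - k) *
      (if b * k + a * (m - k) \<le> N then fps_nth s (N - (b * k + a * (m - k))) else 0)))" .
  qed
  finally show ?thesis by (simp only: sum_distrib_left)
qed

lemma nth_exchange_right:
  "fps_nth (fps_nth (fps_const s * evT a (subst_scale (scalar \<theta>) g) * evQ b u (subst_scale \<theta> f)) m) N =
    scalar (\<theta> ^ m) * (\<Sum>k\<le>m. (if b * k + a * (m - k) \<le> N then fps_nth s (N - (b * k + a * (m - k))) else 0) *
      fps_nth g (m - k) * scalar (fps_nth (subst_scale u f) k))"
proof -
  have "fps_nth (fps_nth (fps_const s * evT a (subst_scale (scalar \<theta>) g) * evQ b u (subst_scale \<theta> f)) m) N =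
    (\<Sum>i\<le>m. (if b * (m - i) + a * i \<le> N then fps_nth s (N - (b * (m - i) + a * i)) else 0) *
      (fps_nth g i * scalar \<theta> ^ i) * scalar (fps_nth f (m - i) * \<theta> ^ (m - i) * u ^ (m - i)))"
    by (simp add: fps_mult_nth[of _ "evQ _ _ _"] fps_sum_nth nth_evQ nth_evT nth_subst_scale
        nth_monomial_mult atLeast0AtMost del: fps_const_mult)
  also have "\<dots> = (\<Sum>k\<le>m. (if b * k + a * (m - k) \<le> N then fps_nth s (N - (b * k + a * (m - k))) else 0) *
      (fps_nth g (m - k) * scalar \<theta> ^ (m - k)) * scalar (fps_nth f k * \<theta> ^ k * u ^ k))"
    by (rule sum.reindex_bij_witness[of _ "\<lambda>i. m - i" "\<lambda>i. m - i"]) auto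
  also have "\<dots> = (\<Sum>k\<le>m. scalar (\<theta> ^ m) * ((if b * k + a * (m - k) \<le> N then fps_nth s (N - (b * k + a * (m
      - k))) else 0) *
      fps_nth g (m - k) * scalar (fps_nth (subst_scale u f) k)))"
  proof (rule sum.cong[OF refl])
    fix k assume "k \<in> {..m}"
    then have t: "\<theta> ^ m = \<theta> ^ (m - k) * \<theta> ^ k" by (simp flip: power_add)
    have "y * (x * scalar \<theta> ^ (m - k)) * scalar (fps_nth f k * \<theta> ^ k * u ^ k) =
      scalar (\<theta> ^ m) * (y * x * scalar (fps_nth (subst_scale u f) k))" for x y :: "'a falg"
    proof -
      have "y * (x * scalar \<theta> ^ (m - k)) * scalar (fps_nth f k * \<theta> ^ k * u ^ k) =
        y * x * scalar (\<theta> ^ (m - k) * (fps_nth f k * \<theta> ^ k * u ^ k))"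
        by (simp only: mult.assoc scalar.mult scalar.power)
      also have "\<theta> ^ (m - k) * (fps_nth f k * \<theta> ^ k * u ^ k) = fps_nth (subst_scale u f) k * \<theta> ^ m"
        unfolding t nth_subst_scale by (simp only: mult_ac)
      finally show ?thesis by (simp only: scalar.mult mult.assoc scalar_commute[of "\<theta> ^ m"])
    qed
    then show "(if b * k + a * (m - k) \<le> N then fps_nth s (N - (b * k + a * (m - k))) else 0) *
      (fps_nth g (m - k) * scalar \<theta> ^ (m - k)) * scalar (fps_nth f k * \<theta> ^ k * u ^ k) =
      scalar (\<theta> ^ m) * ((if b * k + a * (m - k) \<le> N then fps_nth s (N - (b * k + a * (m - k))) else 0) *
      fps_nth g (m - k) * scalar (fps_nth (subst_scale u f) k))" .
  qed
  finally show ?thesis by (simp only: sum_distrib_left)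
qed

definition series_mat :: "(nat \<Rightarrow> ('n::finite, 'n falg) mat1) \<Rightarrow> ('n, 'n falg fps fps) mat1" where
  "series_mat V = (\<chi> i j. fps_const (Abs_fps (\<lambda>n. V n $ i $ j)))"

definition T_shift :: "complex fps \<Rightarrow> ('n::finite, 'n falg fps) mat1" where
  "T_shift \<theta> = (\<chi> i j. subst_scale (scalar \<theta>) (T_plus $ i $ j))"

lemma T_plus_coeff_diff: "k \<le> m \<Longrightarrow> T_plus_coeff (int m - int k) $ i $ j = fps_nth (T_plus $ i $ j) (m - k)"
  by (simp add: T_plus_coeff_def nat_diff_distrib)

text \<open>\<open>\<nu> m N\<close> is the exponent n of y for which x^m y^n becomes w^m t^N: it is
  N - m for S = T^+, where x = t w and y = t, and - N for S = T^-, where x = w and y = 1 /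
  t.\<close>

lemma exchange_series:
  fixes Q :: "('n::finite, complex fps fps) mat2" and V :: "int \<Rightarrow> ('n, 'n falg) mat1"
  assumes "two_sided_ideal J" and rel: "exchange_rel J Q u u' V"
    and V: "\<And>m k N. k \<le> m \<Longrightarrow> V (\<nu> m N + int k) =
      (if b * k + a * (m - k) \<le> N then V' (N - (b * k + a * (m - k))) else 0)"
  shows "((\<chi> p q. evQ b u (subst_scale \<theta> (Q $ p $ q))) ** kron (\<chi> i j. evT a (T_shift \<theta> $ i $ j))
      (series_mat V')) $ p $ q -
    (kron (series_mat V') (\<chi> i j. evT a (T_shift \<theta> $ i $ j)) ** (\<chi> p q. evQ b u' (subst_scale \<theta> (Q $ p $
        q)))) $ p $ q
    \<in> coeff_ideal (coeff_ideal J)" (is "?x - ?y \<in> _")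
proof -
  interpret two_sided_ideal J by fact
  have "fps_nth (fps_nth (?x - ?y) m) N \<in> J" for m N
  proof -
    let ?c = "\<lambda>k. if b * k + a * (m - k) \<le> N then V' (N - (b * k + a * (m - k))) else 0"
    have "fps_nth (fps_nth ?x m) N = scalar (\<theta> ^ m) * (\<Sum>e\<in>UNIV. \<Sum>k\<le>m. scalar (fps_nth (subst_scale u (Q $
        p $ e)) k) *
        (fps_nth (T_plus $ fst e $ fst q) (m - k) * ?c k $ snd e $ snd q))"
      by (simp add: mat_mult_entry kron_def series_mat_def T_shift_def fps_sum_nth nth_exchange_left
          sum_distrib_left[symmetric] if_distrib[of "\<lambda>v. v $ _ $ _"] cong: if_cong)
    also have "(\<Sum>e\<in>UNIV. \<Sum>k\<le>m. scalar (fps_nth (subst_scale u (Q $ p $ e)) k) *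
        (fps_nth (T_plus $ fst e $ fst q) (m - k) * ?c k $ snd e $ snd q)) =
      (\<Sum>k\<le>m. (mat2_coeff Q u k ** kron (T_plus_coeff (int m - int k)) (V (\<nu> m N + int k))) $ p $ q)"
      by (subst sum.swap) (simp add: mat_mult_entry mat2_coeff_def kron_def V T_plus_coeff_diff)
    finally have x: "fps_nth (fps_nth ?x m) N = scalar (\<theta> ^ m) * \<dots>" .
    have "fps_nth (fps_nth ?y m) N = scalar (\<theta> ^ m) * (\<Sum>e\<in>UNIV. \<Sum>k\<le>m. ?c k $ fst p $ fst e *
        fps_nth (T_plus $ snd p $ snd e) (m - k) * scalar (fps_nth (subst_scale u' (Q $ e $ q)) k))"
      by (simp add: mat_mult_entry kron_def series_mat_def T_shift_def fps_sum_nth nth_exchange_right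
          sum_distrib_left[symmetric] if_distrib[of "\<lambda>v. v $ _ $ _"] cong: if_cong)
    also have "(\<Sum>e\<in>UNIV. \<Sum>k\<le>m. ?c k $ fst p $ fst e *
        fps_nth (T_plus $ snd p $ snd e) (m - k) * scalar (fps_nth (subst_scale u' (Q $ e $ q)) k)) =
      (\<Sum>k\<le>m. (kron (V (\<nu> m N + int k)) (T_plus_coeff (int m - int k)) ** mat2_coeff Q u' k) $ p $ q)"
      by (subst sum.swap) (simp add: mat_mult_entry mat2_coeff_def kron_def V T_plus_coeff_diff)
    finally have y: "fps_nth (fps_nth ?y m) N = scalar (\<theta> ^ m) * \<dots>" .
    show ?thesis
      using rel unfolding fps_sub_nth x y right_diff_distrib[symmetric] exchange_rel_def
      by (blast intro: mult_left_mem)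
  qed
  then show ?thesis by (simp add: coeff_ideal_def)
qed

section \<open>Specialising the relation for T^+ to proportional arguments\<close>

lemma subst_scale_1: "subst_scale 1 f = (f :: 'a::ring_1 fps)"
  by (rule fps_ext) (simp add: nth_subst_scale)

text \<open>The factor d = 0 of the product in \<open>kappa_prod\<close> is kappa itself.\<close>

lemma kappa_unit:
  assumes "M > 0"
  shows "\<exists>w. w * kappa M = 1"
proof -
  obtain n where M: "M = Suc n" using assms by (cases M) auto
  have k: "(\<Prod>d<M. subst_scale (fps_exp (- 1) ^ (2 * d)) (kappa M)) =
    kappa M * (\<Prod>d<n. subst_scale (fps_exp (- 1) ^ (2 * Suc d)) (kappa M))"
    unfolding M prod.lessThan_Suc_shift by (simp add: subst_scale_1)
  obtain P where "kappa M * (\<Prod>d<n. subst_scale (fps_exp (- 1) ^ (2 * Suc d)) (kappa M)) * P = 1"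
    using kappa_prod[of n, folded M, unfolded k] by blast
  then have "((\<Prod>d<n. subst_scale (fps_exp (- 1) ^ (2 * Suc d)) (kappa M)) * P) * kappa M = 1"
    by (simp only: mult_ac)
  then show ?thesis by blast
qed

lemma fps_nth_linear: "fps_nth (fps_const (r :: 'a::ring_1) + fps_const r' * fps_X) k = (if k = 0 then r
    else if k = 1 then r' else 0)"
  by (auto simp: fps_mult_right_const_nth)

lemma sum_two_terms:
  fixes g :: "nat \<Rightarrow> 'a::comm_monoid_add"
  assumes "\<And>k. k > 1 \<Longrightarrow> g k = 0"
  shows "(\<Sum>k\<le>m. g k) = g 0 + (if m > 0 then g 1 else 0)"
proof (cases m)
  case (Suc m')
  have "(\<Sum>k\<le>m. g k) = (\<Sum>k\<in>{0, 1}. g k)"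
    by (rule sum.mono_neutral_right) (use Suc assms in auto)
  then show ?thesis using Suc by simp
qed simp

text \<open>
  Substituting \<open>x \<mapsto> \<alpha> x\<close>, \<open>y \<mapsto> \<beta> x\<close> in a relation between series in \<open>x\<close> and \<open>y\<close> whose R-matrix is linear in \<open>x / y\<close>.
\<close>

lemma (in two_sided_ideal) homogenize:
  fixes s :: "'c::comm_ring_1 \<Rightarrow> 'b"
  assumes s: "ring_hom1 s"
    and rel: "\<And>m. m \<le> Suc N \<Longrightarrow> (if m \<le> N then x m else 0) + (if m > 0 then y (m - 1) else 0) \<in> J"
  shows "(\<Sum>j\<le>N. s (\<alpha> ^ j * \<beta> ^ (N - j)) * (s \<beta> * x j + s \<alpha> * y j)) \<in> J"
proof -
  interpret s: ring_hom1 s by fact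
  let ?c = "\<lambda>m. s (\<alpha> ^ m * \<beta> ^ (Suc N - m))"
  have "(\<Sum>m\<le>Suc N. ?c m * ((if m \<le> N then x m else 0) + (if m > 0 then y (m - 1) else 0))) \<in> J"
    by (intro sum_mem mult_left_mem rel) simp
  also have "(\<Sum>m\<le>Suc N. ?c m * ((if m \<le> N then x m else 0) + (if m > 0 then y (m - 1) else 0))) =
    (\<Sum>m\<le>Suc N. ?c m * (if m \<le> N then x m else 0)) + (\<Sum>m\<le>Suc N. ?c m * (if m > 0 then y (m - 1) else 0))"
    by (simp only: distrib_left sum.distrib)
  also have "(\<Sum>m\<le>Suc N. ?c m * (if m \<le> N then x m else 0)) = (\<Sum>m\<le>N. ?c m * x m)"
    by (simp add: sum.atMost_Suc)
  also have "(\<Sum>m\<le>Suc N. ?c m * (if m > 0 then y (m - 1) else 0)) = (\<Sum>m\<le>N. ?c (Suc m) * y m)"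
    by (simp add: sum.atMost_Suc_shift del: sum.atMost_Suc)
  also have "(\<Sum>m\<le>N. ?c m * x m) + (\<Sum>m\<le>N. ?c (Suc m) * y m) =
    (\<Sum>j\<le>N. s (\<alpha> ^ j * \<beta> ^ (N - j)) * (s \<beta> * x j + s \<alpha> * y j))"
    unfolding sum.distrib[symmetric]
  proof (rule sum.cong[OF refl])
    fix j assume "j \<in> {..N}"
    then have "\<alpha> ^ j * \<beta> ^ (Suc N - j) = \<alpha> ^ j * \<beta> ^ (N - j) * \<beta>"
      "\<alpha> ^ Suc j * \<beta> ^ (Suc N - Suc j) = \<alpha> ^ j * \<beta> ^ (N - j) * \<alpha>"
      by (simp_all add: Suc_diff_le mult_ac)
    then show "?c j * x j + ?c (Suc j) * y j = s (\<alpha> ^ j * \<beta> ^ (N - j)) * (s \<beta> * x j + s \<alpha> * y j)"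
      by (simp only: s.mult distrib_left mult.assoc)
  qed
  finally show ?thesis .
qed

text \<open>Multiplying by the inverse of kappa leaves the relation for the linear polynomial R + z
  r', where z = x / y and r' = (q - p) I - R. Each coefficient then has two terms only, and x and y
  may be replaced by \<alpha> x and \<beta> x; \<open>W\<close> is \<beta> times the polynomial at z
  = \<alpha> / \<beta>.\<close>

lemma rtt_special:
  fixes R :: "('n::finite, complex fps) mat2" and \<alpha> \<beta> :: "complex fps"
  assumes J: "two_sided_ideal J" and D: "D_relations R M a c \<subseteq> J" and M: "M > 0"
  defines "r' \<equiv> \<lambda>p q. (fps_exp 1 - fps_exp (- 1)) * mat 1 $ p $ q - R $ p $ q"
  defines "W \<equiv> \<chi> p q. fps_const (scalar (\<beta> * R $ p $ q + \<alpha> * r' p q)) :: ('n, 'n falg fps) mat2"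
  shows "(W ** kron (T_shift \<alpha>) (T_shift \<beta>)) $ p $ q - (kron (T_shift \<beta>) (T_shift \<alpha>) ** W) $ p $ q \<in>
      coeff_ideal J"
proof -
  interpret two_sided_ideal J by fact
  interpret J1: two_sided_ideal "coeff_ideal J" by (rule coeff_ideal) fact
  interpret J2: two_sided_ideal "coeff_ideal (coeff_ideal J)" by (rule coeff_ideal, rule coeff_ideal) fact
  interpret E: ring_hom1 "evQ 0 1 :: complex fps fps \<Rightarrow> 'n falg fps fps" by (rule evQ_hom)
  define q0 where "q0 = (\<lambda>p q. fps_const (R $ p $ q) + fps_const (r' p q) * fps_X)"
  obtain w where w: "w * kappa M = 1" using kappa_unit[OF M] by blast
  have q0: "w * Q_mat R M $ p $ q = q0 p q" for p q
  proof -
    have m: "mat 1 $ p $ q = fps_const (mat 1 $ p $ q :: complex fps)" by (simp add: mat_def)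
    have "w * Q_mat R M $ p $ q = (w * kappa M) * ((1 - fps_X) * fps_const (R $ p $ q) +
       fps_const (fps_exp 1 - fps_exp (- 1)) * fps_X * mat 1 $ p $ q)"
      unfolding Q_mat_eq by (simp only: mult.assoc)
    also have "\<dots> = q0 p q"
      unfolding w q0_def r'_def m by (simp add: algebra_simps flip: fps_const_mult fps_const_sub)
    finally show ?thesis .
  qed
  let ?T = "(\<chi> i j. evT 1 (T_shift 1 $ i $ j)) :: ('n, 'n falg fps fps) mat1" and ?S = "series_mat (\<lambda>n.
      T_plus_coeff (int n)) :: ('n, 'n falg fps fps) mat1"
  let ?Q = "(\<chi> p q. evQ 0 1 (subst_scale 1 (Q_mat R M $ p $ q))) :: ('n, 'n falg fps fps) mat2"
  have Z: "(?Q ** kron ?T ?S) $ p $ q - (kron ?S ?T ** ?Q) $ p $ q \<in> coeff_ideal (coeff_ideal J)"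
    by (rule exchange_series[OF J exchange_plus[OF D], where \<nu> = "\<lambda>m N. int N - int m"])
      (auto simp: T_plus_coeff_neg of_nat_diff algebra_simps)
  have "evQ 0 1 w * ((?Q ** kron ?T ?S) $ p $ q - (kron ?S ?T ** ?Q) $ p $ q) =
    (\<Sum>e\<in>UNIV. evQ 0 1 (q0 p e) * kron ?T ?S $ e $ q) - (\<Sum>e\<in>UNIV. kron ?S ?T $ p $ e * evQ 0 1 (q0 e q))"
  proof -
    have "evQ 0 1 w * (?Q ** kron ?T ?S) $ p $ q = (\<Sum>e\<in>UNIV. evQ 0 1 (q0 p e) * kron ?T ?S $ e $ q)"
      by (simp add: mat_mult_entry sum_distrib_left E.mult subst_scale_1 flip: q0 mult.assoc)
    moreover have "evQ 0 1 w * (x * evQ 0 1 (Q_mat R M $ e $ q)) = x * evQ 0 1 (q0 e q)" for x :: "'n falg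
        fps fps" and e
    proof -
      have "evQ 0 1 w * (x * evQ 0 1 (Q_mat R M $ e $ q)) = (evQ 0 1 w * x) * evQ 0 1 (Q_mat R M $ e $ q)"
        by (simp only: mult.assoc)
      also have "\<dots> = x * evQ 0 1 (q0 e q)"
        unfolding evQ_commute[of 0 1 w x] q0[symmetric] E.mult by (simp only: mult.assoc)
      finally show ?thesis .
    qed
    then have "evQ 0 1 w * (kron ?S ?T ** ?Q) $ p $ q = (\<Sum>e\<in>UNIV. kron ?S ?T $ p $ e * evQ 0 1 (q0 e q))"
      by (simp add: mat_mult_entry sum_distrib_left subst_scale_1)
    ultimately show ?thesis by (simp only: right_diff_distrib)
  qed
  then have Z0: "(\<Sum>e\<in>UNIV. evQ 0 1 (q0 p e) * kron ?T ?S $ e $ q) - (\<Sum>e\<in>UNIV. kron ?S ?T $ p $ e * evQ 0 1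
      (q0 e q))
    \<in> coeff_ideal (coeff_ideal J)" (is "?z \<in> _")
    using J2.mult_left_mem[OF Z, of "evQ 0 1 w"] by simp
  have "fps_nth ((W ** kron (T_shift \<alpha>) (T_shift \<beta>)) $ p $ q - (kron (T_shift \<beta>) (T_shift \<alpha>) ** W) $ p $
      q) N \<in> J" for N
  proof -
    let ?t = "\<lambda>j i k. fps_nth (T_plus $ i $ k :: 'n falg fps) j"
    \<comment> \<open>The (p, q) entry of the coefficient of x^j y^(N-j) in r T_1(x) T_2(y) - T_1(y)
      T_2(x) r, for a scalar matrix function r.\<close>
    define X where "X = (\<lambda>r j. (\<Sum>e\<in>UNIV. scalar (r p e) * (?t j (fst e) (fst q) * ?t (N - j) (snd e) (snd
        q))) -
      (\<Sum>e\<in>UNIV. ?t (N - j) (fst p) (fst e) * ?t j (snd p) (snd e) * scalar (r e q)))"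
    let ?R = "\<lambda>p q. R $ p $ q"
    have rel: "(if m \<le> N then X ?R m else 0) + (if m > 0 then X r' (m - 1) else 0) \<in> J" if "m \<le> Suc N" for m
    proof -
      let ?sN = "\<lambda>k i j. if m - k \<le> N then ?t (N - (m - k)) i j else 0"
      have tc: "T_plus_coeff (int n) $ i $ j = ?t n i j" for n i j
        by (simp add: T_plus_coeff_def)
      have l: "fps_nth (fps_nth (evQ 0 1 (q0 p e) * kron ?T ?S $ e $ q) m) N =
        (\<Sum>k\<le>m. scalar (fps_nth (q0 p e) k) * (?t (m - k) (fst e) (fst q) * ?sN k (snd e) (snd q)))" for e
        using nth_exchange_left[of 0 1 1 "q0 p e" 1 "T_plus $ fst e $ fst q" "Abs_fps (\<lambda>n. T_plus_coeff
            (int n) $ snd e $ snd q)" m N]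
        by (simp add: kron_def series_mat_def T_shift_def subst_scale_1 scalar.one tc cong: if_cong)
      have r: "fps_nth (fps_nth (kron ?S ?T $ p $ e * evQ 0 1 (q0 e q)) m) N =
        (\<Sum>k\<le>m. ?sN k (fst p) (fst e) * ?t (m - k) (snd p) (snd e) * scalar (fps_nth (q0 e q) k))" for e
        using nth_exchange_right[of "Abs_fps (\<lambda>n. T_plus_coeff (int n) $ fst p $ fst e)" 1 1 "T_plus $ snd
            p $ snd e" 0 1 "q0 e q" m N]
        by (simp add: kron_def series_mat_def T_shift_def subst_scale_1 scalar.one tc cong: if_cong)
      have 0: "k > 1 \<Longrightarrow> fps_nth (q0 p e) k = 0" and 1: "fps_nth (q0 p e) 0 = R $ p $ e" "fps_nth (q0 p e) 1
          = r' p e" for k p e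
        by (simp_all add: q0_def fps_nth_linear del: One_nat_def)
      have l': "fps_nth (fps_nth (evQ 0 1 (q0 p e) * kron ?T ?S $ e $ q) m) N =
        (if m \<le> N then scalar (R $ p $ e) * (?t m (fst e) (fst q) * ?t (N - m) (snd e) (snd q)) else 0) +
        (if m > 0 then scalar (r' p e) * (?t (m - 1) (fst e) (fst q) * ?t (N - (m - 1)) (snd e) (snd q))
            else 0)" for e
        unfolding l by (subst sum_two_terms) (use that in \<open>auto simp: 0 1 scalar.zero simp del: One_nat_def\<close>)
      have r': "fps_nth (fps_nth (kron ?S ?T $ p $ e * evQ 0 1 (q0 e q)) m) N =
        (if m \<le> N then ?t (N - m) (fst p) (fst e) * ?t m (snd p) (snd e) * scalar (R $ e $ q) else 0) +
        (if m > 0 then ?t (N - (m - 1)) (fst p) (fst e) * ?t (m - 1) (snd p) (snd e) * scalar (r' e q)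
            else 0)" for e
        unfolding r by (subst sum_two_terms) (use that in \<open>auto simp: 0 1 scalar.zero simp del: One_nat_def\<close>)
      have "fps_nth (fps_nth ?z m) N = (if m \<le> N then X ?R m else 0) + (if m > 0 then X r' (m - 1) else 0)"
        unfolding X_def fps_sub_nth fps_sum_nth l' r' by (simp add: sum.distrib)
      moreover have "fps_nth (fps_nth ?z m) N \<in> J" using Z0 by (simp add: coeff_ideal_def)
      ultimately show ?thesis by simp
    qed
    have term1: "scalar (\<beta> * x + \<alpha> * y) * (A * scalar \<alpha> ^ j * (B * scalar \<beta> ^ (N - j))) =
      scalar (\<alpha> ^ j * \<beta> ^ (N - j)) * (scalar \<beta> * (scalar x * (A * B)) + scalar \<alpha> * (scalar y * (A * B)))"
      for x y A j and B :: "'n falg"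
    proof -
      have "A * scalar \<alpha> ^ j * (B * scalar \<beta> ^ (N - j)) = scalar (\<alpha> ^ j) * A * (scalar (\<beta> ^ (N - j)) * B)"
        by (simp only: scalar.power[symmetric] scalar_commute)
      also have "\<dots> = scalar (\<alpha> ^ j) * (A * scalar (\<beta> ^ (N - j))) * B" by (simp only: mult.assoc)
      also have "\<dots> = scalar (\<alpha> ^ j * \<beta> ^ (N - j)) * (A * B)"
        unfolding scalar_commute[of "\<beta> ^ (N - j)" A, symmetric] by (simp only: mult.assoc scalar.mult)
      finally have "scalar (\<beta> * x + \<alpha> * y) * (A * scalar \<alpha> ^ j * (B * scalar \<beta> ^ (N - j))) =
        scalar ((\<beta> * x + \<alpha> * y) * (\<alpha> ^ j * \<beta> ^ (N - j))) * (A * B)"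
        by (simp only: scalar.mult mult.assoc)
      also have "(\<beta> * x + \<alpha> * y) * (\<alpha> ^ j * \<beta> ^ (N - j)) = (\<alpha> ^ j * \<beta> ^ (N - j)) * (\<beta> * x + \<alpha> * y)"
        by (rule mult.commute)
      finally show ?thesis by (simp only: scalar.mult scalar.add distrib_left distrib_right mult.assoc)
    qed
    have term2: "B * scalar \<beta> ^ (N - j) * (A * scalar \<alpha> ^ j) * scalar (\<beta> * x + \<alpha> * y) =
      scalar (\<alpha> ^ j * \<beta> ^ (N - j)) * (scalar \<beta> * (B * A * scalar x) + scalar \<alpha> * (B * A * scalar y))"
      for x y A j and B :: "'n falg"
    proof -
      have "B * scalar \<beta> ^ (N - j) * (A * scalar \<alpha> ^ j) * scalar (\<beta> * x + \<alpha> * y) =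
        B * (scalar (\<beta> ^ (N - j)) * A) * (scalar (\<alpha> ^ j) * scalar (\<beta> * x + \<alpha> * y))"
        by (simp only: scalar.power[symmetric] mult.assoc)
      also have "\<dots> = B * A * scalar (\<beta> ^ (N - j) * (\<alpha> ^ j * (\<beta> * x + \<alpha> * y)))"
        unfolding scalar_commute[of "\<beta> ^ (N - j)" A] by (simp only: mult.assoc scalar.mult)
      also have "\<beta> ^ (N - j) * (\<alpha> ^ j * (\<beta> * x + \<alpha> * y)) = (\<alpha> ^ j * \<beta> ^ (N - j)) * (\<beta> * x) + (\<alpha> ^ j * \<beta> ^
          (N - j)) * (\<alpha> * y)"
        by (simp only: distrib_left mult_ac)
      also have "B * A * scalar \<dots> = scalar (\<alpha> ^ j * \<beta> ^ (N - j) * \<beta>) * (B * A * scalar x) + scalar (\<alpha> ^ j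
          * \<beta> ^ (N - j) * \<alpha>) * (B * A * scalar y)"
        unfolding scalar_commute[of "_ * _" "B * A * _"]
        by (simp only: scalar.add distrib_left mult.assoc scalar.mult[symmetric]) (simp only: mult_ac)
      finally show ?thesis by (simp only: scalar.mult distrib_left mult.assoc)
    qed
    have "fps_nth ((W ** kron (T_shift \<alpha>) (T_shift \<beta>)) $ p $ q) N =
      (\<Sum>e\<in>UNIV. \<Sum>j\<le>N. scalar (\<alpha> ^ j * \<beta> ^ (N - j)) * (scalar \<beta> * (scalar (R $ p $ e) * (?t j (fst e) (fst
          q) * ?t (N - j) (snd e) (snd q))) +
        scalar \<alpha> * (scalar (r' p e) * (?t j (fst e) (fst q) * ?t (N - j) (snd e) (snd q)))))"
      by (simp add: mat_mult_entry W_def kron_def T_shift_def fps_sum_nth fps_mult_nth[of "subst_scale _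
          _"] nth_subst_scale sum_distrib_left term1 atLeast0AtMost)
    also have "\<dots> = (\<Sum>j\<le>N. scalar (\<alpha> ^ j * \<beta> ^ (N - j)) * (scalar \<beta> * (\<Sum>e\<in>UNIV. scalar (R $ p $ e) * (?t j
        (fst e) (fst q) * ?t (N - j) (snd e) (snd q))) +
        scalar \<alpha> * (\<Sum>e\<in>UNIV. scalar (r' p e) * (?t j (fst e) (fst q) * ?t (N - j) (snd e) (snd q)))))"
      by (subst sum.swap) (simp only: sum_distrib_left distrib_left sum.distrib)
    finally have 1: "fps_nth ((W ** kron (T_shift \<alpha>) (T_shift \<beta>)) $ p $ q) N = \<dots>" .
    have "fps_nth ((kron (T_shift \<beta>) (T_shift \<alpha>) ** W) $ p $ q) N =
      (\<Sum>e\<in>UNIV. \<Sum>j\<le>N. scalar (\<alpha> ^ j * \<beta> ^ (N - j)) * (scalar \<beta> * (?t (N - j) (fst p) (fst e) * ?t j (snd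
          p) (snd e) * scalar (R $ e $ q)) +
        scalar \<alpha> * (?t (N - j) (fst p) (fst e) * ?t j (snd p) (snd e) * scalar (r' e q))))"
    proof -
      have "fps_nth (subst_scale (scalar \<beta>) f * subst_scale (scalar \<alpha>) g * fps_const (scalar z)) N =
        (\<Sum>j\<le>N. fps_nth f (N - j) * scalar \<beta> ^ (N - j) * (fps_nth g j * scalar \<alpha> ^ j) * scalar z)" for f g
            :: "'n falg fps" and z
      proof -
        have "fps_nth (subst_scale (scalar \<beta>) f * subst_scale (scalar \<alpha>) g * fps_const (scalar z)) N =
          (\<Sum>j\<le>N. fps_nth f j * scalar \<beta> ^ j * (fps_nth g (N - j) * scalar \<alpha> ^ (N - j)) * scalar z)"
          by (simp add: fps_mult_nth[of "subst_scale _ _"] nth_subst_scale sum_distrib_right atLeast0AtMost)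
        also have "\<dots> = (\<Sum>j\<le>N. fps_nth f (N - j) * scalar \<beta> ^ (N - j) * (fps_nth g j * scalar \<alpha> ^ j) *
            scalar z)"
          by (rule sum.reindex_bij_witness[of _ "\<lambda>i. N - i" "\<lambda>i. N - i"]) auto
        finally show ?thesis .
      qed
      then show ?thesis
        by (simp add: mat_mult_entry W_def kron_def T_shift_def fps_sum_nth term2)
    qed
    also have "\<dots> = (\<Sum>j\<le>N. scalar (\<alpha> ^ j * \<beta> ^ (N - j)) * (scalar \<beta> * (\<Sum>e\<in>UNIV. ?t (N - j) (fst p) (fst e)
        * ?t j (snd p) (snd e) * scalar (R $ e $ q)) +
        scalar \<alpha> * (\<Sum>e\<in>UNIV. ?t (N - j) (fst p) (fst e) * ?t j (snd p) (snd e) * scalar (r' e q))))"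
      by (subst sum.swap) (simp only: sum_distrib_left distrib_left sum.distrib)
    finally have 2: "fps_nth ((kron (T_shift \<beta>) (T_shift \<alpha>) ** W) $ p $ q) N = \<dots>" .
    have "fps_nth ((W ** kron (T_shift \<alpha>) (T_shift \<beta>)) $ p $ q - (kron (T_shift \<beta>) (T_shift \<alpha>) ** W) $ p $
        q) N =
      (\<Sum>j\<le>N. scalar (\<alpha> ^ j * \<beta> ^ (N - j)) * (scalar \<beta> * X ?R j + scalar \<alpha> * X r' j))"
      unfolding fps_sub_nth 1 2 X_def by (simp only: right_diff_distrib distrib_left sum_subtractf
          sum.distrib) (simp only: add_diff_add)
    then show ?thesis
      using homogenize[OF scalar_hom rel] by simp
  qed
  then show ?thesis by (simp add: coeff_ideal_def)
qed

section \<open>Reversal of arguments by the skew-symmetrizer\<close>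

abbreviation lop_ideal_of :: "'a set \<Rightarrow> ('n::finite, 'a::ring_1) lop set" where
  "lop_ideal_of I \<equiv> {A. \<forall>X Y. ent A X Y \<in> I}"

lemma exchange_leg:
  fixes A B :: "('n::finite, 'a::ring_1) mat2"
  assumes I: "two_sided_ideal I"
    and rel: "\<And>p q. (A ** kron T S) $ p $ q - (kron S' T' ** B) $ p $ q \<in> I"
    and i: "Suc i < K"
  shows "two_sided_ideal.cgr (lop_ideal_of I)
    (Lop K (leg2 K i (Suc i) A) * Lop K (leg1 K i T) * Lop K (leg1 K (Suc i) S))
    (Lop K (leg1 K i S') * Lop K (leg1 K (Suc i) T') * Lop K (leg2 K i (Suc i) B))"
proof -
  interpret two_sided_ideal I by fact
  interpret L: two_sided_ideal "lop_ideal_of I :: ('n, 'a) lop set" by (rule lop_ideal) fact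
  have "Lop K (leg2 K i (Suc i) A) * Lop K (leg1 K i T) * Lop K (leg1 K (Suc i) S) = Lop K (leg2 K i (Suc
      i) (A ** kron T S))"
    using i by (simp add: leg1_leg1 leg2_leg2 mult.assoc)
  moreover have "Lop K (leg1 K i S') * Lop K (leg1 K (Suc i) T') * Lop K (leg2 K i (Suc i) B) = Lop K
      (leg2 K i (Suc i) (kron S' T' ** B))"
    using i by (simp add: leg1_leg1 leg2_leg2)
  ultimately show ?thesis
    using rel by (auto simp: L.cgr_def ent_Lop leg2_def zero_mem)
qed

abbreviation sigma :: "complex fps \<Rightarrow> 'n falg fps" where
  "sigma c \<equiv> fps_const (scalar c)"

interpretation sigma: ring_hom1 "sigma :: complex fps \<Rightarrow> 'n falg fps"
  by (rule const_scalar_hom)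

abbreviation TL :: "nat \<Rightarrow> nat \<Rightarrow> nat \<Rightarrow> ('n::finite, 'n falg fps) lop" where
  "TL K i e \<equiv> Lop K (leg1 K i (T_shift (fps_exp (- 2 * of_nat e))))"

abbreviation QL :: "('n::finite, complex fps) mat2 \<Rightarrow> nat \<Rightarrow> nat \<Rightarrow> nat \<Rightarrow> ('n, 'n falg fps) lop" where
  "QL R K i k \<equiv> Lop K (leg2 K i (Suc i) (\<chi> p q. sigma ((R + mat (skew_coeff k)) $ p $ q)))"

abbreviation skewS :: "('n::finite, complex fps) mat2 \<Rightarrow> nat \<Rightarrow> ('n, 'n falg fps) lop" where
  "skewS R k \<equiv> lop_map sigma (skewL R k)"

text \<open>The two arguments have ratio q^(2k), where the linear polynomial of
  \<open>rtt_special\<close> is 1 - q^(2k) times R-hat at q^(2k). That factor vanishes at h = 0, so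
  cancelling it requires torsion-freeness.\<close>

lemma QL_exchange:
  fixes R :: "('n::finite, complex fps) mat2"
  assumes J: "torsion_free_ideal J" and D: "D_relations R M a c \<subseteq> J" and M: "M > 0"
    and k: "k > 0" and i: "Suc i < K"
  shows "two_sided_ideal.cgr (lop_ideal_of (coeff_ideal J))
    (QL R K i k * TL K i e * TL K (Suc i) (e + k)) (TL K i (e + k) * TL K (Suc i) e * QL R K i k)"
proof (rule exchange_leg[OF _ _ i])
  interpret torsion_free_ideal J by fact
  show I: "two_sided_ideal (coeff_ideal J)" by (rule coeff_ideal) unfold_locales
  interpret J1: two_sided_ideal "coeff_ideal J" by fact
  fix p q :: "'n \<times> 'n"
  let ?\<alpha> = "fps_exp (- 2 * of_nat e) :: complex fps" and ?\<beta> = "fps_exp (- 2 * of_nat (e + k)) :: complex fps"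
  let ?x = "fps_exp (2 * of_nat k) :: complex fps"
  let ?A = "(\<chi> p q. sigma ((R + mat (skew_coeff k)) $ p $ q)) :: ('n, 'n falg fps) mat2"
  have \<alpha>: "?\<alpha> = ?\<beta> * ?x" by (simp add: algebra_simps flip: fps_exp_add_mult)
  have W: "?\<beta> * R $ p $ q + ?\<alpha> * ((fps_exp 1 - fps_exp (- 1)) * mat 1 $ p $ q - R $ p $ q) =
      ?\<beta> * (1 - ?x) * ((R + mat (skew_coeff k)) $ p $ q)" for p q
  proof -
    have "?\<beta> * (1 - ?x) * ((R + mat (skew_coeff k)) $ p $ q) =
      ?\<beta> * (1 - ?x) * R $ p $ q + ?\<beta> * (skew_coeff k * (1 - ?x)) * mat 1 $ p $ q"
      by (simp add: mat_def algebra_simps)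
    also have "\<dots> = ?\<beta> * R $ p $ q + ?\<alpha> * ((fps_exp 1 - fps_exp (- 1)) * mat 1 $ p $ q - R $ p $ q)"
      unfolding skew_coeff_mult[OF k] \<alpha> by (simp only: algebra_simps mult_1_left mult_1_right)
    finally show ?thesis by simp
  qed
  let ?c = "?\<beta> * (1 - ?x)"
  have c: "?c \<noteq> 0" using one_minus_fps_exp_nonzero[OF k] by simp
  note rel = rtt_special[OF two_sided_ideal_axioms D M, of ?\<beta> ?\<alpha> p q, unfolded W]
  have "(\<chi> p q. sigma (?c * (R + mat (skew_coeff k)) $ p $ q)) ** kron (T_shift ?\<alpha>) (T_shift ?\<beta>) =
    (\<chi> p q. sigma ?c * (?A ** kron (T_shift ?\<alpha>) (T_shift ?\<beta>)) $ p $ q)"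
    unfolding vec_eq_iff by (simp only: mat_mult_entry vec_lambda_beta sigma.mult sum_distrib_left
        mult.assoc) simp
  moreover have "kron (T_shift ?\<beta>) (T_shift ?\<alpha>) ** (\<chi> p q. sigma (?c * (R + mat (skew_coeff k)) $ p $ q)) =
    (\<chi> p q. sigma ?c * (kron (T_shift ?\<beta>) (T_shift ?\<alpha>) ** ?A) $ p $ q)"
  proof -
    have "x * sigma (?c * y) = sigma ?c * (x * sigma y)" for x :: "'n falg fps" and y
    proof -
      have "x * sigma (?c * y) = (x * sigma ?c) * sigma y" by (simp only: sigma.mult mult.assoc)
      then show ?thesis unfolding const_scalar_commute[of ?c x, symmetric] by (simp only: mult.assoc)
    qed
    then show ?thesis
      unfolding vec_eq_iff by (simp only: mat_mult_entry vec_lambda_beta sum_distrib_left) simp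
  qed
  ultimately have "sigma ?c * ((?A ** kron (T_shift ?\<alpha>) (T_shift ?\<beta>)) $ p $ q - (kron (T_shift ?\<beta>)
      (T_shift ?\<alpha>) ** ?A) $ p $ q) \<in> coeff_ideal J"
    using rel by (simp only: right_diff_distrib vec_lambda_beta)
  then show "(?A ** kron (T_shift ?\<alpha>) (T_shift ?\<beta>)) $ p $ q - (kron (T_shift ?\<beta>) (T_shift ?\<alpha>) ** ?A) $ p $
      q \<in> coeff_ideal J"
    by (rule scalar_cancel1[OF _ c])
qed

lemma smul_sigma_right: "A * smul (sigma c) B = smul (sigma c) (A * B)"
  by (rule smul_mult_right) (rule const_scalar_commute)

lemma skewS_Suc:
  fixes R :: "('n::finite, complex fps) mat2"
  assumes "k > 0"
  shows "\<exists>c. skewS R (Suc k) = smul (sigma c) (prod_list (map (\<lambda>i. QL R (Suc k) i (Suc i)) [0..<k]) * lext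
      (skewS R k))"
proof -
  interpret L: ring_hom1 "lop_map sigma :: ('n, complex fps) lop \<Rightarrow> ('n, 'n falg fps) lop"
    by (rule sigma.lop_map)
  have m: "map (lop_map sigma) (map (\<lambda>i. RL R (Suc k) i + smul (skew_coeff (Suc
      i)) (idL (Suc k))) [0..<k]) =
    map (\<lambda>i. QL R (Suc k) i (Suc i)) [0..<k]"
    unfolding map_map
  proof (rule map_cong[OF refl])
    fix i assume "i \<in> set [0..<k]"
    then have "RL R (Suc k) i + smul (skew_coeff (Suc i)) (idL (Suc k)) =
      Lop (Suc k) (leg2 (Suc k) i (Suc i) (R + mat (skew_coeff (Suc i))))"
      by (simp add: Lop_leg2_add Lop_leg2_mat)
    then show "(lop_map sigma \<circ> (\<lambda>i. RL R (Suc k) i + smul (skew_coeff (Suc i))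
        (idL (Suc k)))) i = QL R (Suc k) i (Suc i)"
      by (simp only: comp_def sigma.lop_map_leg2)
  qed
  show ?thesis
    unfolding skewL_Suc[OF assms] sigma.lop_map_smul L.mult L.prod_list m sigma.lop_map_lext by blast
qed

lemma upt_Suc_shift: "map f [0..<Suc k] = f 0 # map (\<lambda>i. f (Suc i)) [0..<k]"
  by (induction k) simp_all

text \<open>Nonemptiness matters because \<open>lext\<close> does not preserve 1.\<close>

lemma lext_prod_list: "xs \<noteq> [] \<Longrightarrow> lext (prod_list xs) = prod_list (map lext xs)"
  by (induction xs rule: list_nonempty_induct) (simp_all add: lext_mult)

text \<open>The algebra of the induction in \<open>skew_TT\<close>: \<open>X\<close> is the extended
  lower skew-symmetrizer, \<open>z\<close> the new factor of T, \<open>q\<close> the product of the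
  R-hats and \<open>c\<close> the scalar prefactor.\<close>

lemma (in two_sided_ideal) fusion_step:
  assumes IH: "X * t \<approx> t' * X" and comm: "X * z = z * X" and tr: "q * t' * z \<approx> y * q"
    and P: "P = c * (q * X)" and c: "\<And>x. c * x = x * c"
  shows "P * (t * z) \<approx> y * P"
proof -
  have e1: "P * (t * z) = c * q * (X * t) * z" unfolding P by (simp only: mult.assoc)
  have e2: "c * q * (t' * X) * z = c * (q * t' * z) * X" using comm by (simp only: mult.assoc)
  have "c * (y * q) * X = (c * y) * q * X" by (simp only: mult.assoc)
  then have e3: "c * (y * q) * X = y * P" unfolding c[of y] P by (simp only: mult.assoc)
  have "P * (t * z) \<approx> c * (q * t' * z) * X"
    unfolding e1 e2[symmetric] by (rule cgr_mult_right[OF cgr_mult_left[OF IH]])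
  moreover have "c * (q * t' * z) * X \<approx> y * P"
    unfolding e3[symmetric] by (rule cgr_mult_right[OF cgr_mult_left[OF tr]])
  ultimately show ?thesis by (rule cgr_trans)
qed

text \<open>By induction the lower skew-symmetrizer reverses the first k arguments, after which
  factor i carries x q^(-2(k-1-i)). Its ratio to the new argument x q^(-2k) is q^(2(i+1)), precisely
  the argument of the R-hat in that position, so the new T is transported to the front.\<close>

lemma skew_TT:
  fixes R :: "('n::finite, complex fps) mat2"
  assumes J: "torsion_free_ideal J" and D: "D_relations R M a c \<subseteq> J" and M: "M > 0"
  shows "two_sided_ideal.cgr (lop_ideal_of (coeff_ideal J))
    (skewS R k * prod_list (map (\<lambda>i. TL k i i) [0..<k]))
    (prod_list (map (\<lambda>i. TL k i (k - Suc i)) [0..<k]) * skewS R k)"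
proof -
  interpret torsion_free_ideal J by fact
  have I: "two_sided_ideal (coeff_ideal J)" by (rule coeff_ideal) unfold_locales
  interpret J1: two_sided_ideal "coeff_ideal J" by fact
  interpret L: two_sided_ideal "lop_ideal_of (coeff_ideal J) :: ('n, 'n falg fps) lop set" by (rule
      lop_ideal) fact
  have lext_cgr: "L.cgr (lext A) (lext B)" if "L.cgr A B" for A B
  proof -
    have "lext A - lext B = lext (A - B)" by (simp add: lext_diff)
    moreover have "ent (lext C) X Y \<in> coeff_ideal J" if "\<forall>X Y. ent C X Y \<in> coeff_ideal J" for C :: "('n,
        'n falg fps) lop" and X Y
      using that by (simp add: lext.rep_eq op_extend_def J1.zero_mem)
    ultimately show ?thesis using that by (simp add: L.cgr_def)
  qed
  show ?thesis
  proof (induction k)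
    case 0
    then show ?case by (simp add: L.cgr_refl)
  next
    case (Suc k)
    show ?case
    proof (cases "k = 0")
      case True
      have "skewS R 1 = idL 1"
        by (rule lop_eqI) (simp add: sigma.ent_lop_map ent_Lop op_id_def scalar.one scalar.zero)
      then show ?thesis using True by (simp add: L.cgr_refl)
    next
      case False
      then have k: "k > 0" by simp
      obtain d where d: "skewS R (Suc k) = smul (sigma d) (prod_list (map (\<lambda>i. QL R (Suc k) i (Suc i))
          [0..<k]) * lext (skewS R k))"
        using skewS_Suc[OF k] by blast
      let ?q = "prod_list (map (\<lambda>i. QL R (Suc k) i (Suc i)) [0..<k])"
      let ?X = "lext (skewS R k)"
      let ?t = "prod_list (map (\<lambda>i. TL (Suc k) i i) [0..<k])"
      let ?t' = "prod_list (map (\<lambda>i. TL (Suc k) i (k - Suc i)) [0..<k])"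
      let ?u = "prod_list (map (\<lambda>i. TL (Suc k) (Suc i) (k - Suc i)) [0..<k])"
      have lt: "lext (prod_list (map (\<lambda>i. TL k i (f i)) [0..<k])) = (prod_list (map (\<lambda>i. TL (Suc k) i (f
          i)) [0..<k]) :: ('n, 'n falg fps) lop)" for f
        using k by (subst lext_prod_list) (auto intro!: arg_cong[of _ _ prod_list] simp: lext_leg1)
      have IH: "L.cgr (?X * ?t) (?t' * ?X)"
        using lext_cgr[OF Suc] unfolding lext_mult lt .
      have comm: "?X * TL (Suc k) k k = TL (Suc k) k k * ?X"
        unfolding sigma.lop_map_Lop
        by (rule lext_leg1_last_commute) (simp add: ent_Lop const_scalar_commute)
      have tr: "L.cgr (?q * ?t' * TL (Suc k) k k) (TL (Suc k) 0 k * ?u * ?q)"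
      proof -
        let ?B = "\<lambda>i. TL (Suc k) i (k - i) :: ('n, 'n falg fps) lop"
        have "L.cgr (prod_list (map (\<lambda>i. QL R (Suc k) i (Suc i)) [0..<k]) * prod_list (map (\<lambda>i. TL (Suc k)
            i (k - Suc i)) [0..<k]) * TL (Suc k) k k)
          (TL (Suc k) 0 k * prod_list (map (\<lambda>i. ?B (Suc i)) [0..<k]) * prod_list (map (\<lambda>i. QL R (Suc k) i
              (Suc i)) [0..<k]))"
        proof (rule L.transport[where X = "\<lambda>i. TL (Suc k) i k" and B = ?B])
          fix i assume "i < k"
          then show "L.cgr (QL R (Suc k) i (Suc i) * TL (Suc k) i (k - Suc i) * TL (Suc k) (Suc i) k)
            (TL (Suc k) i k * TL (Suc k) (Suc i) (k - Suc i) * QL R (Suc k) i (Suc i))"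
            using QL_exchange[OF J D M, of "Suc i" i "Suc k" "k - Suc i"] by simp
        next
          fix i l assume "i < k" "l < i"
          then show "QL R (Suc k) i (Suc i) * TL (Suc k) l (k - Suc l) = TL (Suc k) l (k - Suc l) * QL R
              (Suc k) i (Suc i)"
            by (intro leg1_leg2_commute) (simp_all add: const_scalar_commute)
        next
          fix i l assume "Suc i < l" "l \<le> k"
          then show "QL R (Suc k) i (Suc i) * ?B l = ?B l * QL R (Suc k) i (Suc i)"
            by (intro leg1_leg2_commute) (simp_all add: const_scalar_commute)
        qed
        then show ?thesis .
      qed
      have "skewS R (Suc k) = smul (sigma d) 1 * (?q * ?X)"
        unfolding d smul_mult_left by (simp only: mult_1_left)
      moreover have "smul (sigma d) 1 * y = y * smul (sigma d) 1" for y :: "('n, 'n falg fps) lop"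
        by (simp only: smul_mult_left smul_sigma_right mult_1_left mult_1_right)
      ultimately have "L.cgr (skewS R (Suc k) * (?t * TL (Suc k) k k)) (TL (Suc k) 0 k * ?u * skewS R (Suc
          k))"
        by (rule L.fusion_step[OF IH comm tr])
      moreover have "prod_list (map (\<lambda>i. TL (Suc k) i (Suc k - Suc i)) [0..<Suc k]) = (TL (Suc k) 0 k * ?u
          :: ('n, 'n falg fps) lop)"
        by (simp only: upt_Suc_shift prod_list.Cons) simp
      moreover have "prod_list (map (\<lambda>i. TL (Suc k) i i) [0..<Suc k]) = (?t * TL (Suc k) k k :: ('n, 'n
          falg fps) lop)"
        by simp
      ultimately show ?thesis by (simp only:)
    qed
  qed
qed

section \<open>The quantum determinant as an eigenvalue\<close>

text \<open>The functional \<open>u\<close> takes the value 1 because \<open>v\<close> itself lies in the image.\<close>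

lemma skew_rank_one:
  fixes R :: "('n::finite, complex fps) mat2"
  assumes "is_v_R R M v"
  obtains u w I0 where "\<And>I J. length J = M \<Longrightarrow> skew_symmetrizer R M I J = v I * u J"
    "(\<Sum>J\<in>multi_idx M. u J * w J) = 1" "v I0 \<noteq> 0"
proof -
  let ?P = "skew_symmetrizer R M"
  have v: "v \<noteq> (\<lambda>_. 0)" and rng: "range (op_apply M ?P) = {(\<lambda>I. c * v I) | c. True}"
    using assms by (auto simp: is_v_R_def)
  have "\<exists>c. \<forall>I. ?P I J = v I * c" if "length J = M" for J
  proof -
    have "op_apply M ?P (\<lambda>L. if L = J then 1 else 0) \<in> range (op_apply M ?P)" by (rule rangeI)
    then obtain c where "op_apply M ?P (\<lambda>L. if L = J then 1 else 0) = (\<lambda>I. c * v I)"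
      unfolding rng by blast
    then have "?P I J = c * v I" for I
      using that by (auto simp: op_apply_def fun_eq_iff mult_delta_right sum.delta)
    then show ?thesis by (auto simp: mult.commute)
  qed
  then obtain u where u: "\<And>I J. length J = M \<Longrightarrow> ?P I J = v I * u J" by metis
  have "v \<in> range (op_apply M ?P)"
    unfolding rng by (rule CollectI, rule exI[of _ 1]) simp
  then obtain w where w: "v = op_apply M ?P w" by blast
  obtain I0 where I0: "v I0 \<noteq> 0" using v by auto
  have "v I0 = (\<Sum>J\<in>multi_idx M. ?P I0 J * w J)"
    by (subst w) (simp add: op_apply_def)
  also have "\<dots> = v I0 * (\<Sum>J\<in>multi_idx M. u J * w J)"
    by (simp add: u sum_distrib_left mult.assoc)
  finally have "(\<Sum>J\<in>multi_idx M. u J * w J) = 1" using I0 by simp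
  with u I0 that show ?thesis by blast
qed

text \<open>As P = v u, the congruence of P A and B P reads v U = V u modulo the ideal, with the row
  U = u A and the column V = B v. Applying both sides to w, where u w = 1, gives V = v D with D = U
  w, whence B P = D P.\<close>

lemma (in two_sided_ideal) rank_one_eigen:
  fixes A B P :: "('n::finite, 'b) lop" and f :: "complex fps \<Rightarrow> 'b"
  assumes f: "ring_hom1 f" and central: "\<And>c x. f c * x = x * f c"
    and P: "\<And>I L. length I = M \<Longrightarrow> length L = M \<Longrightarrow> ent P I L = f (v I) * f (u L)"
    and P0: "\<And>I L. length I \<noteq> M \<Longrightarrow> ent P I L = 0"
    and uw: "(\<Sum>L\<in>multi_idx M. u L * w L) = 1"
    and PA: "\<And>X Y. ent (P * A) X Y - ent (B * P) X Y \<in> J"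
  shows "\<exists>D. \<forall>X Y. ent (B * P) X Y - D * ent P X Y \<in> J"
proof -
  interpret f: ring_hom1 f by fact
  define U where "U = (\<lambda>L. \<Sum>N\<in>multi_idx M. f (u N) * ent A N L)"
  define V where "V = (\<lambda>I. \<Sum>N\<in>multi_idx M. ent B I N * f (v N))"
  define D where "D = (\<Sum>L\<in>multi_idx M. U L * f (w L))"
  have PAe: "ent (P * A) I L = f (v I) * U L" if "length I = M" for I L
    using that by (simp add: ent_mult P U_def sum_distrib_left mult.assoc)
  have BPe: "ent (B * P) I L = V I * f (u L)" if "length I = M" "length L = M" for I L
    using that by (simp add: ent_mult P V_def sum_distrib_right mult.assoc)
  have VD: "f (v I) * D - V I \<in> J" if I: "length I = M" for I
  proof -
    have "(\<Sum>L\<in>multi_idx M. (f (v I) * U L - V I * f (u L)) * f (w L)) \<in> J"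
    proof (intro sum_mem mult_right_mem)
      fix L :: "'n list" assume "L \<in> multi_idx M"
      then show "f (v I) * U L - V I * f (u L) \<in> J"
        using PA[of I L] I by (simp add: PAe BPe)
    qed
    also have "(\<Sum>L\<in>multi_idx M. (f (v I) * U L - V I * f (u L)) * f (w L)) =
      f (v I) * D - V I * f (\<Sum>L\<in>multi_idx M. u L * w L)"
      by (simp add: D_def left_diff_distrib sum_subtractf sum_distrib_left f.sum f.mult mult.assoc)
    finally show ?thesis by (simp add: uw f.one)
  qed
  have "ent (B * P) I L - D * ent P I L \<in> J" for I L
  proof (cases "length I = M \<and> length L = M")
    case True
    have "D * (f (v I) * f (u L)) = f (v I) * D * f (u L)"
      unfolding central[of "v I" D] by (simp only: mult.assoc)
    then have "ent (B * P) I L - D * ent P I L = - ((f (v I) * D - V I) * f (u L))"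
      using True by (simp add: BPe P left_diff_distrib)
    then show ?thesis using VD[of I] True by (simp only: minus_mem mult_right_mem)
  next
    case False
    have "ent (B * P) I L = 0 \<and> ent P I L = 0"
    proof (cases "length I = M")
      case True
      then show ?thesis using False by (simp add: ent_eq_0)
    next
      case I: False
      then show ?thesis by (simp add: P0 times_lop.rep_eq)
    qed
    then show ?thesis by (simp add: zero_mem)
  qed
  then show ?thesis by blast
qed

lemma (in two_sided_ideal) R_trace_cong:
  fixes A B :: "('n::finite, 'b) tensop"
  assumes "\<And>X Y. length X = k \<Longrightarrow> length Y = k \<Longrightarrow> A X Y - B X Y \<in> J"
  shows "R_trace C k A - R_trace C k B \<in> J"
  using assms
proof (induction k arbitrary: A B)
  case (Suc k)
  have "R_trace C k (partial_trace k (op_mult (Suc k) A (leg1 (Suc k) k C))) -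
    R_trace C k (partial_trace k (op_mult (Suc k) B (leg1 (Suc k) k C))) \<in> J"
  proof (rule Suc.IH)
    fix X Y :: "'n list" assume X: "length X = k" "length Y = k"
    have "partial_trace k (op_mult (Suc k) A (leg1 (Suc k) k C)) X Y - partial_trace k (op_mult (Suc k) B
        (leg1 (Suc k) k C)) X Y =
      (\<Sum>b\<in>UNIV. \<Sum>L\<in>multi_idx (Suc k). (A (X @ [b]) L - B (X @ [b]) L) * leg1 (Suc k) k C L (Y @ [b]))"
      using X by (simp add: partial_trace_def op_mult_def left_diff_distrib sum_subtractf)
    also have "\<dots> \<in> J"
      by (intro sum_mem mult_right_mem Suc.prems) (use X in auto)
    finally show "partial_trace k (op_mult (Suc k) A (leg1 (Suc k) k C)) X Y - partial_trace k (op_mult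
        (Suc k) B (leg1 (Suc k) k C)) X Y \<in> J" .
  qed
  then show ?case by simp
qed simp

lemma (in ring_hom1) R_trace_hom:
  fixes C :: "('n::finite, 'a) mat1"
  shows "R_trace (\<chi> i j. \<phi> (C $ i $ j)) k (\<lambda>X Y. D * \<phi> (A X Y)) = D * \<phi> (R_trace C k A)"
proof (induction k arbitrary: A)
  case (Suc k)
  have l: "leg1 (Suc k) k (\<chi> i j. \<phi> (C $ i $ j)) L Y = \<phi> (leg1 (Suc k) k C L Y)" for L Y
    by (auto simp: leg1_def zero)
  have "partial_trace k (op_mult (Suc k) (\<lambda>X Y. D * \<phi> (A X Y)) (leg1 (Suc k) k (\<chi> i j. \<phi> (C $ i $ j)))) =
    (\<lambda>X Y. D * \<phi> (partial_trace k (op_mult (Suc k) A (leg1 (Suc k) k C)) X Y))"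
    by (intro ext) (simp add: partial_trace_def op_mult_def l sum mult sum_distrib_left mult.assoc)
  then show ?case using Suc by simp
qed simp

text \<open>Needed because the spanning vector is a function on lists of all lengths: an index where
  it is nonzero must be shown to have length \<open>M\<close>.\<close>

lemma skew_supp: "length I \<noteq> k \<Longrightarrow> skew_symmetrizer R k I J = 0"
proof (cases k)
  case (Suc m)
  assume "length I \<noteq> k"
  then have "op_prod k (map (\<lambda>i. leg2 k (i - 1) i (R_hat R (fps_exp (2 * of_nat i)))) [1..<m + 1]) I L =
      0" if "m > 0" for L
    using that by (simp add: upt_conv_Cons op_prod_def op_mult_def leg2_def del: upt_Suc)
  then show ?thesis
    using Suc \<open>length I \<noteq> k\<close> by (auto simp: op_id_def op_mult_def del: upt_Suc)
qed (simp add: op_id_def)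

lemma ent_mult_id: "ent (A * idL K) X Y = (if length Y = K then ent A X Y else 0)"
proof (cases "length X = length Y")
  case True
  then show ?thesis
    by (simp add: times_lop.rep_eq ent_Lop op_id_def mult_delta_right sum.delta')
qed (simp add: ent_eq_0)

text \<open>\<open>D\<close> stands on the left of the skew-symmetrizer, so it comes out of the
  iterated traces without having to commute with anything.\<close>

lemma qdet_eigen:
  fixes R :: "('n::finite, complex fps) mat2"
  assumes J: "torsion_free_ideal J" and D: "D_relations R M a c \<subseteq> J" and M: "M > 0"
    and v: "is_v_R R M v"
  obtains D \<theta> where
    "\<And>X Y. ent (prod_list (map (\<lambda>i. TL M i (M - Suc i)) [0..<M]) * skewS R M) X Y - D * ent (skewS R M) X
        Y \<in> coeff_ideal J"
    "qdet_T_plus R M - D * sigma \<theta> \<in> coeff_ideal J"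
proof -
  interpret torsion_free_ideal J by fact
  have I: "two_sided_ideal (coeff_ideal J)" by (rule coeff_ideal) unfold_locales
  interpret J1: two_sided_ideal "coeff_ideal J" by fact
  interpret L: two_sided_ideal "lop_ideal_of (coeff_ideal J) :: ('n, 'n falg fps) lop set" by (rule
      lop_ideal) fact
  obtain u w I0 where P: "\<And>I J. length J = M \<Longrightarrow> skew_symmetrizer R M I J = v I * u J"
    and uw: "(\<Sum>J\<in>multi_idx M. u J * w J) = 1" and "v I0 \<noteq> 0"
    using skew_rank_one[OF v] by metis
  let ?T = "prod_list (map (\<lambda>i. TL M i i) [0..<M]) :: ('n, 'n falg fps) lop"
  let ?T' = "prod_list (map (\<lambda>i. TL M i (M - Suc i)) [0..<M]) :: ('n, 'n falg fps) lop"
  let ?P = "skewS R M :: ('n, 'n falg fps) lop"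
  have PT: "ent (?P * ?T) X Y - ent (?T' * ?P) X Y \<in> coeff_ideal J" for X Y
    using skew_TT[OF J D M, of M] by (simp add: L.cgr_def)
  obtain D where D: "\<And>X Y. ent (?T' * ?P) X Y - D * ent ?P X Y \<in> coeff_ideal J"
    using J1.rank_one_eigen[OF sigma.ring_hom1_axioms const_scalar_commute _ _ uw PT, of v]
    by (auto simp: sigma.lop_map_Lop ent_Lop P sigma.mult scalar.mult)
  define \<theta> where "\<theta> = R_trace (C_matrix R) M (skew_symmetrizer R M)"
  let ?X = "op_mult M (\<lambda>I J. sigma (skew_symmetrizer R M I J))
         (op_prod M (map (\<lambda>k. leg1 M k (T_shift (fps_exp (- 2 * of_nat k)))) [0..<M])) :: ('n, 'n falg
             fps) tensop"
  have "R_trace (\<chi> i j. sigma (C_matrix R $ i $ j)) M ?X -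
     R_trace (\<chi> i j. sigma (C_matrix R $ i $ j)) M (\<lambda>X Y. D * sigma (skew_symmetrizer R M X Y)) \<in>
         coeff_ideal J"
  proof (rule J1.R_trace_cong)
    fix X Y :: "'n list" assume len: "length X = M" "length Y = M"
    have "?X X Y = ent (Lop M ?X) X Y" using len by (simp add: ent_Lop)
    also have "Lop M ?X = ?P * ?T * idL M"
      by (simp add: Lop_op_mult Lop_op_prod sigma.lop_map_Lop comp_def mult.assoc)
    also have "ent (?P * ?T * idL M) X Y = ent (?P * ?T) X Y" using len by (simp add: ent_mult_id)
    finally have "?X X Y - D * sigma (skew_symmetrizer R M X Y) =
      (ent (?P * ?T) X Y - ent (?T' * ?P) X Y) + (ent (?T' * ?P) X Y - D * ent ?P X Y)"
      using len by (simp add: sigma.lop_map_Lop ent_Lop)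
    then show "?X X Y - D * sigma (skew_symmetrizer R M X Y) \<in> coeff_ideal J"
      using J1.add_mem[OF PT D] by (simp only:)
  qed
  then have "qdet_T_plus R M - D * sigma \<theta> \<in> coeff_ideal J"
    unfolding sigma.R_trace_hom \<theta>_def qdet_T_plus_def T_shift_def by simp
  with D that show ?thesis by blast
qed

section \<open>Centrality\<close>

text \<open>Every column of the skew-symmetrizer is a multiple of v_R, so the equation defining N_R,
  which concerns v_R only, becomes an operator identity with the rotation. The scalar s is nonzero
  because each R_i is invertible and the skew-symmetrizer is not zero.\<close>

lemma N_R_rotation:
  fixes R :: "('n::finite, complex fps) mat2"
  assumes h: "hecke_symmetry R" and N: "is_N_R R M N_R" and sc: "scalar_matrix N_R"
  obtains v s where "is_v_R R M v" "s \<noteq> 0"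
    "prod_list (map (\<lambda>i. RL R (Suc M) i) [0..<M]) * lext (skewL R M) =
     smul s (rotL (Suc M) * lext (skewL R M))"
    "skewL R M \<noteq> 0"
proof -
  let ?K = "Suc M"
  let ?r = "\<lambda>i. RL R ?K i"
  obtain s where s: "N_R = mat s" using sc by (auto simp: scalar_matrix_def)
  obtain v where v: "is_v_R R M v" and ev: "\<And>w :: complex ^ 'n.
       op_apply (M + 1) (op_prod (M + 1) (map (\<lambda>i. leg2 (M + 1) i (i + 1) R) [0..<M]))
         (tensor_vec M v (vec1 (\<chi> i. fps_const (w $ i)))) = tensor_vec 1 (vec1 (N_R *v (\<chi> i. fps_const (w
             $ i)))) v"
    using N unfolding is_N_R_def Let_def by blast
  obtain u w I0 where P: "\<And>I J. length J = M \<Longrightarrow> skew_symmetrizer R M I J = v I * u J"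
    and uw: "(\<Sum>J\<in>multi_idx M. u J * w J) = 1" and I0: "v I0 \<noteq> 0"
    using skew_rank_one[OF v] by metis
  have "\<exists>J0. length J0 = M \<and> u J0 \<noteq> 0"
  proof (rule ccontr)
    assume "\<nexists>J0. length J0 = M \<and> u J0 \<noteq> 0"
    then have "(\<Sum>J\<in>multi_idx M. u J * w J) = 0" by (intro sum.neutral) simp
    then show False using uw by simp
  qed
  then obtain J0 where J0: "length J0 = M" "u J0 \<noteq> 0" by blast
  have "skew_symmetrizer R M I0 J0 \<noteq> 0" using P J0 I0 by simp
  then have nz: "skewL R M \<noteq> 0"
    using J0 skew_supp[of I0 M R J0] by (metis ent_Lop ent_simps(1))
  let ?O = "op_prod ?K (map (\<lambda>i. leg2 ?K i (Suc i) R) [0..<M])"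
  \<comment> \<open>The defining equation for w the basis vector e_j; N_R acts by s.\<close>
  have col: "(\<Sum>L\<in>multi_idx M. ?O I (L @ [j]) * v L) = (if hd I = j then s * v (tl I) else 0)" if I:
      "length I = ?K" for I j
  proof -
    let ?e = "(\<chi> i. fps_const ((axis j 1 :: complex ^ 'n) $ i)) :: complex fps ^ 'n"
    have e: "?e $ l = (if l = j then 1 else 0)" for l by (simp add: axis_def)
    have "op_apply ?K ?O (tensor_vec M v (vec1 ?e)) I = tensor_vec 1 (vec1 (N_R *v ?e)) v I"
      using ev[of "axis j 1"] by (simp only: Suc_eq_plus1)
    moreover have "op_apply ?K ?O (tensor_vec M v (vec1 ?e)) I = (\<Sum>L\<in>multi_idx M. ?O I (L @ [j]) * v L)"
      unfolding op_apply_def sum_multi_idx_Suc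
    proof (rule sum.cong[OF refl])
      fix L :: "'n list" assume "L \<in> multi_idx M"
      then have L: "length L = M" by simp
      have "tensor_vec M v (vec1 ?e) (L @ [l]) = (if l = j then v L else 0)" for l
        using L e[of l] by (simp add: tensor_vec_def vec1_def del: vec_lambda_beta)
      then show "(\<Sum>l\<in>UNIV. ?O I (L @ [l]) * tensor_vec M v (vec1 ?e) (L @ [l])) = ?O I (L @ [j]) * v L"
        by (simp add: mult_delta_right sum.delta)
    qed
    moreover have "tensor_vec 1 (vec1 (N_R *v ?e)) v I = (if hd I = j then s * v (tl I) else 0)"
    proof -
      obtain i I' where I': "I = i # I'" using I by (cases I) auto
      have "(mat s *v ?e) $ i = (if i = j then s else 0)"
        by (simp add: matrix_vector_mult_def mat_def e mult_delta_left mult_delta_right sum.delta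
            sum.delta' del: vec_lambda_beta)
           (simp add: mat_def mult_delta_left mult_delta_right sum.delta sum.delta')
      then show ?thesis by (simp add: tensor_vec_def vec1_def I' s)
    qed
    ultimately show ?thesis by simp
  qed
  have rot: "prod_list (map ?r [0..<M]) * lext (skewL R M) = smul s (rotL ?K * lext (skewL R M))"
  proof (rule lop_eqI)
    fix I J :: "'n list" assume len: "length I = length J"
    show "ent (prod_list (map ?r [0..<M]) * lext (skewL R M)) I J = ent (smul s (rotL ?K * lext (skewL R
        M))) I J"
    proof (cases "length J = ?K")
      case True
      then obtain J' j where J: "J = J' @ [j]" "length J' = M" by (auto simp: length_Suc_conv_rev)
      have I: "length I = ?K" using len True by simp
      have O: "ent (prod_list (map ?r [0..<M])) I L = ?O I L" if "length L = ?K" for L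
      proof -
        have "ent (prod_list (map ?r [0..<M]) * idL ?K) I L = ent (Lop ?K ?O) I L"
          by (simp add: Lop_op_prod comp_def)
        then show ?thesis using that I by (simp add: ent_mult_id ent_Lop)
      qed
      have "ent (prod_list (map ?r [0..<M]) * lext (skewL R M)) I J = (\<Sum>L\<in>multi_idx M. ?O I (L @ [j]) * (v
          L * u J'))"
        using J I by (simp add: ent_mult sum_multi_idx_Suc ent_lext ent_Lop O P mult_delta_right sum.delta)
      also have "\<dots> = (if hd I = j then s * v (tl I) else 0) * u J'"
        unfolding col[OF I, symmetric] by (simp add: sum_distrib_right mult.assoc)
      also have "\<dots> = ent (smul s (rotL ?K * lext (skewL R M))) I J"
      proof -
        obtain i I' where I': "I = i # I'" "length I' = M" using I by (cases I) auto
        then show ?thesis using J I by (simp add: ent_rotL_mult ent_lext ent_Lop P mult.assoc)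
      qed
      finally show ?thesis .
    next
      case False
      have "ent (A * lext (skewL R M)) I J = 0" for A
        using False by (auto simp: lext_Lop times_lop.rep_eq ent_Lop intro!: sum.neutral)
      then show ?thesis by simp
    qed
  qed
  have "s \<noteq> 0"
  proof
    assume "s = 0"
    then have 0: "prod_list (map ?r [0..<M]) * lext (skewL R M) = 0" using rot by simp
    \<comment> \<open>The quadratic relation provides R - (q - q^-1) I as a left inverse of R, so
      the factors can be stripped off one by one.\<close>
    have inv: "(?r i - smul (fps_exp 1 - fps_exp (- 1)) (idL ?K)) * ?r i = idL ?K" if "i < M" for i
      using hecke_quadratic[OF h, of i ?K] that by (simp add: left_diff_distrib smul_mult_left)
    have "prod_list (map ?r xs) * lext (skewL R M) = 0 \<Longrightarrow> lext (skewL R M) = 0" if "set xs \<subseteq> {..<M}" for xs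
      using that
    proof (induction xs)
      case (Cons i xs)
      let ?Y = "prod_list (map ?r xs) * lext (skewL R M)"
      have "idL ?K * ?Y = (?r i - smul (fps_exp 1 - fps_exp (- 1)) (idL ?K)) * (?r i * ?Y)"
        using inv[of i] Cons.prems mult.assoc[of "?r i - smul (fps_exp 1 - fps_exp (- 1)) (idL ?K)" "?r i"
            ?Y] by simp
      also have "\<dots> = 0" using Cons.prems by (simp add: mult.assoc)
      finally have "idL ?K * ?Y = 0" .
      moreover have "idL ?K * ?Y = ?Y"
        by (cases xs) (simp_all add: lext_Lop flip: mult.assoc)
      ultimately show ?case using Cons by simp
    qed simp
    from this[OF _ 0] have X0: "lext (skewL R M) = 0" by (simp add: atLeast0LessThan)
    have "skewL R M = 0"
    proof (rule lop_eqI)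
      fix I J :: "'n list"
      show "ent (skewL R M) I J = ent 0 I J"
        using arg_cong[OF X0, of "\<lambda>A. ent A (I @ [undefined]) (J @ [undefined])"] by (simp add: ent_lext)
    qed
    then show False using nz by simp
  qed
  with v rot nz that show ?thesis by blast
qed

text \<open>Both sides of \<open>tr\<close> are applied to \<open>P\<close>, on which
  \<open>L\<close> and \<open>L'\<close> both act as the scalar \<open>s\<close> times the rotation
  \<open>C\<close>. On the left \<open>A\<close> becomes the eigenvalue \<open>d\<close> in front;
  on the right the rotation restores \<open>B\<close> and \<open>X\<close> to \<open>A\<close> and
  \<open>Y\<close>, and \<open>d\<close> appears behind \<open>Y\<close>.\<close>

lemma (in two_sided_ideal) central_core:
  assumes tr: "L * A * Y \<approx> X * B * L'"
    and L: "L * P = s * (C * P)" "L' * P = s * (C * P)"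
    and A: "A * P \<approx> d * P" and Ld: "L * d = d * L" and s: "\<And>x. s * x = x * s"
    and YP: "Y * P = P * Y" and CA: "C * A = B * C" and CY: "C * Y = X * C"
  shows "s * (C * (Y * (d * P))) \<approx> s * (d * (C * (Y * P)))"
proof -
  have e1: "L * A * Y * P = L * (A * P) * Y" using YP by (simp only: mult.assoc)
  have "L * (d * P) * Y = (L * d) * P * Y" by (simp only: mult.assoc)
  also have "\<dots> = d * (L * P) * Y" unfolding Ld by (simp only: mult.assoc)
  also have "\<dots> = (d * s) * (C * (P * Y))" unfolding L by (simp only: mult.assoc)
  finally have e2: "L * (d * P) * Y = s * (d * (C * (Y * P)))"
    unfolding s[of d, symmetric] YP by (simp only: mult.assoc)
  have "X * B * L' * P = X * B * (L' * P)" by (simp only: mult.assoc)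
  also have "\<dots> = (X * B * s) * (C * P)" unfolding L by (simp only: mult.assoc)
  also have "\<dots> = s * (X * (B * C) * P)" unfolding s[of "X * B", symmetric] by (simp only: mult.assoc)
  finally have e3: "X * B * L' * P = s * (X * C * (A * P))" unfolding CA[symmetric] by (simp only: mult.assoc)
  have e4: "s * (X * C * (d * P)) = s * (C * (Y * (d * P)))" unfolding CY[symmetric] by (simp only:
      mult.assoc)
  have "s * (C * (Y * (d * P))) \<approx> X * B * L' * P"
    unfolding e3 e4[symmetric] by (intro cgr_mult_left cgr_sym[OF A])
  moreover have "X * B * L' * P \<approx> L * A * Y * P"
    by (rule cgr_sym[OF cgr_mult_right[OF tr]])
  moreover have "L * A * Y * P \<approx> s * (d * (C * (Y * P)))"
    unfolding e1 e2[symmetric] by (intro cgr_mult_left cgr_mult_right A)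
  ultimately show ?thesis by (blast intro: cgr_trans)
qed

abbreviation sigma2 :: "complex fps \<Rightarrow> 'n falg fps fps" where
  "sigma2 c \<equiv> fps_const (sigma c)"

interpretation sigma2: ring_hom1 "sigma2 :: complex fps \<Rightarrow> 'n falg fps fps"
  by unfold_locales (simp_all add: scalar.add scalar.mult scalar.one)

lemma sigma2_commute: "sigma2 c * y = y * sigma2 c"
  by (rule fps_central) (simp add: const_scalar_commute scalar.zero)

lemma evT_const: "evT a (fps_const x) = fps_const (fps_const x)"
  by (rule fps_ext) (simp add: nth_evT)

lemma evT_ideal:
  assumes "two_sided_ideal J" "f \<in> coeff_ideal J"
  shows "evT a f \<in> coeff_ideal (coeff_ideal J)"
  using assms two_sided_ideal.zero_mem[OF assms(1)]
  by (auto simp: coeff_ideal_def nth_evT fps_X_power_mult_right_nth)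

text \<open>\<open>V'\<close> lists the coefficients of S in the inner variable t. The operator
  congruence of \<open>central_core\<close> is compared at one matrix entry, where the
  skew-symmetrizer contributes only a nonzero scalar.\<close>

lemma eigenvalue_commutes:
  fixes R :: "('n::finite, complex fps) mat2" and V :: "int \<Rightarrow> ('n, 'n falg) mat1"
  assumes J: "torsion_free_ideal J" and h: "hecke_symmetry R" and rk: "has_rank_M0 R M"
    and rel: "exchange_rel J (Q_mat R M) u u' V"
    and V: "\<And>m k N. k \<le> m \<Longrightarrow> V (\<nu> m N + int k) =
      (if b * k + a * (m - k) \<le> N then V' (N - (b * k + a * (m - k))) else 0)"
    and D: "\<And>X Y. ent (prod_list (map (\<lambda>i. TL M i (M - Suc i)) [0..<M]) * skewS R M) X Y - D * ent (skewS
        R M) X Y \<in> coeff_ideal J"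
    and s: "s \<noteq> 0" and nz: "skewL R M \<noteq> 0"
    and rot: "prod_list (map (\<lambda>i. RL R (Suc M) i) [0..<M]) * lext (skewL R M) =
     smul s (rotL (Suc M) * lext (skewL R M))"
  shows "V' n $ i $ j * fps_nth D m - fps_nth D m * V' n $ i $ j \<in> J"
proof -
  interpret torsion_free_ideal J by fact
  have J0: "two_sided_ideal J" by unfold_locales
  have I1: "two_sided_ideal (coeff_ideal J)" by (rule coeff_ideal) fact
  have I2: "two_sided_ideal (coeff_ideal (coeff_ideal J))" by (rule coeff_ideal) fact
  interpret J2: two_sided_ideal "coeff_ideal (coeff_ideal J)" by fact
  interpret L: two_sided_ideal "lop_ideal_of (coeff_ideal (coeff_ideal J)) :: ('n, 'n falg fps fps) lop set"
    by (rule lop_ideal) fact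
  interpret E: ring_hom1 "evT a :: 'n falg fps \<Rightarrow> _" by (rule evT_hom)
  interpret LE: ring_hom1 "lop_map (evT a) :: ('n, 'n falg fps) lop \<Rightarrow> _" by (rule E.lop_map)
  interpret LS: ring_hom1 "lop_map sigma2 :: ('n, complex fps) lop \<Rightarrow> ('n, 'n falg fps fps) lop" by (rule
      sigma2.lop_map)
  have M: "M > 0" using rank_M0[OF rk] by simp
  define K where "K = Suc M"
  define P where "P = (lop_map sigma2 (skewL R M) :: ('n, 'n falg fps fps) lop)"
  define Q where "Q = (\<lambda>u i. Lop K (leg2 K i (Suc i) (\<chi> p q. evQ b u (subst_scale (fps_exp (- 1) ^ (2 * (M
      - Suc i))) (Q_mat R M $ p $ q)))) :: ('n, 'n falg fps fps) lop)"
  define T where "T = (\<lambda>i e. Lop K (leg1 K i (\<chi> i j. evT a (T_shift (fps_exp (- 1) ^ (2 * e)) $ i $ j)))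
      :: ('n, 'n falg fps fps) lop)"
  define X where "X = (\<lambda>i. Lop K (leg1 K i (series_mat V')) :: ('n, 'n falg fps fps) lop)"
  define d where "d = (smul (evT a D) 1 :: ('n, 'n falg fps fps) lop)"
  define s' where "s' = (smul (sigma2 s) 1 :: ('n, 'n falg fps fps) lop)"
  let ?L = "\<lambda>u. prod_list (map (Q u) [0..<M])"
  let ?A = "prod_list (map (\<lambda>i. T i (M - Suc i)) [0..<M])"
  let ?B = "prod_list (map (\<lambda>i. T (Suc i) (M - Suc i)) [0..<M])"
  have TE: "lop_map (evT a) (TL K i e) = T i e" for i e
    unfolding T_def E.lop_map_leg1 fps_exp_m1_power ..
  have PE: "lop_map (evT a) (skewS R M) = P"
    by (rule lop_eqI) (simp add: P_def E.ent_lop_map sigma.ent_lop_map sigma2.ent_lop_map evT_const)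
  have tr: "L.cgr (?L u * ?A * X M) (X 0 * ?B * ?L u')"
  proof -
    let ?BB = "\<lambda>i. T i (M - i)"
    have "L.cgr (prod_list (map (Q u) [0..<M]) * prod_list (map (\<lambda>i. T i (M - Suc i)) [0..<M]) * X M)
      (X 0 * prod_list (map (\<lambda>i. ?BB (Suc i)) [0..<M]) * prod_list (map (Q u') [0..<M]))"
    proof (rule L.transport)
      fix i assume "i < M"
      then show "L.cgr (Q u i * T i (M - Suc i) * X (Suc i)) (X i * ?BB (Suc i) * Q u' i)"
        unfolding Q_def T_def X_def
        by (intro exchange_leg[OF I2] exchange_series[OF J0 rel V]) (simp_all add: K_def)
    next
      fix i l assume "i < M" "l < i"
      then show "Q u i * T l (M - Suc l) = T l (M - Suc l) * Q u i"
        unfolding Q_def T_def by (intro leg1_leg2_commute) (simp_all add: K_def evQ_commute)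
    next
      fix i l assume "Suc i < l" "l \<le> M"
      then show "Q u' i * ?BB l = ?BB l * Q u' i"
        unfolding Q_def T_def by (intro leg1_leg2_commute) (simp_all add: K_def evQ_commute)
    qed
    then show ?thesis by simp
  qed
  have lp: "lext P = lop_map sigma2 (lext (skewL R M))"
    unfolding P_def by (rule sigma2.lop_map_lext[symmetric])
  \<comment> \<open>The right-hand side in \<open>Q_mat_fusion\<close> is constant in x, so it does
    not see the dilation by \<open>w\<close>: the products of the Q_i for \<open>u\<close> and
    \<open>u'\<close> act alike on the image.\<close>
  have LP: "?L w * lext P = s' * (rotL K * lext P)" for w
  proof -
    interpret W: ring_hom1 "evQ b w :: complex fps fps \<Rightarrow> 'n falg fps fps" by (rule evQ_hom)
    interpret LW: ring_hom1 "lop_map (evQ b w) :: ('n, complex fps fps) lop \<Rightarrow> ('n, 'n falg fps fps) lop"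
        by (rule W.lop_map)
    interpret c: ring_hom1 "fps_const :: complex fps \<Rightarrow> complex fps fps" by (rule fps_const_hom)
    have comp: "lop_map (evQ b w) (lop_map fps_const Z) = (lop_map sigma2 Z :: ('n, 'n falg fps fps) lop)"
        for Z :: "('n, complex fps) lop"
      by (rule lop_eqI) (simp only: W.ent_lop_map c.ent_lop_map sigma2.ent_lop_map evQ_const)
    have rotm: "lop_map sigma2 (rotL K) = (rotL K :: ('n, 'n falg fps fps) lop)"
    proof -
      have "sigma2 (if x then 1 else 0) = (if x then 1 else 0 :: 'n falg fps fps)" for x
        by (cases x) (simp_all only: if_True if_False sigma2.one sigma2.zero)
      then show ?thesis by (simp only: rotL_def sigma2.lop_map_Lop)
    qed
    define F where "F = (\<lambda>i. Lop K (leg2 K i (Suc i) (\<chi> a b. subst_scale (fps_exp (- 1) ^ (2 * (M - Suc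
        i))) (Q_mat R M $ a $ b))))"
    have F: "prod_list (map F [0..<M]) * lop_map fps_const (lext (skewL R M)) = lop_map fps_const (smul s
        (rotL K * lext (skewL R M)))"
      using Q_mat_fusion[OF h rk] unfolding F_def K_def rot .
    have FQ: "map (lop_map (evQ b w)) (map F [0..<M]) = map (Q w) [0..<M]"
      unfolding map_map
      by (rule map_cong[OF refl]) (simp only: F_def Q_def o_apply W.lop_map_leg2 vec_lambda_beta)
    have "lop_map (evQ b w) (prod_list (map F [0..<M]) * lop_map fps_const (lext (skewL R M))) = ?L w *
        lext P"
      by (simp only: LW.mult LW.prod_list FQ comp lp)
    then have "?L w * lext P = lop_map sigma2 (smul s (rotL K * lext (skewL R M)))"
      by (simp only: F comp)
    then show ?thesis
      by (simp only: sigma2.lop_map_smul LS.mult lp rotm s'_def smul_mult_left mult_1_left)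
  qed
  have AP: "L.cgr (?A * lext P) (d * lext P)"
  proof -
    have "lext (prod_list (map (\<lambda>i. TL M i (M - Suc i)) [0..<M])) = (prod_list (map (\<lambda>i. TL K i (M - Suc
        i)) [0..<M]) :: ('n, 'n falg fps) lop)"
      using M by (subst lext_prod_list) (auto intro!: arg_cong[of _ _ prod_list] simp: lext_leg1 K_def)
    then have "lop_map (evT a) (lext (prod_list (map (\<lambda>i. TL M i (M - Suc i)) [0..<M]) * skewS R M)) = ?A
        * lext P"
      unfolding lext_mult LE.mult E.lop_map_lext[of "skewS R M"] PE by (simp only: LE.prod_list map_map
          comp_def TE)
    moreover have "lop_map (evT a) (lext (smul D (skewS R M))) = d * lext P"
      by (simp add: E.lop_map_lext E.lop_map_smul PE lext_smul d_def smul_mult_left)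
    ultimately have "?A * lext P - d * lext P =
      lop_map (evT a) (lext (prod_list (map (\<lambda>i. TL M i (M - Suc i)) [0..<M]) * skewS R M - smul D (skewS
          R M)))"
      by (simp only: lext_diff LE.diff)
    moreover have "ent (lop_map (evT a) (lext Z)) U W \<in> coeff_ideal (coeff_ideal J)"
      if "\<And>U W. ent Z U W \<in> coeff_ideal J" for Z :: "('n, 'n falg fps) lop" and U W
      unfolding E.ent_lop_map
      by (rule evT_ideal[OF J0]) (simp add: lext.rep_eq op_extend_def that two_sided_ideal.zero_mem[OF I1])
    ultimately show ?thesis
      using D unfolding L.cgr_def by simp
  qed
  have Qd: "Q u i * d = d * Q u i" for i
    unfolding d_def smul_mult_left mult_1_left
    by (subst smul_mult_right) (simp_all add: Q_def ent_Lop leg2_def evQ_commute)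
  have "d * ?L u = ?L u * d"
    by (rule commute_prod_list) (use Qd in auto)
  then have Ld: "?L u * d = d * ?L u" by simp
  have sc: "s' * x = x * s'" for x
    unfolding s'_def smul_mult_left mult_1_left
    by (subst smul_mult_right) (simp_all add: sigma2_commute)
  have YP: "X M * lext P = lext P * X M"
    unfolding X_def K_def P_def sigma2.lop_map_Lop
    by (rule lext_leg1_last_commute[symmetric]) (simp add: ent_Lop sigma2_commute)
  have CT: "rotL K * T l e = T (Suc l) e * rotL K" if "l < M" for l e
    using that rotL_leg1[of l K] by (simp add: T_def K_def)
  have CA: "rotL K * ?A = ?B * rotL K"
  proof -
    have "rotL K * prod_list (map (\<lambda>i. T i (M - Suc i)) xs) = prod_list (map (\<lambda>i. T (Suc i) (M - Suc i))
        xs) * rotL K"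
      if "set xs \<subseteq> {..<M}" for xs
      using that
    proof (induction xs)
      case (Cons l xs)
      have "rotL K * (T l (M - Suc l) * Z) = T (Suc l) (M - Suc l) * (rotL K * Z)" for Z
        using CT[of l] Cons.prems by (simp flip: mult.assoc)
      then show ?case using Cons by (simp add: mult.assoc)
    qed simp
    then show ?thesis by (simp add: atLeast0LessThan)
  qed
  have CY: "rotL K * X M = X 0 * rotL K"
    using rotL_leg1[of M K "series_mat V'"] by (simp add: X_def K_def)
  have core: "L.cgr (s' * (rotL K * (X M * (d * lext P)))) (s' * (d * (rotL K * (X M * lext P))))"
    by (rule L.central_core[OF tr LP LP AP Ld sc YP CA CY])
  \<comment> \<open>Any nonzero entry of the skew-symmetrizer will do. Its row is completed to
    \<open>i # I'\<close>, which the rotation turns into \<open>I' @ [i]\<close>, so that entry (i,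
    j) of the series of S appears next to \<open>D\<close>.\<close>
  obtain I' J' where P0: "ent (skewL R M) I' J' \<noteq> 0"
    using nz lop_eqI[of "skewL R M" 0] by auto
  then have len: "length I' = M" "length J' = M" by (auto simp: ent_Lop split: if_splits)
  let ?p = "ent (skewL R M) I' J'" and ?S = "series_mat V' $ i $ j"
  let ?Ia = "i # I'" and ?I = "I' @ [i]" and ?J = "J' @ [j]"
  have dP: "d * lext P = lext (smul (evT a D) P)"
    by (simp add: d_def smul_mult_left lext_smul)
  have Pp: "ent P I' J' = sigma2 ?p"
    by (simp add: P_def sigma2.ent_lop_map)
  have rotE: "ent (rotL K * Z) ?Ia ?J = ent Z ?I ?J" for Z :: "('n, 'n falg fps fps) lop"
    by (subst ent_rotL_mult) (simp_all add: len K_def)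
  have XE: "ent (X M * lext Z) ?I ?J = ?S * ent Z I' J'" for Z
    unfolding X_def K_def by (rule ent_leg1_last_mult_lext[OF len])
  have "ent (s' * (rotL K * (X M * (d * lext P)))) ?Ia ?J = sigma2 s * (?S * (evT a D * sigma2 ?p))"
    unfolding dP by (simp only: s'_def smul_mult_left mult_1_left ent_smul rotE XE Pp)
  moreover have "ent (s' * (d * (rotL K * (X M * lext P)))) ?Ia ?J = sigma2 s * (evT a D * (?S * sigma2 ?p))"
    by (simp only: s'_def d_def smul_mult_left mult_1_left ent_smul rotE XE Pp)
  moreover have "ent (s' * (rotL K * (X M * (d * lext P))) - s' * (d * (rotL K * (X M * lext P)))) ?Ia ?J
      \<in> coeff_ideal (coeff_ideal J)"
    using core unfolding L.cgr_def by blast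
  ultimately have mem: "sigma2 s * (?S * (evT a D * sigma2 ?p)) - sigma2 s * (evT a D * (?S * sigma2 ?p))
      \<in> coeff_ideal (coeff_ideal J)"
    by (simp only: ent_simps)
  have "sigma2 s * (?S * (evT a D * sigma2 ?p)) - sigma2 s * (evT a D * (?S * sigma2 ?p)) =
    sigma2 (s * ?p) * (?S * evT a D - evT a D * ?S)"
  proof -
    have "x * (y * sigma2 ?p) = sigma2 ?p * (x * y)" for x y :: "'n falg fps fps"
      unfolding sigma2_commute[of ?p "x * y"] by (simp only: mult.assoc)
    then show ?thesis
      by (simp only: sigma2.mult right_diff_distrib mult.assoc)
  qed
  then have "?S * evT a D - evT a D * ?S \<in> coeff_ideal (coeff_ideal J)"
    using mem P0 s scalar_cancel2[of "s * ?p"] by simp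
  \<comment> \<open>Coefficient \<open>m\<close> of \<open>D\<close> comes with x^m = t^(am) w^m and
    \<open>V' n\<close> with t^n, whence the degree n + a m in t.\<close>
  then have "fps_nth (fps_nth (?S * evT a D - evT a D * ?S) m) (n + a * m) \<in> J"
    by (simp add: coeff_ideal_def)
  moreover have "fps_nth (fps_nth (?S * evT a D - evT a D * ?S) m) (n + a * m) = V' n $ i $ j * fps_nth D
      m - fps_nth D m * V' n $ i $ j"
  proof -
    have "x * (fps_const c * fps_X ^ k) = fps_X ^ k * (x * fps_const c)" for x :: "'n falg fps" and c k
      unfolding fps_mult_fps_X_power_commute[of k "x * fps_const c"] by (simp only: mult.assoc)
    moreover have "fps_const c * fps_X ^ k * x = fps_X ^ k * (fps_const c * x)" for x :: "'n falg fps" and c k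
      unfolding mult.assoc fps_mult_fps_X_power_commute[of k x] fps_mult_fps_X_power_commute[of k
          "fps_const c * x"] ..
    ultimately show ?thesis
      by (simp add: series_mat_def nth_evT fps_X_power_mult_nth)
  qed
  ultimately show ?thesis by simp
qed

text \<open>Modulo the ideal the determinant is \<open>D\<close> times a central scalar, so
  commutators with \<open>D\<close> suffice. Generators of negative index are coefficients of T^+,
  all others of T^-.\<close>

lemma qdet_commutes_generators:
  fixes R :: "('n::finite, complex fps) mat2"
  assumes J: "torsion_free_ideal J" and Drel: "D_relations R M a c \<subseteq> J"
    and h: "hecke_symmetry R" and rk: "has_rank_M0 R M"
    and N: "is_N_R R M N_R" and sc: "scalar_matrix N_R"
  shows "gen i j r * fps_nth (qdet_T_plus R M) m - fps_nth (qdet_T_plus R M) m * gen i j r \<in> J"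
proof -
  interpret torsion_free_ideal J by fact
  have J0: "two_sided_ideal J" by unfold_locales
  have M: "M > 0" using rank_M0[OF rk] by simp
  obtain v s where v: "is_v_R R M v" and s: "s \<noteq> 0"
    and rot: "prod_list (map (\<lambda>i. RL R (Suc M) i) [0..<M]) * lext (skewL R M) =
     smul s (rotL (Suc M) * lext (skewL R M))"
    and nz: "skewL R M \<noteq> 0"
    by (rule N_R_rotation[OF h N sc])
  obtain D \<theta> where D: "\<And>X Y. ent (prod_list (map (\<lambda>i. TL M i (M - Suc i)) [0..<M]) * skewS R M) X Y - D *
      ent (skewS R M) X Y \<in> coeff_ideal J"
    and q: "qdet_T_plus R M - D * sigma \<theta> \<in> coeff_ideal J"
    by (rule qdet_eigen[OF J Drel M v]) (rule that; blast)
  have DV: "gen i j r * fps_nth D m - fps_nth D m * gen i j r \<in> J"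
  proof (cases "r < 0")
    case True
    \<comment> \<open>T^+ carries the generator of index - n - 1 at x^n.\<close>
    define n where "n = nat (- r - 1)"
    have "T_plus_coeff (int n) $ i $ j = gen i j r"
      using True by (simp add: T_plus_coeff_def T_plus_def n_def)
    moreover have "T_plus_coeff (int n) $ i $ j * fps_nth D m - fps_nth D m * T_plus_coeff (int n) $ i $ j
        \<in> J"
      by (rule eigenvalue_commutes[OF J h rk exchange_plus[OF Drel] _ D s nz rot, where \<nu> = "\<lambda>m N. int N -
          int m" and a = 1 and b = 0])
        (auto simp: T_plus_coeff_neg of_nat_diff algebra_simps)
    ultimately show ?thesis by simp
  next
    case False
    define n where "n = nat r"
    have "T_minus_coeff (- int n) $ i $ j = gen i j r"
      using False by (simp add: T_minus_coeff_def n_def)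
    moreover have "T_minus_coeff (- int n) $ i $ j * fps_nth D m - fps_nth D m * T_minus_coeff (- int n) $
        i $ j \<in> J"
    proof (rule eigenvalue_commutes[OF J h rk exchange_minus[OF Drel J0] _ D s nz rot,
        where \<nu> = "\<lambda>m N. - int N" and a = 0 and b = 1 and V' = "\<lambda>n. T_minus_coeff (- int n)"])
      fix m k N :: nat
      show "T_minus_coeff (- int N + int k) = (if 1 * k + 0 * (m - k) \<le> N then T_minus_coeff (- int (N -
          (1 * k + 0 * (m - k)))) else 0)"
        by (auto simp: of_nat_diff T_minus_coeff_def vec_eq_iff)
    qed
    ultimately show ?thesis by simp
  qed
  let ?q = "fps_nth (qdet_T_plus R M) m" and ?g = "gen i j r"
  have q': "?q - fps_nth D m * scalar \<theta> \<in> J"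
    using q by (simp add: coeff_ideal_def)
  have "?g * ?q - ?q * ?g = (?g * (?q - fps_nth D m * scalar \<theta>) - (?q - fps_nth D m * scalar \<theta>) * ?g) +
     (?g * fps_nth D m - fps_nth D m * ?g) * scalar \<theta>"
  proof -
    have "fps_nth D m * scalar \<theta> * ?g = fps_nth D m * ?g * scalar \<theta>"
      using scalar_commute[of \<theta> ?g] by (simp add: mult.assoc)
    then show ?thesis by (simp add: algebra_simps)
  qed
  then show ?thesis
    using add_mem[OF diff_mem[OF mult_left_mem[OF q'] mult_right_mem[OF q']] mult_right_mem[OF DV]] by simp
qed

text \<open>The elements commuting with z modulo the ideal form a subring. It contains the
  constants, the generators and h, hence all polynomials in h over the free algebra; these are
  h-adically dense, and closedness of the ideal covers the limits.\<close>

lemma commutator_mem: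
  fixes J :: "'n::finite falg set"
  assumes J: "two_sided_ideal J" and cl: "closed J" and g: "\<And>i j r. gen i j r * z - z * gen i j r \<in> J"
  shows "y * z - z * y \<in> J"
proof -
  interpret two_sided_ideal J by fact
  define Z where "Z = {y. y * z - z * y \<in> J}"
  have Z_add: "x + y \<in> Z" if "x \<in> Z" "y \<in> Z" for x y
    using add_mem[of "x * z - z * x" "y * z - z * y"] that by (simp add: Z_def algebra_simps)
  have mult: "x * y \<in> Z" if "x \<in> Z" "y \<in> Z" for x y
  proof -
    have "x * y * z - z * (x * y) = x * (y * z - z * y) + (x * z - z * x) * y"
      by (simp add: algebra_simps)
    then show ?thesis using that by (simp add: Z_def add_mem mult_left_mem mult_right_mem)
  qed
  have word: "fps_const (Poly_Mapping.single (Free_Word xs) c) \<in> Z" for xs c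
  proof (induction xs)
    case Nil
    have "fps_const (Poly_Mapping.single (Free_Word []) c) = (scalar (fps_const c) :: 'n falg)"
      by (rule fps_ext) (simp add: nth_scalar zero_free_word_def)
    then show ?case by (simp add: Z_def scalar_commute zero_mem)
  next
    case (Cons x xs)
    obtain i j r where x: "x = (i, j, r)" by (cases x)
    have "fps_const (Poly_Mapping.single (Free_Word (x # xs)) c) =
      gen i j r * fps_const (Poly_Mapping.single (Free_Word xs) c)"
      by (simp add: gen_def x mult_single plus_free_word_def)
    then show ?case using mult[OF _ Cons] g by (simp add: Z_def)
  qed
  have const: "fps_const p \<in> Z" for p
  proof (induction p rule: poly_mapping_additive_induct)
    case (single k v)
    then show ?case using word[of "letters k" v] by simp
  next
    case (add f g)
    then show ?case using Z_add[of "fps_const f" "fps_const g"] by simp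
  qed (simp add: Z_def zero_mem)
  have X: "fps_X ^ n \<in> Z" for n
    using fps_mult_fps_X_power_commute[of n z] by (simp add: Z_def zero_mem)
  have Z0: "0 \<in> Z" by (simp add: Z_def zero_mem)
  \<comment> \<open>The truncations of \<open>y\<close> modulo h^n. Each coefficient of their
    commutator with \<open>z\<close> is eventually constant, which is convergence in the h-adic
    topology.\<close>
  define S where "S = (\<lambda>n. \<Sum>i<n. fps_const (fps_nth y i) * fps_X ^ i)"
  have S: "S n \<in> Z" for n
  proof (induction n)
    case (Suc n)
    have "S (Suc n) = S n + fps_const (fps_nth y n) * fps_X ^ n" by (simp add: S_def)
    then show ?case using Z_add[OF Suc mult[OF const X]] by simp
  qed (simp add: S_def Z0)
  have Sy: "fps_nth (S n) k = (if k < n then fps_nth y k else 0)" for n k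
    by (simp add: S_def fps_sum_nth mult_delta_right sum.delta)
  have lim: "(\<lambda>n. S n * z - z * S n) \<longlonglongrightarrow> y * z - z * y"
    unfolding tendsto_fps_iff
  proof
    fix k
    have "eventually (\<lambda>n. fps_nth (S n * z - z * S n) k = fps_nth (y * z - z * y) k) sequentially"
      using eventually_gt_at_top[of k] by eventually_elim (simp add: fps_mult_nth Sy less_imp_diff_less)
    then show "eventually (\<lambda>n. fps_nth (S n * z - z * S n) k = fps_nth (y * z - z * y) k) sequentially" .
  qed
  show ?thesis
    by (rule closed_sequentially[OF cl _ lim]) (use S in \<open>simp add: Z_def\<close>)
qed

lemma falg_ring_a_inv: "\<ominus>\<^bsub>falg_ring\<^esub> x = - (x :: 'n falg)"
proof -
  interpret ring "falg_ring :: 'n falg ring" by (rule ring_falg_ring)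
  show ?thesis by (rule minus_equality) (simp_all add: falg_ring_def)
qed

lemma ideal_falg_ring_iff: "ideal J falg_ring \<longleftrightarrow> two_sided_ideal (J :: 'n::finite falg set)"
proof
  assume "ideal J falg_ring"
  then interpret ideal J falg_ring .
  show "two_sided_ideal J"
    using additive_subgroup.zero_closed[OF additive_subgroup_axioms]
      additive_subgroup.a_closed[OF additive_subgroup_axioms] I_l_closed I_r_closed
    by unfold_locales (auto simp: falg_ring_def)
next
  assume "two_sided_ideal J"
  then interpret two_sided_ideal J .
  interpret ring "falg_ring :: 'n falg ring" by (rule ring_falg_ring)
  show "ideal J falg_ring"
  proof (rule idealI)
    show "subgroup J (add_monoid falg_ring)"
    proof (rule group.subgroupI)
      show "Group.group (add_monoid (falg_ring :: 'n falg ring))"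
        by (rule add.is_group)
      show "inv\<^bsub>add_monoid falg_ring\<^esub> x \<in> J" if "x \<in> J" for x
        using minus_mem[OF that] falg_ring_a_inv[of x] by (simp add: a_inv_def)
    qed (use zero_mem add_mem in \<open>auto simp: falg_ring_def\<close>)
  qed (use ring_falg_ring mult_left_mem mult_right_mem in \<open>auto simp: falg_ring_def\<close>)
qed

lemma D_ideal_props:
  fixes R :: "('n::finite, complex fps) mat2"
  shows "torsion_free_ideal (D_ideal R M a c)" "closed (D_ideal R M a c)"
    "D_relations R M a c \<subseteq> D_ideal R M a c" "ideal (D_ideal R M a c) falg_ring"
proof -
  have ts: "two_sided_ideal (D_ideal R M a c)"
    by unfold_locales
      (auto simp: D_ideal_def ideal_falg_ring_iff intro: two_sided_ideal.zero_mem two_sided_ideal.add_mem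
        two_sided_ideal.mult_left_mem two_sided_ideal.mult_right_mem)
  then show "ideal (D_ideal R M a c) falg_ring" by (simp add: ideal_falg_ring_iff)
  show "torsion_free_ideal (D_ideal R M a c)"
    by (intro torsion_free_ideal.intro ts, unfold_locales) (auto simp: D_ideal_def)
  show "closed (D_ideal R M a c)"
    unfolding D_ideal_def by (rule closed_Inter) auto
  show "D_relations R M a c \<subseteq> D_ideal R M a c"
    unfolding D_ideal_def by blast
qed

theorem corollary6p4:
  fixes R :: "complex fps ^ ('n::finite \<times> 'n) ^ ('n \<times> 'n)"
    and N_R :: "complex fps ^ 'n ^ 'n"
    and M :: nat and a c :: complex
  assumes "CARD('n) \<ge> 2"
    and "hecke_symmetry R"
    and "skew_invertible R"
    and "has_rank_M0 R M"
    and "is_N_R R M N_R"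
    and "scalar_matrix N_R"
    and "a \<noteq> 0"
  shows "\<forall>n. D_class R M a c (fps_nth (qdet_T_plus R M) n) \<in> ring_center (D_algebra R M a c)"
proof
  fix n
  let ?J = "D_ideal R M a c"
  let ?q = "fps_nth (qdet_T_plus R M) n"
  interpret torsion_free_ideal ?J by (rule D_ideal_props)
  interpret I: ideal ?J falg_ring by (rule D_ideal_props)
  have comm: "y * ?q - ?q * y \<in> ?J" for y
    by (rule commutator_mem[OF two_sided_ideal_axioms D_ideal_props(2)])
      (rule qdet_commutes_generators[OF D_ideal_props(1,3) assms(2,4,5,6)])
  have carrier: "x \<in> carrier falg_ring" for x :: "'n falg"
    by (simp add: falg_ring_def)
  have coset: "?J +>\<^bsub>falg_ring\<^esub> (?q * y) = ?J +>\<^bsub>falg_ring\<^esub> (y * ?q)" for y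
  proof -
    have "?q * y - y * ?q \<in> ?J" using minus_mem[OF comm[of y]] by simp
    moreover have "(?q * y) \<ominus>\<^bsub>falg_ring\<^esub> (y * ?q) = ?q * y - y * ?q"
      by (simp add: a_minus_def falg_ring_a_inv) (simp add: falg_ring_def)
    ultimately show ?thesis
      using I.quotient_eq_iff_same_a_r_cos[OF I.ideal_axioms carrier carrier, of "?q * y" "y * ?q"] by simp
  qed
  show "D_class R M a c ?q \<in> ring_center (D_algebra R M a c)"
    unfolding ring_center_def
  proof (intro CollectI conjI ballI)
    show "D_class R M a c ?q \<in> carrier (D_algebra R M a c)"
      using carrier by (auto simp: D_class_def D_algebra_def FactRing_def A_RCOSETS_def')
    fix Y assume "Y \<in> carrier (D_algebra R M a c)"
    then obtain y where Y: "Y = ?J +>\<^bsub>falg_ring\<^esub> y"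
      by (auto simp: D_algebra_def FactRing_def A_RCOSETS_def')
    show "D_class R M a c ?q \<otimes>\<^bsub>D_algebra R M a c\<^esub> Y = Y \<otimes>\<^bsub>D_algebra R M a c\<^esub> D_class R M a c ?q"
      using I.rcoset_mult_add[OF carrier carrier] coset[of y]
      by (simp add: Y D_class_def D_algebra_def FactRing_def falg_ring_def)
  qed
qed

end
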